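(* $\mathbf{EQP} = \mathbf{ERQP} = \mathbf{EBQP}$.
   Context: For $0\le\delta<\epsilon\le 1$, $\mathbf{EBQP}_{\delta,\epsilon}$ is the class of languages $L\subseteq\{0,1\}^*$ for which there exist a uniform family of polynomial-size quantum circuits $\{C_n\}$, a uniform family of states $\ket{A_n}$ on $a_n$ ancilla qubits, and a uniform family of two-outcome projective measurements $\{\mathcal{P}_n=\langle P_{E,n}, I-P_{E,n}\rangle\}$, with $C_n$ and $\mathcal{P}_n$ acting on $n+a_n$ qubits, such that for every $n$ and every $x\in\{0,1\}^n$: if $x\notin L$, measuring $C_n(\ket{x}\otimes\ket{A_n})$ with $\mathcal{P}_n$ yields outcome $E$ with probability exactly $\delta$; if $x\in L$, it yields outcome $E$ with probability exactly $\epsilon$. $\mathbf{ERQP}_\epsilon = \mathbf{EBQP}_{0,\epsilon}$, $\mathbf{EBQP}=\bigcup_{\epsilon>\delta\ge0}\mathbf{EBQP}_{\delta,\epsilon}$ and $\mathbf{ERQP}=\bigcup_{\epsilon>0}\mathbf{ERQP}_\epsilon$. $\mathbf{EQP}$ is the class of languages decided with certainty (zero error) by uniform families of polynomial-size quantum circuits; equivalently $\mathbf{EQP}=\mathbf{EBQP}_{0,1}$. *)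

theory Defs
  imports "Jordan_Normal_Form.Schur_Decomposition"
begin

section \<open>Polynomial-time uniformity\<close>

text \<open>
  Uniformity is polynomial-time uniformity. The underlying machine is a structured program over
  finitely many stacks of symbols. A program mentions only finitely many registers and symbols, and
  every elementary step pushes, pops or inspects one symbol; as two stacks simulate a work tape and
  conversely, these programs are polynomially equivalent to multitape Turing machines.
\<close>

datatype prog =
    Skip
  | Push nat nat
  | Pop nat
  | Seq prog prog
  | Cond nat nat prog prog
  | Loop nat nat prog

definition top_is :: "(nat \<Rightarrow> nat list) \<Rightarrow> nat \<Rightarrow> nat \<Rightarrow> bool" where
  "top_is s r c \<longleftrightarrow> (\<exists>xs. s r = c # xs)"

text \<open>\<open>exec p s t s'\<close>: started in \<open>s\<close>, program \<open>p\<close> halts in \<open>s'\<close> after \<open>t\<close> steps.\<close>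

inductive exec :: "prog \<Rightarrow> (nat \<Rightarrow> nat list) \<Rightarrow> nat \<Rightarrow> (nat \<Rightarrow> nat list) \<Rightarrow> bool" where
  Skip: "exec Skip s 1 s"
| Push: "exec (Push r c) s 1 (s(r := c # s r))"
| Pop: "exec (Pop r) s 1 (s(r := tl (s r)))"
| Seq: "exec p s t s' \<Longrightarrow> exec q s' u s'' \<Longrightarrow> exec (Seq p q) s (t + u) s''"
| Cond_True: "top_is s r c \<Longrightarrow> exec p s t s' \<Longrightarrow> exec (Cond r c p q) s (Suc t) s'"
| Cond_False: "\<not> top_is s r c \<Longrightarrow> exec q s t s' \<Longrightarrow> exec (Cond r c p q) s (Suc t) s'"
| Loop_False: "\<not> top_is s r c \<Longrightarrow> exec (Loop r c p) s 1 s"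
| Loop_True: "top_is s r c \<Longrightarrow> exec p s t s' \<Longrightarrow> exec (Loop r c p) s' u s''
    \<Longrightarrow> exec (Loop r c p) s (Suc (t + u)) s''"

text \<open>The input \<open>n\<close> is given in unary in register 0; the output is read off register 0. The bound
  \<open>n ^ k + k\<close> with arbitrary \<open>k\<close> dominates every polynomial.\<close>

definition polytime :: "(nat \<Rightarrow> nat list) \<Rightarrow> bool" where
  "polytime f \<longleftrightarrow> (\<exists>p k. \<forall>n. \<exists>t s.
     exec p ((\<lambda>_. [])(0 := replicate n 0)) t s \<and> s 0 = f n \<and> t \<le> n ^ k + k)"


section \<open>Qubits and circuits\<close>

text \<open>
  A state of \<open>m\<close> qubits is a vector of dimension \<open>2 ^ m\<close>. The basis state with index \<open>i\<close> has qubit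
  \<open>w\<close> equal to \<open>bit i w\<close>, so a bit string is placed on wires \<open>0, 1, \<dots>\<close> in reading order, and in a
  tensor product \<open>u \<otimes> v\<close> the first factor occupies the lower-numbered wires.
\<close>

definition ket :: "bool list \<Rightarrow> complex vec" where
  "ket x = unit_vec (2 ^ length x) (horner_sum of_bool 2 x)"

definition ket0 :: "nat \<Rightarrow> complex vec" where
  "ket0 m = ket (replicate m False)"

definition tensor_state :: "nat \<Rightarrow> complex vec \<Rightarrow> nat \<Rightarrow> complex vec \<Rightarrow> complex vec" where
  "tensor_state m u b v = vec (2 ^ (m + b)) (\<lambda>i. u $ take_bit m i * v $ drop_bit m i)"

definition norm_sq :: "complex vec \<Rightarrow> real" where
  "norm_sq v = (\<Sum>i<dim_vec v. (cmod (v $ i))\<^sup>2)"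

definition unitary_mat :: "nat \<Rightarrow> complex mat \<Rightarrow> bool" where
  "unitary_mat d U \<longleftrightarrow> U \<in> carrier_mat d d \<and> mat_adjoint U * U = 1\<^sub>m d \<and> U * mat_adjoint U = 1\<^sub>m d"

definition projection_mat :: "nat \<Rightarrow> complex mat \<Rightarrow> bool" where
  "projection_mat d P \<longleftrightarrow> P \<in> carrier_mat d d \<and> mat_adjoint P = P \<and> P * P = P"

text \<open>Probability of outcome \<open>P\<close> when the state \<open>v\<close> is measured with \<open>\<langle>P, I - P\<rangle>\<close>.\<close>

definition outcome_prob :: "complex mat \<Rightarrow> complex vec \<Rightarrow> real" where
  "outcome_prob P v = norm_sq (P *\<^sub>v v)"

text \<open>The outcome ``qubit 0 is 1'' of a measurement in the standard basis.\<close>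

definition qubit0_proj :: "nat \<Rightarrow> complex mat" where
  "qubit0_proj m = mat (2 ^ m) (2 ^ m) (\<lambda>(i, j). of_bool (i = j \<and> bit i 0))"

text \<open>A circuit is its number of wires together with a sequence of gates, each a matrix with
  the list of wires it is applied to; the \<open>l\<close>-th listed wire is qubit \<open>l\<close> of the gate.\<close>

type_synonym circuit = "nat \<times> (complex mat \<times> nat list) list"

definition gate_wf :: "nat \<Rightarrow> complex mat \<times> nat list \<Rightarrow> bool" where
  "gate_wf m = (\<lambda>(U, ws). distinct ws \<and> set ws \<subseteq> {..<m} \<and> unitary_mat (2 ^ length ws) U)"

definition circuit_wf :: "circuit \<Rightarrow> bool" where
  "circuit_wf C \<longleftrightarrow> (\<forall>g \<in> set (snd C). gate_wf (fst C) g)"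

text \<open>The gate \<open>U\<close> on the wires \<open>ws\<close>, tensored with the identity on all other wires.\<close>

definition gate_mat :: "nat \<Rightarrow> complex mat \<times> nat list \<Rightarrow> complex mat" where
  "gate_mat m = (\<lambda>(U, ws). mat (2 ^ m) (2 ^ m) (\<lambda>(i, j).
     if \<forall>w<m. w \<notin> set ws \<longrightarrow> bit i w = bit j w
     then U $$ (horner_sum of_bool 2 (map (bit i) ws), horner_sum of_bool 2 (map (bit j) ws))
     else 0))"

definition run_circuit :: "circuit \<Rightarrow> complex vec \<Rightarrow> complex vec" where
  "run_circuit C v = fold (\<lambda>g u. gate_mat (fst C) g *\<^sub>v u) (snd C) v"


section \<open>Uniform families\<close>

text \<open>
  A circuit description refers to gates by their position in a gate list. It is written over a
  finite alphabet, with numbers in unary: 0 is the unary digit, 1 ends a number, and \<open>g + 2\<close> names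
  gate \<open>g\<close>.
\<close>

type_synonym circuit_desc = "nat \<times> (nat \<times> nat list) list"

definition encode_nat :: "nat \<Rightarrow> nat list" where
  "encode_nat w = replicate w 0 @ [1]"

definition encode_circuit :: "circuit_desc \<Rightarrow> nat list" where
  "encode_circuit = (\<lambda>(m, gs).
     encode_nat m @ concat (map (\<lambda>(g, ws). (g + 2) # concat (map encode_nat ws)) gs))"

definition interpret_circuit :: "complex mat list \<Rightarrow> circuit_desc \<Rightarrow> circuit" where
  "interpret_circuit G = (\<lambda>(m, gs). (m, map (\<lambda>(g, ws). (G ! g, ws)) gs))"

text \<open>
  A uniform family of circuits uses a finite set \<open>G\<close> of unitary gates that is fixed for the whole
  family and is otherwise arbitrary, and its circuits are written down in polynomial time, whence
  they have polynomial size. No computability of the entries of the gates is demanded. This does not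
  affect the class EQP (Adleman, DeMarrais and Huang, Quantum Computability, 1997): the requirements
  of unitarity and zero error on the entries of the gates are polynomial equations over the
  rationals, and if these have a solution, they have one in algebraic, hence efficiently
  computable, numbers.
\<close>

definition uniform_circuits :: "(nat \<Rightarrow> circuit) \<Rightarrow> bool" where
  "uniform_circuits C \<longleftrightarrow> (\<exists>(G :: complex mat list) (D :: nat \<Rightarrow> circuit_desc).
     polytime (\<lambda>n. encode_circuit (D n)) \<and>
     (\<forall>n. (\<forall>(g, ws) \<in> set (snd (D n)). g < length G) \<and>
          C n = interpret_circuit G (D n) \<and> circuit_wf (C n)))"

text \<open>Uniform states and measurements are those realised exactly by uniform circuits, which may use
  further work qubits: a state is prepared from the all-zero state, and a measurement is reduced to
  a standard measurement of one qubit.\<close>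

definition uniform_states :: "(nat \<Rightarrow> nat) \<Rightarrow> (nat \<Rightarrow> complex vec) \<Rightarrow> bool" where
  "uniform_states a A \<longleftrightarrow>
     (\<forall>n. A n \<in> carrier_vec (2 ^ a n) \<and> norm_sq (A n) = 1) \<and>
     (\<exists>C b. uniform_circuits C \<and>
        (\<forall>n. fst (C n) = a n + b n \<and>
             run_circuit (C n) (ket0 (a n + b n)) =
               tensor_state (a n) (A n) (b n) (ket0 (b n))))"

definition uniform_measurements :: "(nat \<Rightarrow> nat) \<Rightarrow> (nat \<Rightarrow> complex mat) \<Rightarrow> bool" where
  "uniform_measurements m P \<longleftrightarrow>
     (\<forall>n. projection_mat (2 ^ m n) (P n)) \<and>
     (\<exists>C b. uniform_circuits C \<and>
        (\<forall>n. fst (C n) = m n + b n \<and> 0 < m n + b n \<and>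
             (\<forall>v \<in> carrier_vec (2 ^ m n).
                outcome_prob (qubit0_proj (m n + b n))
                  (run_circuit (C n) (tensor_state (m n) v (b n) (ket0 (b n)))) =
                outcome_prob (P n) v)))"


section \<open>Complexity classes\<close>

type_synonym language = "bool list set"

definition EBQP_with :: "real \<Rightarrow> real \<Rightarrow> language set" where
  "EBQP_with \<delta> \<epsilon> = {L. \<exists>a C A P.
     uniform_circuits C \<and> (\<forall>n. fst (C n) = n + a n) \<and>
     uniform_states a A \<and> uniform_measurements (\<lambda>n. n + a n) P \<and>
     (\<forall>n x. length x = n \<longrightarrow>
        outcome_prob (P n) (run_circuit (C n) (tensor_state n (ket x) (a n) (A n))) =
          (if x \<in> L then \<epsilon> else \<delta>))}"

definition ERQP_with :: "real \<Rightarrow> language set" where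
  "ERQP_with \<epsilon> = EBQP_with 0 \<epsilon>"

definition EBQP :: "language set" where
  "EBQP = (\<Union>(\<delta>, \<epsilon>) \<in> {(\<delta>, \<epsilon>). 0 \<le> \<delta> \<and> \<delta> < \<epsilon> \<and> \<epsilon> \<le> 1}. EBQP_with \<delta> \<epsilon>)"

definition ERQP :: "language set" where
  "ERQP = (\<Union>\<epsilon> \<in> {0<..1}. ERQP_with \<epsilon>)"

text \<open>EQP is defined directly: the input and all-zero ancillas are fed to the circuit, and a
  standard measurement of qubit 0 gives the correct answer with certainty.\<close>

definition EQP :: "language set" where
  "EQP = {L. \<exists>a C.
     uniform_circuits C \<and> (\<forall>n. fst (C n) = n + a n \<and> 0 < n + a n) \<and>
     (\<forall>n x. length x = n \<longrightarrow>
        outcome_prob (qubit0_proj (n + a n))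
          (run_circuit (C n) (tensor_state n (ket x) (a n) (ket0 (a n)))) =
          (if x \<in> L then 1 else 0))}"

end

theory Submission
  imports Defs
begin

text \<open>
  Measuring an EBQP computation amounts to measuring qubit 0 of a circuit that accepts with probability
  exactly \<open>\<epsilon>\<close> or exactly \<open>\<delta>\<close>. Two operations on such circuits change the acceptance probability \<open>p\<close> in a
  controlled way. A rotation of a fresh qubit controlled by qubit 0 realises every affine map of \<open>[0, 1]\<close> into
  itself. Running the circuit \<open>W\<close> on a copy of the input, reflecting about the accepting subspace, running
  \<open>W\<close> backwards and testing whether the initial state has been recovered realises \<open>p \<mapsto> 4 * p * (1 - p)\<close>, since
  the amplitude of the initial state is \<open>1 - 2 * p\<close> then. A constant number of these maps takes \<open>(\<delta>, \<epsilon>)\<close>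
  to \<open>(0, 1)\<close>: rescale the larger probability to 1/2, amplify it to 1 and complement, so that one of
  the two probabilities is 0; amplify until the other one is at least 1/2, rescale it to 1/2 and amplify once more.
\<close>

section \<open>Polynomial growth and stack programs\<close>

text \<open>Amplification in the usual sense only makes an error small. Here the two probabilities
  are known constants, and a known probability can be steered to an exact value. Two features of the
  model matter: gate entries may be arbitrary reals, so the rotations may contain the square root of
  any number in [0, 1], and the number of rounds depends on \<delta> and \<epsilon> alone, so the
  gate list stays finite and the same for all input lengths. The reason for working on a copy is
  that a circuit may destroy its input: an untouched original turns the question whether the initial
  state has been recovered into a comparison by classical gates. The bulk of the work is uniformity,
  since every new circuit description has to be written by a stack program. To keep the programming
  finite, one program scheme is verified for all finite-state transducers; renaming gates, shifting
  wires, emitting regular families of gates and inverting a circuit are then transductions of the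
  encoded descriptions, or compositions of a few of them.\<close>

definition poly_bounded :: "(nat \<Rightarrow> nat) \<Rightarrow> bool" where
  "poly_bounded T \<longleftrightarrow> (\<exists>c k. \<forall>n. T n \<le> c * Suc n ^ k)"

lemma poly_boundedI: "(\<And>n. T n \<le> c * Suc n ^ k) \<Longrightarrow> poly_bounded T"
  unfolding poly_bounded_def by blast

lemma poly_bounded_const [simp]: "poly_bounded (\<lambda>_. c)"
  by (rule poly_boundedI[of _ c 0]) simp

lemma poly_bounded_id [simp]: "poly_bounded (\<lambda>n. n)"
  by (rule poly_boundedI[of _ 1 1]) simp

lemma poly_bounded_mono: "poly_bounded T \<Longrightarrow> (\<And>n. U n \<le> T n) \<Longrightarrow> poly_bounded U"
  unfolding poly_bounded_def by (meson le_trans)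

lemma poly_bounded_add [intro]:
  assumes "poly_bounded T" "poly_bounded U"
  shows "poly_bounded (\<lambda>n. T n + U n)"
proof -
  obtain c k d l where T: "\<And>n. T n \<le> c * Suc n ^ k" and U: "\<And>n. U n \<le> d * Suc n ^ l"
    using assms unfolding poly_bounded_def by blast
  show ?thesis
  proof (rule poly_boundedI[of _ "c + d" "k + l"])
    fix n
    have "Suc n ^ k \<le> Suc n ^ (k + l)" "Suc n ^ l \<le> Suc n ^ (k + l)"
      by (rule power_increasing; simp)+
    then have "c * Suc n ^ k \<le> c * Suc n ^ (k + l)" "d * Suc n ^ l \<le> d * Suc n ^ (k + l)"
      by (simp_all only: mult_le_mono2)
    then show "T n + U n \<le> (c + d) * Suc n ^ (k + l)"
      using T[of n] U[of n] by (simp only: distrib_right)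
  qed
qed

lemma poly_bounded_mult [intro]:
  assumes "poly_bounded T" "poly_bounded U"
  shows "poly_bounded (\<lambda>n. T n * U n)"
proof -
  obtain c k d l where T: "\<And>n. T n \<le> c * Suc n ^ k" and U: "\<And>n. U n \<le> d * Suc n ^ l"
    using assms unfolding poly_bounded_def by blast
  show ?thesis
  proof (rule poly_boundedI[of _ "c * d" "k + l"])
    fix n
    show "T n * U n \<le> c * d * Suc n ^ (k + l)"
      using mult_le_mono[OF T[of n] U[of n]] by (simp only: power_add ac_simps)
  qed
qed

lemma poly_bounded_power_add: "poly_bounded (\<lambda>n. n ^ k + k)"
proof (rule poly_boundedI[of _ "Suc k" k])
  fix n
  have "n ^ k \<le> Suc n ^ k" by (simp add: power_mono)
  moreover have "k \<le> k * Suc n ^ k" by simp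
  ultimately show "n ^ k + k \<le> Suc k * Suc n ^ k" unfolding mult_Suc by (rule add_mono)
qed

text \<open>Bounds c * (n + 1) ^ k are stable under sums and products, whereas
  \<open>polytime\<close> wants n ^ k + k. For n \<ge> 2 the constant goes into the exponent, as c
  \<le> 2 ^ c \<le> n ^ c and n + 1 \<le> n ^ 2; for n \<le> 1 the additive term pays.\<close>

lemma poly_bounded_imp_power_add:
  assumes "poly_bounded T"
  shows "\<exists>k. \<forall>n. T n \<le> n ^ k + k"
proof -
  obtain c k where T: "\<And>n. T n \<le> c * Suc n ^ k"
    using assms unfolding poly_bounded_def by blast
  define m where "m = c + 2 * k + c * 2 ^ k"
  have "T n \<le> n ^ m + m" for n
  proof (cases "n \<le> 1")
    case True
    have "c * Suc n ^ k \<le> c * 2 ^ k"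
      using True by (intro mult_le_mono2 power_mono) auto
    then show ?thesis using T[of n] unfolding m_def by linarith
  next
    case False
    then have n: "2 \<le> n" by simp
    have "c \<le> 2 ^ c" by (simp add: less_imp_le)
    also have "\<dots> \<le> n ^ c" using n by (rule power_mono) simp
    finally have 1: "c \<le> n ^ c" .
    have "Suc n \<le> 2 * n" using n by linarith
    also have "\<dots> \<le> n ^ 2" using n by (simp add: power2_eq_square)
    finally have "Suc n ^ k \<le> (n ^ 2) ^ k" by (rule power_mono) simp
    with 1 have "c * Suc n ^ k \<le> n ^ c * (n ^ 2) ^ k" by (rule mult_le_mono)
    also have "\<dots> = n ^ (c + 2 * k)" by (simp add: power_add power_mult)
    also have "\<dots> \<le> n ^ m" using n unfolding m_def by (intro power_increasing) auto
    finally show ?thesis using T[of n] by linarith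
  qed
  then show ?thesis by blast
qed


section \<open>Execution, relocation and subroutine calls\<close>

lemma top_is_Nil [simp]: "s r = [] \<Longrightarrow> \<not> top_is s r c"
  by (simp add: top_is_def)

lemma top_is_Cons [simp]: "s r = d # xs \<Longrightarrow> top_is s r c \<longleftrightarrow> d = c"
  by (simp add: top_is_def)

lemma exec_length: "exec p s t s' \<Longrightarrow> length (s' r) \<le> length (s r) + t"
  by (induction rule: exec.induct) auto

primrec rename_regs :: "(nat \<Rightarrow> nat) \<Rightarrow> prog \<Rightarrow> prog" where
  "rename_regs f Skip = Skip"
| "rename_regs f (Push r c) = Push (f r) c"
| "rename_regs f (Pop r) = Pop (f r)"
| "rename_regs f (Seq p q) = Seq (rename_regs f p) (rename_regs f q)"
| "rename_regs f (Cond r c p q) = Cond (f r) c (rename_regs f p) (rename_regs f q)"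
| "rename_regs f (Loop r c p) = Loop (f r) c (rename_regs f p)"

text \<open>\<open>S\<close> is any larger configuration that shows \<open>s\<close> through
  \<open>f\<close>; injectivity keeps distinct registers apart. The running time is preserved, and
  whatever lies outside the range of \<open>f\<close> is safe during the call.\<close>

lemma exec_rename_regs:
  assumes "exec p s t s'" "inj f" "S \<circ> f = s"
  shows "\<exists>S'. exec (rename_regs f p) S t S' \<and> S' \<circ> f = s' \<and> (\<forall>r. r \<notin> range f \<longrightarrow> S' r = S r)"
  using assms
proof (induction arbitrary: S rule: exec.induct)
  case (Skip s)
  then show ?case by (intro exI[of _ S]) (auto intro: exec.Skip[unfolded One_nat_def])
next
  case (Push r c s)
  then show ?case
    by (intro exI[of _ "S(f r := c # S (f r))"] conjI, unfold rename_regs.simps, intro exec.Push)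
      (auto simp: fun_eq_iff inj_eq)
next
  case (Pop r s)
  then show ?case
    by (intro exI[of _ "S(f r := tl (S (f r)))"] conjI, unfold rename_regs.simps, intro exec.Pop)
      (auto simp: fun_eq_iff inj_eq)
next
  case (Seq p s t s' q u s'')
  obtain S' where S': "exec (rename_regs f p) S t S'" "S' \<circ> f = s'" "\<forall>r. r \<notin> range f \<longrightarrow> S' r = S r"
    using Seq.IH(1) Seq.prems by blast
  obtain S'' where "exec (rename_regs f q) S' u S''" "S'' \<circ> f = s''"
      "\<forall>r. r \<notin> range f \<longrightarrow> S'' r = S' r"
    using Seq.IH(2) Seq.prems S' by blast
  then show ?case using S' by (auto intro!: exec.Seq)
next
  case (Cond_True s r c p t s' q)
  then have "top_is S (f r) c" by (auto simp: top_is_def)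
  then show ?case using Cond_True.IH[OF Cond_True.prems] by (auto intro: exec.Cond_True)
next
  case (Cond_False s r c q t s' p)
  then have "\<not> top_is S (f r) c" by (auto simp: top_is_def)
  then show ?case using Cond_False.IH[OF Cond_False.prems] by (auto intro: exec.Cond_False)
next
  case (Loop_False s r c p)
  then have "\<not> top_is S (f r) c" by (auto simp: top_is_def)
  then show ?case using Loop_False
    by (intro exI[of _ S] conjI, unfold rename_regs.simps, intro exec.Loop_False) auto
next
  case (Loop_True s r c p t s' u s'')
  have top: "top_is S (f r) c" using Loop_True by (auto simp: top_is_def)
  obtain S' where S': "exec (rename_regs f p) S t S'" "S' \<circ> f = s'" "\<forall>r. r \<notin> range f \<longrightarrow> S' r = S r"
    using Loop_True.IH(1) Loop_True.prems by blast
  obtain S'' where "exec (rename_regs f (Loop r c p)) S' u S''" "S'' \<circ> f = s''"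
      "\<forall>r. r \<notin> range f \<longrightarrow> S'' r = S' r"
    using Loop_True.IH(2) Loop_True.prems S' by blast
  then show ?case using S' exec.Loop_True[OF top S'(1)]
    by (intro exI[of _ S'']) auto
qed

primrec reg_bound :: "prog \<Rightarrow> nat" where
  "reg_bound Skip = 0"
| "reg_bound (Push r c) = Suc r"
| "reg_bound (Pop r) = Suc r"
| "reg_bound (Seq p q) = max (reg_bound p) (reg_bound q)"
| "reg_bound (Cond r c p q) = max (reg_bound p) (reg_bound q)"
| "reg_bound (Loop r c p) = reg_bound p"

lemma exec_reg_bound: "exec p s t s' \<Longrightarrow> reg_bound p \<le> r \<Longrightarrow> s' r = s r"
  by (induction rule: exec.induct) auto

text \<open>A subroutine based at register \<open>K\<close>. \<open>polytime\<close> speaks only of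
  runs in which all other registers are empty, hence the condition above \<open>K\<close>; the data
  of the caller lie below \<open>K\<close> and survive; from \<open>K + B\<close> on everything is
  empty, so a further call can be based there.\<close>

definition callable :: "(nat \<Rightarrow> nat list) \<Rightarrow> prog \<Rightarrow> nat \<Rightarrow> (nat \<Rightarrow> nat) \<Rightarrow> bool" where
  "callable f p B T \<longleftrightarrow> poly_bounded T \<and> 0 < B \<and>
     (\<forall>K n S. S K = replicate n 0 \<longrightarrow> (\<forall>r>K. S r = []) \<longrightarrow>
       (\<exists>t S'. exec (rename_regs ((+) K) p) S t S' \<and> t \<le> T n \<and> S' K = f n \<and>
         (\<forall>r<K. S' r = S r) \<and> (\<forall>r\<ge>K + B. S' r = [])))"

lemma polytime_callable:
  assumes "polytime f"
  shows "\<exists>p B T. callable f p B T"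
proof -
  obtain p k where p: "\<And>n. \<exists>t s. exec p ((\<lambda>_. [])(0 := replicate n 0)) t s \<and> s 0 = f n \<and> t \<le> n ^ k + k"
    using assms unfolding polytime_def by blast
  have "callable f p (Suc (reg_bound p)) (\<lambda>n. n ^ k + k)"
    unfolding callable_def
  proof (intro conjI allI impI)
    show "poly_bounded (\<lambda>n. n ^ k + k)" by (rule poly_bounded_power_add)
    show "0 < Suc (reg_bound p)" by simp
    fix K n and S :: "nat \<Rightarrow> nat list"
    assume S: "S K = replicate n 0" "\<forall>r>K. S r = []"
    obtain t s where s: "exec p ((\<lambda>_. [])(0 := replicate n 0)) t s" "s 0 = f n" "t \<le> n ^ k + k"
      using p by blast
    have "S \<circ> (+) K = (\<lambda>_. [])(0 := replicate n 0)"
      using S by (auto simp: fun_eq_iff)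
    from exec_rename_regs[OF s(1) _ this] obtain S' where
      S': "exec (rename_regs ((+) K) p) S t S'" "S' \<circ> (+) K = s" "\<forall>r. r \<notin> range ((+) K) \<longrightarrow> S' r = S r"
      by auto
    have "S' K = f n" using fun_cong[OF S'(2), of 0] s(2) by simp
    moreover have "\<forall>r<K. S' r = S r" using S'(3) by (auto simp: image_iff)
    moreover have "S' r = []" if "r \<ge> K + Suc (reg_bound p)" for r
    proof -
      have "S' r = s (r - K)" using fun_cong[OF S'(2), of "r - K"] that by simp
      also have "\<dots> = []" using exec_reg_bound[OF s(1), of "r - K"] that by simp
      finally show ?thesis .
    qed
    ultimately show "\<exists>t S'. exec (rename_regs ((+) K) p) S t S' \<and> t \<le> n ^ k + k \<and> S' K = f n \<and>
         (\<forall>r<K. S' r = S r) \<and> (\<forall>r\<ge>K + Suc (reg_bound p). S' r = [])"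
      using S'(1) s(3) by blast
  qed
  then show ?thesis by blast
qed


section \<open>Time-bounded runs and stack loops\<close>

definition runs :: "prog \<Rightarrow> (nat \<Rightarrow> nat list) \<Rightarrow> nat \<Rightarrow> (nat \<Rightarrow> nat list) \<Rightarrow> bool" where
  "runs p S T S' \<longleftrightarrow> (\<exists>t\<le>T. exec p S t S')"

lemma runs_mono: "runs p S T S' \<Longrightarrow> T \<le> U \<Longrightarrow> runs p S U S'"
  unfolding runs_def by (meson le_trans)

lemma runs_cong: "runs p S T S' \<Longrightarrow> T = U \<Longrightarrow> S' = S'' \<Longrightarrow> runs p S U S''"
  by simp

lemma runs_Skip: "runs Skip S 1 S"
  unfolding runs_def using exec.Skip by blast

lemma runs_Push: "runs (Push r c) S 1 (S(r := c # S r))"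
  unfolding runs_def using exec.Push by blast

lemma runs_Pop: "runs (Pop r) S 1 (S(r := tl (S r)))"
  unfolding runs_def using exec.Pop by blast

lemma runs_Seq: "runs p S T S' \<Longrightarrow> runs q S' U S'' \<Longrightarrow> runs (Seq p q) S (T + U) S''"
  unfolding runs_def using exec.Seq by (meson add_mono)

text \<open>\<open>Cond\<close> compares the top with one fixed symbol, so a dispatch is a chain of
  comparisons over an alphabet of known size; the empty stack fails them all and leads to
  \<open>e\<close>.\<close>

primrec case_top :: "nat \<Rightarrow> nat \<Rightarrow> (nat \<Rightarrow> prog) \<Rightarrow> prog \<Rightarrow> prog" where
  "case_top r 0 body e = e"
| "case_top r (Suc A) body e = Cond r A (body A) (case_top r A body e)"

lemma runs_case_top:
  assumes "S r = c # cs" "c < A" "runs (body c) S T S'"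
  shows "runs (case_top r A body e) S (T + A) S'"
  using assms(2)
proof (induction A)
  case (Suc A)
  show ?case
  proof (cases "c = A")
    case True
    then obtain t where "t \<le> T" "exec (body A) S t S'" using assms unfolding runs_def by blast
    moreover have "top_is S r A" using assms True by simp
    ultimately show ?thesis unfolding runs_def case_top.simps
      by (intro exI[of _ "Suc t"]) (auto intro: exec.Cond_True)
  next
    case False
    then have "runs (case_top r A body e) S (T + A) S'" using Suc by simp
    then obtain t where "t \<le> T + A" "exec (case_top r A body e) S t S'" unfolding runs_def by blast
    moreover have "\<not> top_is S r A" using assms False by simp
    ultimately show ?thesis unfolding runs_def case_top.simps
      by (intro exI[of _ "Suc t"]) (auto intro: exec.Cond_False)
  qed
qed simp

lemma runs_case_top_Nil:
  assumes "S r = []" "runs e S T S'"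
  shows "runs (case_top r A body e) S (T + A) S'"
proof (induction A)
  case (Suc A)
  then obtain t where "t \<le> T + A" "exec (case_top r A body e) S t S'" unfolding runs_def by blast
  moreover have "\<not> top_is S r A" using assms by simp
  ultimately show ?case unfolding runs_def case_top.simps
    by (intro exI[of _ "Suc t"]) (auto intro: exec.Cond_False)
qed (use assms in simp)

text \<open>\<open>Loop\<close> can wait only for one fixed symbol and cannot ask whether a stack is
  nonempty. The loop therefore runs on a flag in \<open>F\<close>, which is dropped when the
  dispatch finds \<open>r\<close> empty; \<open>body\<close> has to pop its symbol itself.\<close>

definition drain :: "nat \<Rightarrow> nat \<Rightarrow> nat \<Rightarrow> (nat \<Rightarrow> prog) \<Rightarrow> prog" where
  "drain F r A body = Seq (Push F 0) (Loop F 0 (case_top r A body (Pop F)))"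

text \<open>Induction on the unread symbols, with \<open>P\<close> as loop invariant; each round
  costs the body, at most \<open>A\<close> comparisons and one test of the flag.\<close>

lemma runs_drain:
  assumes step: "\<And>c cs S. c < A \<Longrightarrow> P (c # cs) S \<Longrightarrow> S r = c # cs \<Longrightarrow> S F = [0] \<Longrightarrow>
      \<exists>S'. runs (body c) S T S' \<and> P cs S' \<and> S' r = cs \<and> S' F = [0]"
    and P: "P (S r) (S(F := [0]))" and F: "S F = []" "F \<noteq> r" and A: "set (S r) \<subseteq> {..<A}"
  shows "\<exists>S'. runs (drain F r A body) S (length (S r) * (T + A + 1) + A + 4) (S'(F := [])) \<and> P [] S' \<and> S' r = []"
proof -
  let ?L = "Loop F 0 (case_top r A body (Pop F))"
  have loop: "\<exists>S'. runs ?L S (length cs * (T + A + 1) + A + 3) (S'(F := [])) \<and> P [] S' \<and> S' r = []"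
    if "P cs S" "S r = cs" "S F = [0]" "set cs \<subseteq> {..<A}" for cs S
    using that
  proof (induction cs arbitrary: S)
    case Nil
    have "runs (case_top r A body (Pop F)) S (1 + A) (S(F := tl (S F)))"
      using Nil by (intro runs_case_top_Nil runs_Pop) auto
    then obtain t where t: "t \<le> 1 + A" "exec (case_top r A body (Pop F)) S t (S(F := []))"
      using Nil unfolding runs_def by auto
    have "exec ?L S (Suc (t + 1)) (S(F := []))"
      using Nil t by (intro exec.Loop_True[OF _ t(2)] exec.Loop_False) auto
    then have "runs ?L S (A + 3) (S(F := []))"
      using t unfolding runs_def by (intro exI[of _ "Suc (t + 1)"]) auto
    then have "runs ?L S (length [] * (T + A + 1) + A + 3) (S(F := []))" by (simp del: fun_upd_apply)
    then show ?case using Nil by blast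
  next
    case (Cons c cs)
    obtain S1 where S1: "runs (body c) S T S1" "P cs S1" "S1 r = cs" "S1 F = [0]"
      using step[of c cs S] Cons.prems by auto
    have "runs (case_top r A body (Pop F)) S (T + A) S1"
      using Cons.prems S1 by (intro runs_case_top) auto
    then obtain t where t: "t \<le> T + A" "exec (case_top r A body (Pop F)) S t S1"
      unfolding runs_def by auto
    have cs: "set cs \<subseteq> {..<A}" using Cons.prems by simp
    obtain S2 where S2: "runs ?L S1 (length cs * (T + A + 1) + A + 3) (S2(F := []))" "P [] S2" "S2 r = []"
      using Cons.IH[OF S1(2,3,4) cs] by blast
    then obtain u where u: "u \<le> length cs * (T + A + 1) + A + 3" "exec ?L S1 u (S2(F := []))"
      unfolding runs_def by auto
    have "exec ?L S (Suc (t + u)) (S2(F := []))"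
      using Cons.prems t u by (intro exec.Loop_True) auto
    then have "runs ?L S (length (c # cs) * (T + A + 1) + A + 3) (S2(F := []))"
      using t u unfolding runs_def by (intro exI[of _ "Suc (t + u)"]) auto
    then show ?case using S2 by blast
  qed
  obtain S' where S': "runs ?L (S(F := [0])) (length (S r) * (T + A + 1) + A + 3) (S'(F := []))"
      "P [] S'" "S' r = []"
    using loop[OF P] F A by auto
  have "runs (drain F r A body) S (1 + (length (S r) * (T + A + 1) + A + 3)) (S'(F := []))"
    unfolding drain_def by (rule runs_Seq[OF _ S'(1)]) (use runs_Push[of F 0 S] F in simp)
  then have "runs (drain F r A body) S (length (S r) * (T + A + 1) + A + 4) (S'(F := []))"
    by (rule runs_mono) simp
  then show ?thesis using S' by blast
qed

text \<open>Pouring reverses, so two pours move a string intact; several targets in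
  \<open>rs\<close> give copies, and an empty \<open>rs\<close> erases.\<close>

definition pour :: "nat \<Rightarrow> nat \<Rightarrow> nat \<Rightarrow> nat list \<Rightarrow> prog" where
  "pour F r A rs = drain F r A (\<lambda>c. Seq (Pop r) (foldr (\<lambda>q p. Seq (Push q c) p) rs Skip))"

lemma runs_pushes:
  "distinct rs \<Longrightarrow> runs (foldr (\<lambda>q p. Seq (Push q c) p) rs Skip) S (Suc (length rs))
     (\<lambda>x. if x \<in> set rs then c # S x else S x)"
proof (induction rs arbitrary: S)
  case Nil
  show ?case using runs_Skip[of S] by simp
next
  case (Cons q rs)
  let ?S = "S(q := c # S q)"
  have "runs (foldr (\<lambda>q p. Seq (Push q c) p) (q # rs) Skip) S (1 + Suc (length rs))
     (\<lambda>x. if x \<in> set rs then c # ?S x else ?S x)"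
    unfolding foldr_Cons o_def
    by (rule runs_Seq[OF runs_Push Cons.IH]) (use Cons.prems in auto)
  also have "(\<lambda>x. if x \<in> set rs then c # ?S x else ?S x)
      = (\<lambda>x. if x \<in> set (q # rs) then c # S x else S x)"
    using Cons.prems by (auto simp: fun_eq_iff)
  finally show ?case by simp
qed

lemma runs_pour:
  assumes "distinct rs" "r \<notin> set rs" "F \<notin> set rs" "F \<noteq> r" "S F = []" "set (S r) \<subseteq> {..<A}"
  shows "runs (pour F r A rs) S (length (S r) * (length rs + A + 3) + A + 4)
    (\<lambda>x. if x = r then [] else if x \<in> set rs then rev (S r) @ S x else S x)"
proof -
  define P where "P cs S' \<longleftrightarrow> (\<forall>x. x \<noteq> F \<longrightarrow> x \<noteq> r \<longrightarrow> (if x \<in> set rs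
      then rev cs @ S' x = rev (S r) @ S x else S' x = S x))" for cs S'
  have step: "\<exists>S2. runs (Seq (Pop r) (foldr (\<lambda>q p. Seq (Push q c) p) rs Skip)) S1
        (Suc (Suc (length rs))) S2 \<and> P cs S2 \<and> S2 r = cs \<and> S2 F = [0]"
    if "c < A" "P (c # cs) S1" "S1 r = c # cs" "S1 F = [0]" for c cs S1
  proof -
    let ?S1 = "S1(r := tl (S1 r))"
    let ?S2 = "\<lambda>x. if x \<in> set rs then c # ?S1 x else ?S1 x"
    have "runs (Seq (Pop r) (foldr (\<lambda>q p. Seq (Push q c) p) rs Skip)) S1 (1 + Suc (length rs)) ?S2"
      by (rule runs_Seq[OF runs_Pop runs_pushes]) fact
    moreover have "P cs ?S2" using that(2) assms unfolding P_def by auto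
    moreover have "?S2 r = cs" "?S2 F = [0]" using that assms by auto
    ultimately show ?thesis by auto
  qed
  have "P (S r) (S(F := [0]))" unfolding P_def by auto
  from runs_drain[of A P r F "\<lambda>c. Seq (Pop r) (foldr (\<lambda>q p. Seq (Push q c) p) rs Skip)"
      "Suc (Suc (length rs))" S, OF step this] assms
  obtain S' where S': "runs (pour F r A rs) S (length (S r) * (Suc (Suc (length rs)) + A + 1) + A + 4) (S'(F := []))"
      "P [] S'" "S' r = []"
    unfolding pour_def by blast
  have "S'(F := []) = (\<lambda>x. if x = r then [] else if x \<in> set rs then rev (S r) @ S x else S x)"
    using S' assms unfolding P_def by (auto simp: fun_eq_iff)
  then show ?thesis
    by (intro runs_cong[OF S'(1)]) (simp_all add: algebra_simps)
qed

text \<open>The uniform alphabet lets a later program read the output symbol by symbol, since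
  \<open>case_top\<close> distinguishes only a fixed number of symbols.\<close>

definition ptime :: "(nat \<Rightarrow> nat list) \<Rightarrow> bool" where
  "ptime f \<longleftrightarrow> polytime f \<and> (\<exists>A. \<forall>n. set (f n) \<subseteq> {..<A})"

lemma ptimeD: "ptime f \<Longrightarrow> polytime f"
  by (simp add: ptime_def)

text \<open>Each step pushes at most one symbol, so the running time bounds the growth of every
  stack.\<close>

lemma polytime_length:
  assumes "polytime f"
  shows "poly_bounded (\<lambda>n. length (f n))"
proof -
  obtain p k where p: "\<And>n. \<exists>t s. exec p ((\<lambda>_. [])(0 := replicate n 0)) t s \<and> s 0 = f n \<and> t \<le> n ^ k + k"
    using assms unfolding polytime_def by blast
  have "length (f n) \<le> n + (n ^ k + k)" for n
  proof -
    obtain t s where "exec p ((\<lambda>_. [])(0 := replicate n 0)) t s" "s 0 = f n" "t \<le> n ^ k + k"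
      using p by blast
    then show ?thesis using exec_length[of p _ t s 0] by fastforce
  qed
  then show ?thesis
    by (rule poly_bounded_mono[rotated]) (intro poly_bounded_add poly_bounded_id poly_bounded_power_add)
qed

text \<open>A program for \<open>h\<close> may assume that \<open>f n\<close> and \<open>g n\<close> have already been computed.\<close>

lemma polytime_combine:
  assumes f: "ptime f" and g: "ptime g" and T: "poly_bounded T"
    and q: "\<And>n S. S 0 = replicate n 0 \<Longrightarrow> S 1 = f n \<Longrightarrow> S 2 = g n \<Longrightarrow>
       (\<And>r. 3 \<le> r \<Longrightarrow> r < 10 \<Longrightarrow> S r = []) \<Longrightarrow> \<exists>S'. runs q S (T n) S' \<and> S' 0 = h n"
  shows "polytime h"
proof -
  obtain A1 A2 where A1: "\<And>n. set (f n) \<subseteq> {..<A1}" and A2: "\<And>n. set (g n) \<subseteq> {..<A2}"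
    using f g unfolding ptime_def by blast
  obtain p1 B1 T1 where call1: "callable f p1 B1 T1"
    using polytime_callable[OF ptimeD[OF f]] by blast
  have T1: "poly_bounded T1" and B1: "0 < B1"
    using call1 unfolding callable_def by blast+
  obtain p2 B2 T2 where call2: "callable g p2 B2 T2"
    using polytime_callable[OF ptimeD[OF g]] by blast
  have T2: "poly_bounded T2" and B2: "0 < B2"
    using call2 unfolding callable_def by blast+
  \<comment> \<open>Registers 0 to 9 belong to the caller, the first subroutine occupies the next
    \<open>B1\<close>, and from \<open>?K\<close> on all is still empty when the second one
    starts.\<close>
  let ?K = "10 + B1"
  \<comment> \<open>Register 3 is the relay: the unary input is duplicated and put back, for which
    its order is irrelevant, and each result passes through register 3 so that two reversals
    cancel.\<close>
  define prog where "prog = Seq (pour 4 0 1 [3, 10]) (Seq (pour 4 3 1 [0]) (Seq (rename_regs ((+) 10) p1)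
    (Seq (pour 4 10 A1 [3]) (Seq (pour 4 3 A1 [1])
    (Seq (pour 4 0 1 [3, ?K]) (Seq (pour 4 3 1 [0]) (Seq (rename_regs ((+) ?K) p2)
    (Seq (pour 4 ?K A2 [3]) (Seq (pour 4 3 A2 [2]) q)))))))))"
  define U where "U n = (n * 6 + 5) + ((n * 5 + 5) + (T1 n +
     ((length (f n) * (A1 + 4) + A1 + 4) + ((length (f n) * (A1 + 4) + A1 + 4) +
     ((n * 6 + 5) + ((n * 5 + 5) + (T2 n +
     ((length (g n) * (A2 + 4) + A2 + 4) + ((length (g n) * (A2 + 4) + A2 + 4) + T n)))))))))" for n
  have U: "poly_bounded U"
    unfolding U_def
    by (intro poly_bounded_add poly_bounded_mult T T1 T2 poly_bounded_const poly_bounded_id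
        polytime_length ptimeD[OF f] ptimeD[OF g])
  have main: "\<exists>S'. runs prog ((\<lambda>_. [])(0 := replicate n 0)) (U n) S' \<and> S' 0 = h n" for n
  proof -
    define S0 where "S0 = (\<lambda>_::nat. [])(0 := replicate n (0::nat))"
    define S1 where "S1 = S0(0 := [], 3 := replicate n 0, 10 := replicate n 0)"
    have 1: "runs (pour 4 0 1 [3, 10]) S0 (n * 6 + 5) S1"
      by (rule runs_cong[OF runs_pour[of "[3,10]" 0 4 S0 1]]) (auto simp: S0_def S1_def)
    define S2 where "S2 = S0(0 := replicate n 0, 3 := [], 10 := replicate n 0)"
    have 2: "runs (pour 4 3 1 [0]) S1 (n * 5 + 5) S2"
      by (rule runs_cong[OF runs_pour[of "[0]" 3 4 S1 1]]) (auto simp: S0_def S1_def S2_def)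
    obtain S3 where S3: "runs (rename_regs ((+) 10) p1) S2 (T1 n) S3"
      "S3 10 = f n" "\<forall>r<10. S3 r = S2 r" "\<forall>r\<ge>?K. S3 r = []"
      using call1[unfolded callable_def, THEN conjunct2, THEN conjunct2, rule_format, of S2 10 n]
      unfolding runs_def by (auto simp: S2_def S0_def)
    define S4 where "S4 = S3(10 := [], 3 := rev (f n))"
    have 4: "runs (pour 4 10 A1 [3]) S3 (length (f n) * (A1 + 4) + A1 + 4) S4"
      by (rule runs_cong[OF runs_pour[of "[3]" 10 4 S3 A1]])
        (use A1[of n] S3 in \<open>auto simp: fun_eq_iff S4_def S2_def S0_def\<close>)
    define S5 where "S5 = S3(10 := [], 3 := [], 1 := f n)"
    have 5: "runs (pour 4 3 A1 [1]) S4 (length (f n) * (A1 + 4) + A1 + 4) S5"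
      by (rule runs_cong[OF runs_pour[of "[1]" 3 4 S4 A1]])
        (use A1[of n] S3 in \<open>auto simp: fun_eq_iff S5_def S4_def S2_def S0_def\<close>)
    define S6 where "S6 = S5(0 := [], 3 := replicate n 0, ?K := replicate n 0)"
    have 6: "runs (pour 4 0 1 [3, ?K]) S5 (n * 6 + 5) S6"
      by (rule runs_cong[OF runs_pour[of "[3, ?K]" 0 4 S5 1]])
        (use S3 in \<open>auto simp: fun_eq_iff S6_def S5_def S4_def S2_def S0_def\<close>)
    define S7 where "S7 = S5(0 := replicate n 0, 3 := [], ?K := replicate n 0)"
    have 7: "runs (pour 4 3 1 [0]) S6 (n * 5 + 5) S7"
      by (rule runs_cong[OF runs_pour[of "[0]" 3 4 S6 1]])
        (use S3 in \<open>auto simp: fun_eq_iff S7_def S6_def S5_def S4_def S2_def S0_def\<close>)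
    obtain S8 where S8: "runs (rename_regs ((+) ?K) p2) S7 (T2 n) S8"
      "S8 ?K = g n" "\<forall>r<?K. S8 r = S7 r"
      using call2[unfolded callable_def, THEN conjunct2, THEN conjunct2, rule_format, of S7 ?K n] S3
      unfolding runs_def by (auto simp: S7_def S5_def)
    define S9 where "S9 = S8(?K := [], 3 := rev (g n))"
    have 9: "runs (pour 4 ?K A2 [3]) S8 (length (g n) * (A2 + 4) + A2 + 4) S9"
      by (rule runs_cong[OF runs_pour[of "[3]" ?K 4 S8 A2]])
        (use A2[of n] S8 S3 in \<open>auto simp: fun_eq_iff S9_def S7_def S5_def S2_def S0_def\<close>)
    define S10 where "S10 = S8(?K := [], 3 := [], 2 := g n)"
    have 10: "runs (pour 4 3 A2 [2]) S9 (length (g n) * (A2 + 4) + A2 + 4) S10"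
      by (rule runs_cong[OF runs_pour[of "[2]" 3 4 S9 A2]])
        (use A2[of n] S8 S3 in \<open>auto simp: fun_eq_iff S10_def S9_def S7_def S5_def S2_def S0_def\<close>)
    have "\<exists>S'. runs q S10 (T n) S' \<and> S' 0 = h n"
    proof (rule q)
      fix r :: nat assume "3 \<le> r" "r < 10"
      then show "S10 r = []" using S8 S3 by (auto simp: S10_def S7_def S5_def S2_def S0_def)
    qed (use S8 S3 in \<open>auto simp: S10_def S7_def S5_def\<close>)
    then obtain S' where S': "runs q S10 (T n) S'" "S' 0 = h n" by blast
    have "runs prog S0 (U n) S'"
      unfolding prog_def U_def
      by (intro runs_Seq[OF 1] runs_Seq[OF 2] runs_Seq[OF S3(1)] runs_Seq[OF 4] runs_Seq[OF 5]
          runs_Seq[OF 6] runs_Seq[OF 7] runs_Seq[OF S8(1)] runs_Seq[OF 9] runs_Seq[OF 10] S'(1))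
    then show ?thesis using S'(2) unfolding S0_def by blast
  qed
  obtain k where k: "\<And>n. U n \<le> n ^ k + k" using poly_bounded_imp_power_add[OF U] by blast
  show ?thesis
    unfolding polytime_def
  proof (rule exI[of _ prog], rule exI[of _ k], rule allI)
    fix n
    obtain S' t where "exec prog ((\<lambda>_. [])(0 := replicate n 0)) t S'" "t \<le> U n" "S' 0 = h n"
      using main[of n] unfolding runs_def by blast
    then show "\<exists>t s. exec prog ((\<lambda>_. [])(0 := replicate n 0)) t s \<and> s 0 = h n \<and> t \<le> n ^ k + k"
      using k[of n] by (meson le_trans)
  qed
qed


section \<open>Finite-state transducers in polynomial time\<close>

definition fill :: "nat list \<Rightarrow> nat option list \<Rightarrow> nat list" where
  "fill h w = concat (map (case_option h (\<lambda>s. [s])) w)"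

lemma fill_simps [simp]:
  "fill h [] = []" "fill h (Some s # w) = s # fill h w" "fill h (None # w) = h @ fill h w"
  by (simp_all add: fill_def)

text \<open>A finite-state transducer whose output words contain holes, to be filled with a string that
  the transducer carries along and can extend by a unary digit.\<close>

fun transduce :: "(nat \<Rightarrow> nat \<Rightarrow> nat) \<Rightarrow> (nat \<Rightarrow> nat \<Rightarrow> nat option list) \<Rightarrow> (nat \<Rightarrow> nat \<Rightarrow> bool) \<Rightarrow>
    nat \<Rightarrow> nat list \<Rightarrow> nat list \<Rightarrow> nat list" where
  "transduce \<delta> out inc q h [] = []"
| "transduce \<delta> out inc q h (c # cs) =
     fill h (out q c) @ transduce \<delta> out inc (\<delta> q c) (if inc q c then 0 # h else h) cs"

text \<open>Register 2 holds the string for the holes, 3 the output written backwards, 5 a spare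
  copy, 7 a loop flag. Pouring 2 into 3 reverses, which is the right order for backward output, and
  the simultaneous copy in 5 restores 2.\<close>

primrec emit_prog :: "nat \<Rightarrow> nat option list \<Rightarrow> prog" where
  "emit_prog A [] = Skip"
| "emit_prog A (x # w) = Seq
     (case x of Some s \<Rightarrow> Push 3 s | None \<Rightarrow> Seq (pour 7 2 A [5, 3]) (pour 7 5 A [2]))
     (emit_prog A w)"

lemma runs_emit_prog:
  assumes "set (S 2) \<subseteq> {..<A}" "S 5 = []" "S 7 = []"
  shows "runs (emit_prog A w) S (length w * (length (S 2) * (2 * A + 9) + 2 * A + 8) + 1)
     (S(3 := rev (fill (S 2) w) @ S 3))"
  using assms
proof (induction w arbitrary: S)
  case Nil
  show ?case using runs_Skip[of S] by simp
next
  case (Cons x w)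
  let ?S1 = "S(3 := rev (fill (S 2) [x]) @ S 3)"
  let ?h = "length (S 2)"
  have "runs (case x of Some s \<Rightarrow> Push 3 s | None \<Rightarrow> Seq (pour 7 2 A [5, 3]) (pour 7 5 A [2])) S
      (?h * (2 * A + 9) + 2 * A + 8) ?S1"
  proof (cases x)
    case None
    let ?S = "S(2 := [], 5 := rev (S 2), 3 := rev (S 2) @ S 3)"
    have "runs (pour 7 2 A [5, 3]) S (?h * (A + 5) + A + 4) ?S"
      by (rule runs_cong[OF runs_pour[of "[5, 3]" 2 7 S A]])
        (use Cons.prems in \<open>auto simp: fun_eq_iff\<close>)
    moreover have "runs (pour 7 5 A [2]) ?S (?h * (A + 4) + A + 4) ?S1"
      by (rule runs_cong[OF runs_pour[of "[2]" 5 7 ?S A]])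
        (use Cons.prems None in \<open>auto simp: fun_eq_iff\<close>)
    ultimately have "runs (Seq (pour 7 2 A [5, 3]) (pour 7 5 A [2])) S
        ((?h * (A + 5) + A + 4) + (?h * (A + 4) + A + 4)) ?S1"
      by (rule runs_Seq)
    then have "runs (Seq (pour 7 2 A [5, 3]) (pour 7 5 A [2])) S (?h * (2 * A + 9) + 2 * A + 8) ?S1"
      by (rule runs_mono) (simp add: algebra_simps)
    then show ?thesis using None by (simp only: option.case)
  next
    case (Some s)
    then show ?thesis using runs_mono[OF runs_Push[of 3 s S]] by simp
  qed
  moreover have "runs (emit_prog A w) ?S1 (length w * (?h * (2 * A + 9) + 2 * A + 8) + 1)
      (S(3 := rev (fill (S 2) (x # w)) @ S 3))"
    by (rule runs_cong[OF Cons.IH[of ?S1]]) (use Cons.prems in \<open>auto simp: fill_def\<close>)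
  ultimately have "runs (emit_prog A (x # w)) S ((?h * (2 * A + 9) + 2 * A + 8) +
      (length w * (?h * (2 * A + 9) + 2 * A + 8) + 1)) (S(3 := rev (fill (S 2) (x # w)) @ S 3))"
    unfolding emit_prog.simps by (rule runs_Seq)
  then show ?case by (elim runs_mono) simp
qed

lemma fill_set: "set (fill h w) \<subseteq> set h \<union> {s. Some s \<in> set w}"
  by (induction w) (auto simp: fill_def split: option.splits)

text \<open>Register 1 holds the unread input, and register 4 the current state as a single symbol,
  so that \<open>case_top\<close> can select among finitely many words to emit.\<close>

definition step_prog where
  "step_prog \<delta> out inc Q A c = Seq (Pop 1) (case_top 4 Q (\<lambda>q. Seq (Pop 4) (Seq (Push 4 (\<delta> q c))
     (Seq (emit_prog A (out q c)) (if inc q c then Push 2 0 else Skip)))) Skip)"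

lemma runs_step_prog:
  assumes "S 4 = [q]" "q < Q" "set (S 2) \<subseteq> {..<A}" "S 5 = []" "S 7 = []"
    and "length (out q c) \<le> L" "length (S 2) \<le> H"
  shows "runs (step_prog \<delta> out inc Q A c) S (L * (H * (2 * A + 9) + 2 * A + 8) + Q + 5)
     (S(1 := tl (S 1), 4 := [\<delta> q c], 3 := rev (fill (S 2) (out q c)) @ S 3,
        2 := (if inc q c then 0 # S 2 else S 2)))" (is "runs _ _ _ ?R")
proof -
  let ?S0 = "S(1 := tl (S 1))" and ?S1 = "S(1 := tl (S 1), 4 := [\<delta> q c])"
  let ?S2 = "?S1(3 := rev (fill (S 2) (out q c)) @ S 3)"
  let ?T = "length (out q c) * (length (S 2) * (2 * A + 9) + 2 * A + 8) + 1"
  have "length (out q c) * (length (S 2) * (2 * A + 9) + 2 * A + 8) \<le> L * (H * (2 * A + 9) + 2 * A + 8)"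
    using assms by (intro mult_le_mono add_mono) auto
  moreover have 1: "runs (emit_prog A (out q c)) ?S1 ?T ?S2"
    by (rule runs_cong[OF runs_emit_prog]) (use assms in auto)
  have 2: "runs (if inc q c then Push 2 0 else Skip) ?S2 1 ?R"
  proof (cases "inc q c")
    case True
    then show ?thesis by (auto intro!: runs_cong[OF runs_Push])
  next
    case False
    then show ?thesis by (auto intro!: runs_cong[OF runs_Skip])
  qed
  have 3: "runs (Push 4 (\<delta> q c)) (?S0(4 := [])) 1 ?S1"
    by (rule runs_cong[OF runs_Push]) auto
  have 4: "runs (Pop 4) ?S0 1 (?S0(4 := []))"
    by (rule runs_cong[OF runs_Pop]) (use assms in auto)
  have "runs (case_top 4 Q (\<lambda>q. Seq (Pop 4) (Seq (Push 4 (\<delta> q c)) (Seq (emit_prog A (out q c))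
      (if inc q c then Push 2 0 else Skip)))) Skip) ?S0 ((1 + (1 + (?T + 1))) + Q) ?R"
    using assms
    by (intro runs_case_top[of _ _ q "[]"] runs_Seq[OF 4 runs_Seq[OF 3 runs_Seq[OF 1 2]]]) auto
  then have "runs (step_prog \<delta> out inc Q A c) S (1 + ((1 + (1 + (?T + 1))) + Q)) ?R"
    unfolding step_prog_def by (rule runs_Seq[OF runs_Pop])
  then show ?thesis
    by (rule runs_mono) (use calculation in linarith)
qed

lemma length_fill: "length (fill h w) \<le> length w * Suc (length h)"
proof (induction w)
  case (Cons x w)
  then show ?case by (cases x) auto
qed simp

text \<open>One symbol is consumed per step and the carried string grows by at most one, so
  \<open>length h + length cs\<close> never exceeds \<open>H\<close>; this keeps the output
  polynomial although every step may copy \<open>h\<close>.\<close>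

lemma length_transduce:
  assumes "\<And>q c. q < Q \<Longrightarrow> \<delta> q c < Q" and L: "\<And>q c. q < Q \<Longrightarrow> c < A \<Longrightarrow> length (out q c) \<le> L"
    and "q < Q" "set cs \<subseteq> {..<A}"
  shows "length h + length cs \<le> H \<Longrightarrow> length (transduce \<delta> out inc q h cs) \<le> length cs * (L * Suc H)"
  using assms(3,4)
proof (induction cs arbitrary: q h)
  case (Cons c cs)
  have "length (fill h (out q c)) \<le> length (out q c) * Suc (length h)" by (rule length_fill)
  also have "\<dots> \<le> L * Suc H" using Cons.prems by (intro mult_le_mono L) auto
  finally have "length (fill h (out q c)) \<le> L * Suc H" .
  moreover have "length (transduce \<delta> out inc (\<delta> q c) (if inc q c then 0 # h else h) cs)
      \<le> length cs * (L * Suc H)"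
    using Cons.prems assms(1) by (intro Cons.IH) auto
  ultimately show ?case by simp
qed simp

lemma set_transduce:
  assumes "\<And>q c. q < Q \<Longrightarrow> \<delta> q c < Q"
    and B: "\<And>q c s. q < Q \<Longrightarrow> c < A \<Longrightarrow> Some s \<in> set (out q c) \<Longrightarrow> s < B"
    and "0 < B" "set cs \<subseteq> {..<A}"
  shows "q < Q \<Longrightarrow> set h \<subseteq> {..<B} \<Longrightarrow> set (transduce \<delta> out inc q h cs) \<subseteq> {..<B}"
  using assms(4)
proof (induction cs arbitrary: q h)
  case (Cons c cs)
  have "set (fill h (out q c)) \<subseteq> {..<B}"
    using fill_set[of h "out q c"] Cons.prems B by fastforce
  moreover have "set (transduce \<delta> out inc (\<delta> q c) (if inc q c then 0 # h else h) cs) \<subseteq> {..<B}"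
    using Cons.prems assms(1,3) by (intro Cons.IH) auto
  ultimately show ?case by simp
qed simp

text \<open>The unary input in register 0 is erased to make room. Register 3 holds the output
  backwards, and the detour through 5 keeps it so.\<close>

definition transduce_prog where
  "transduce_prog \<delta> out inc q0 Q A B = Seq (Push 4 q0) (Seq (drain 6 1 A (step_prog \<delta> out inc Q A))
     (Seq (pour 7 0 1 []) (Seq (pour 7 3 B [5]) (pour 7 5 B [0]))))"

lemma runs_transduce_prog:
  fixes S :: "nat \<Rightarrow> nat list"
  assumes \<delta>: "\<And>q c. q < Q \<Longrightarrow> \<delta> q c < Q" and L: "\<And>q c. q < Q \<Longrightarrow> c < A \<Longrightarrow> length (out q c) \<le> L"
    and q0: "q0 < Q" and A: "0 < A" "set (S 1) \<subseteq> {..<A}" "set (S 2) \<subseteq> {..<A}"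
    and S: "S 0 = replicate n 0" "\<And>r. 3 \<le> r \<Longrightarrow> r < 10 \<Longrightarrow> S r = []"
    and B: "set (transduce \<delta> out inc q0 (S 2) (S 1)) \<subseteq> {..<B}"
    and H: "length (S 2) + length (S 1) \<le> H" and len: "length (transduce \<delta> out inc q0 (S 2) (S 1)) \<le> N"
  shows "\<exists>S'. runs (transduce_prog \<delta> out inc q0 Q A B) S
     (1 + ((length (S 1) * ((L * (H * (2 * A + 9) + 2 * A + 8) + Q + 5) + A + 1) + A + 4) +
      ((n * 4 + 5) + ((N * (B + 4) + B + 4) + (N * (B + 4) + B + 4))))) S' \<and>
     S' 0 = rev (transduce \<delta> out inc q0 (S 2) (S 1))"
proof -
  let ?tr = "transduce \<delta> out inc"
  let ?res = "?tr q0 (S 2) (S 1)"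
  \<comment> \<open>The output still to come, reversed, on top of the output already written is
    always the reversed final result.\<close>
  define P where "P cs S1 \<longleftrightarrow> (\<exists>q<Q. S1 4 = [q] \<and> set (S1 2) \<subseteq> {..<A} \<and> S1 5 = [] \<and> S1 7 = [] \<and>
     length (S1 2) + length cs \<le> H \<and> rev (?tr q (S1 2) cs) @ S1 3 = rev ?res \<and> S1 0 = S 0)"
    for cs and S1 :: "nat \<Rightarrow> nat list"
  let ?S1 = "S(4 := [q0])"
  have 1: "runs (Push 4 q0) S 1 ?S1"
    by (rule runs_cong[OF runs_Push]) (use S in auto)
  have step: "\<exists>S'. runs (step_prog \<delta> out inc Q A c) S1 (L * (H * (2 * A + 9) + 2 * A + 8) + Q + 5) S' \<and>
        P cs S' \<and> S' 1 = cs \<and> S' 6 = [0]"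
    if c: "c < A" and P: "P (c # cs) S1" and S1: "S1 1 = c # cs" "S1 6 = [0]" for c cs S1
  proof -
    obtain q where q: "q < Q" "S1 4 = [q]" "set (S1 2) \<subseteq> {..<A}" "S1 5 = []" "S1 7 = []"
       "length (S1 2) + length (c # cs) \<le> H" "rev (?tr q (S1 2) (c # cs)) @ S1 3 = rev ?res" "S1 0 = S 0"
      using P unfolding P_def by blast
    show ?thesis
    proof (intro exI conjI)
      show "runs (step_prog \<delta> out inc Q A c) S1 (L * (H * (2 * A + 9) + 2 * A + 8) + Q + 5)
         (S1(1 := tl (S1 1), 4 := [\<delta> q c], 3 := rev (fill (S1 2) (out q c)) @ S1 3,
            2 := (if inc q c then 0 # S1 2 else S1 2)))"
        using q c by (intro runs_step_prog L) auto
      show "P cs (S1(1 := tl (S1 1), 4 := [\<delta> q c], 3 := rev (fill (S1 2) (out q c)) @ S1 3,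
            2 := (if inc q c then 0 # S1 2 else S1 2)))"
        unfolding P_def using q c \<delta> A(1) by (intro exI[of _ "\<delta> q c"]) auto
    qed (use S1 in auto)
  qed
  have "P (?S1 1) (?S1(6 := [0]))"
    unfolding P_def using q0 S A H by (intro exI[of _ q0]) auto
  moreover have D: "?S1 6 = []" "(6::nat) \<noteq> 1" "set (?S1 1) \<subseteq> {..<A}" "?S1 1 = S 1"
    using S A by auto
  ultimately have "\<exists>S2. runs (drain 6 1 A (step_prog \<delta> out inc Q A)) ?S1
      (length (?S1 1) * ((L * (H * (2 * A + 9) + 2 * A + 8) + Q + 5) + A + 1) + A + 4) (S2(6 := [])) \<and>
      P [] S2 \<and> S2 1 = []"
    by (intro runs_drain[where P = P] step)
  then obtain S2 where S2: "runs (drain 6 1 A (step_prog \<delta> out inc Q A)) ?S1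
      (length (S 1) * ((L * (H * (2 * A + 9) + 2 * A + 8) + Q + 5) + A + 1) + A + 4) (S2(6 := []))" "P [] S2"
    unfolding D(4) by blast
  have S2': "S2 5 = []" "S2 7 = []" "S2 3 = rev ?res" "S2 0 = replicate n 0"
    using S2(2) S unfolding P_def by auto
  let ?S3 = "S2(6 := [], 0 := [])" and ?S4 = "S2(6 := [], 0 := [], 3 := [], 5 := ?res)"
  have 3: "runs (pour 7 0 1 []) (S2(6 := [])) (n * 4 + 5) ?S3"
    by (rule runs_cong[OF runs_pour[of "[]" 0 7 "S2(6 := [])" 1]])
      (use S2' in \<open>auto simp: fun_eq_iff\<close>)
  have len': "length ?res * (B + 4) + B + 4 \<le> N * (B + 4) + B + 4" using len by simp
  have "runs (pour 7 3 B [5]) ?S3 (length ?res * (B + 4) + B + 4) ?S4"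
    by (rule runs_cong[OF runs_pour[of "[5]" 3 7 ?S3 B]])
      (use S2' B in \<open>auto simp: fun_eq_iff\<close>)
  from runs_mono[OF this len'] have 4: "runs (pour 7 3 B [5]) ?S3 (N * (B + 4) + B + 4) ?S4" .
  have "runs (pour 7 5 B [0]) ?S4 (length ?res * (B + 4) + B + 4) (?S4(5 := [], 0 := rev ?res))"
    by (rule runs_cong[OF runs_pour[of "[0]" 5 7 ?S4 B]])
      (use S2' B in \<open>auto simp: fun_eq_iff\<close>)
  from runs_mono[OF this len'] have 5: "runs (pour 7 5 B [0]) ?S4 (N * (B + 4) + B + 4) (?S4(5 := [], 0 := rev ?res))" .
  show ?thesis
    unfolding transduce_prog_def
    by (rule exI, rule conjI, rule runs_Seq[OF 1 runs_Seq[OF S2(1) runs_Seq[OF 3 runs_Seq[OF 4 5]]]]) simp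
qed

text \<open>Reversed output is taken as the primitive operation: the identity transducer then gives
  reversal, a further reversal gives forward output, and inverting circuits wants the reversed
  form.\<close>

lemma ptime_transduce_rev:
  assumes f: "ptime f" and g: "ptime g" and \<delta>: "\<And>q c. q < Q \<Longrightarrow> \<delta> q c < Q" and q0: "q0 < Q"
  shows "ptime (\<lambda>n. rev (transduce \<delta> out inc q0 (g n) (f n)))"
proof -
  obtain A1 A2 where A1: "\<And>n. set (f n) \<subseteq> {..<A1}" and A2: "\<And>n. set (g n) \<subseteq> {..<A2}"
    using f g unfolding ptime_def by blast
  \<comment> \<open>The successor puts 0 into the alphabet, since the carried string may grow by
    that digit.\<close>
  define A where "A = Suc (max A1 A2)"
  have A0: "0 < A" unfolding A_def by simp
  have A: "set (f n) \<subseteq> {..<A}" "set (g n) \<subseteq> {..<A}" for n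
    using A1[of n] A2[of n] unfolding A_def by (auto simp: less_Suc_eq less_max_iff_disj)
  have fin: "finite ((\<lambda>(q, c). out q c) ` ({..<Q} \<times> {..<A}))" by blast
  obtain L where L: "\<And>q c. q < Q \<Longrightarrow> c < A \<Longrightarrow> length (out q c) \<le> L"
  proof -
    have "finite (length ` (\<lambda>(q, c). out q c) ` ({..<Q} \<times> {..<A}))" by blast
    then obtain L where "\<forall>l \<in> length ` (\<lambda>(q, c). out q c) ` ({..<Q} \<times> {..<A}). l \<le> L"
      using finite_nat_set_iff_bounded_le by blast
    then show ?thesis using that[of L] by blast
  qed
  obtain B where B: "A \<le> B" "\<And>q c s. q < Q \<Longrightarrow> c < A \<Longrightarrow> Some s \<in> set (out q c) \<Longrightarrow> s < B"
  proof -
    have "finite (\<Union>w \<in> (\<lambda>(q, c). out q c) ` ({..<Q} \<times> {..<A}). the ` set w)" by blast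
    then obtain B where B: "\<forall>s \<in> (\<Union>w \<in> (\<lambda>(q, c). out q c) ` ({..<Q} \<times> {..<A}). the ` set w). s < B"
      using finite_nat_set_iff_bounded by blast
    have "s < max A B" if "q < Q" "c < A" "Some s \<in> set (out q c)" for q c s
    proof -
      have "s \<in> (\<Union>w \<in> (\<lambda>(q, c). out q c) ` ({..<Q} \<times> {..<A}). the ` set w)"
        using that by (intro UN_I[of "out q c"] image_eqI[of _ _ "(q, c)"] image_eqI[of s the "Some s"]) auto
      then have "s < B" using B by blast
      then show ?thesis by simp
    qed
    then show ?thesis using that[of "max A B"] by simp
  qed
  have set_tr: "set (transduce \<delta> out inc q0 (g n) (f n)) \<subseteq> {..<B}" for n
    by (rule set_transduce[where Q = Q and \<delta> = \<delta> and A = A and out = out and B = B, OF \<delta> B(2)]) (use A0 A[of n] B(1) q0 in auto)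
  define H where "H n = length (g n) + length (f n)" for n
  define N where "N n = length (f n) * (L * Suc (H n))" for n
  define T where "T n = 1 + ((length (f n) * ((L * (H n * (2 * A + 9) + 2 * A + 8) + Q + 5) + A + 1) + A + 4) +
      ((n * 4 + 5) + ((N n * (B + 4) + B + 4) + (N n * (B + 4) + B + 4))))" for n
  have "poly_bounded T"
    unfolding T_def N_def H_def Suc_eq_plus1
    by (intro poly_bounded_add poly_bounded_mult poly_bounded_const poly_bounded_id
        polytime_length ptimeD[OF f] ptimeD[OF g])
  moreover have "\<exists>S'. runs (transduce_prog \<delta> out inc q0 Q A B) S (T n) S' \<and>
      S' 0 = rev (transduce \<delta> out inc q0 (g n) (f n))"
    if S: "S 0 = replicate n 0" "S 1 = f n" "S 2 = g n" "\<And>r. 3 \<le> r \<Longrightarrow> r < 10 \<Longrightarrow> S r = []" for n S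
  proof -
    have "length (transduce \<delta> out inc q0 (S 2) (S 1)) \<le> N n"
      unfolding N_def S(2)[symmetric]
      by (rule length_transduce[where Q = Q and \<delta> = \<delta> and A = A and out = out and L = L, OF \<delta> L]) (use A[of n] q0 S in \<open>auto simp: H_def\<close>)
    from runs_transduce_prog[where Q = Q and \<delta> = \<delta> and A = A and out = out and L = L and S = S and n = n
        and B = B and H = "H n" and N = "N n", OF \<delta> L q0 A0 _ _ S(1,4) _ _ this]
    show ?thesis using A[of n] set_tr[of n] S(2,3) unfolding T_def H_def by simp
  qed
  ultimately have "polytime (\<lambda>n. rev (transduce \<delta> out inc q0 (g n) (f n)))"
    by (rule polytime_combine[OF f g])
  then show ?thesis using set_tr unfolding ptime_def by auto
qed


section \<open>String operations and circuit descriptions\<close>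

lemma ptime_unary: "ptime (\<lambda>n. replicate n 0)"
proof -
  have "polytime (\<lambda>n. replicate n 0)"
    unfolding polytime_def
  proof (rule exI[of _ Skip], rule exI[of _ 1], rule allI, intro exI conjI)
    show "exec Skip ((\<lambda>_. [])(0 := replicate n 0)) 1 ((\<lambda>_. [])(0 := replicate n 0))" for n
      by (rule exec.Skip)
  qed auto
  moreover have "set (replicate n 0) \<subseteq> {..<1::nat}" for n by auto
  ultimately show ?thesis unfolding ptime_def by blast
qed

lemma ptime_Nil: "ptime (\<lambda>n. [])"
proof -
  have *: "runs (pour 1 0 1 []) ((\<lambda>_. [])(0 := replicate n 0)) (n * 4 + 5) (\<lambda>_. [])" for n
    by (rule runs_cong[OF runs_pour]) (auto simp: fun_eq_iff)
  have "poly_bounded (\<lambda>n. n * 4 + 5)"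
    by (intro poly_bounded_add poly_bounded_mult poly_bounded_id poly_bounded_const)
  then obtain k where k: "\<And>n. n * 4 + 5 \<le> n ^ k + k"
    using poly_bounded_imp_power_add by blast
  have "polytime (\<lambda>n. [])"
    unfolding polytime_def
  proof (rule exI[of _ "pour 1 0 1 []"], rule exI[of _ k], rule allI)
    fix n
    show "\<exists>t s. exec (pour 1 0 1 []) ((\<lambda>_. [])(0 := replicate n 0)) t s \<and> s 0 = [] \<and> t \<le> n ^ k + k"
      using *[of n] k[of n] unfolding runs_def by (auto intro: le_trans)
  qed
  then show ?thesis unfolding ptime_def by auto
qed

lemma ptime_Cons:
  assumes "ptime f"
  shows "ptime (\<lambda>n. c # f n)"
proof -
  obtain p k where p: "\<And>n. \<exists>t s. exec p ((\<lambda>_. [])(0 := replicate n 0)) t s \<and> s 0 = f n \<and> t \<le> n ^ k + k"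
    using ptimeD[OF assms] unfolding polytime_def by blast
  have "poly_bounded (\<lambda>n. (n ^ k + k) + 1)"
    by (rule poly_bounded_add[OF poly_bounded_power_add poly_bounded_const])
  then obtain l where l: "\<And>n. (n ^ k + k) + 1 \<le> n ^ l + l"
    using poly_bounded_imp_power_add by blast
  have "polytime (\<lambda>n. c # f n)"
    unfolding polytime_def
  proof (rule exI[of _ "Seq p (Push 0 c)"], rule exI[of _ l], rule allI)
    fix n
    obtain t s where s: "exec p ((\<lambda>_. [])(0 := replicate n 0)) t s" "s 0 = f n" "t \<le> n ^ k + k"
      using p by blast
    have "exec (Seq p (Push 0 c)) ((\<lambda>_. [])(0 := replicate n 0)) (t + 1) (s(0 := c # s 0))"
      by (rule exec.Seq[OF s(1) exec.Push])
    moreover have "t + 1 \<le> n ^ l + l" using s(3) l[of n] by linarith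
    ultimately show "\<exists>t s. exec (Seq p (Push 0 c)) ((\<lambda>_. [])(0 := replicate n 0)) t s \<and> s 0 = c # f n \<and> t \<le> n ^ l + l"
      using s(2) by (metis fun_upd_same)
  qed
  moreover obtain A where A: "\<And>n. set (f n) \<subseteq> {..<A}" using assms unfolding ptime_def by blast
  have "set (c # f n) \<subseteq> {..<max A (Suc c)}" for n
    using A[of n] by (auto simp: less_max_iff_disj)
  ultimately show ?thesis unfolding ptime_def by blast
qed

lemma ptime_const: "ptime (\<lambda>n. w)"
  by (induction w) (auto intro: ptime_Nil ptime_Cons)

text \<open>With a single state and a constant carried string, a transducer is a substitution of
  words for symbols.\<close>

lemma transduce_stateless:
  "transduce (\<lambda>_ _. 0) (\<lambda>_ c. w c) (\<lambda>_ _. False) 0 h xs = concat (map (\<lambda>c. fill h (w c)) xs)"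
  by (induction xs) auto

lemma ptime_rev:
  assumes "ptime f"
  shows "ptime (\<lambda>n. rev (f n))"
  using ptime_transduce_rev[OF assms ptime_Nil, of 1 "\<lambda>_ _. 0" 0 "\<lambda>_ c. [Some c]" "\<lambda>_ _. False"]
  by (simp add: transduce_stateless)

lemma ptime_transduce:
  assumes "ptime f" "ptime g" "\<And>q c. q < Q \<Longrightarrow> \<delta> q c < Q" "q0 < Q"
  shows "ptime (\<lambda>n. transduce \<delta> out inc q0 (g n) (f n))"
  using ptime_rev[OF ptime_transduce_rev[OF assms]] by simp

lemma ptime_subst:
  assumes "ptime f" "ptime g"
  shows "ptime (\<lambda>n. concat (map (\<lambda>c. fill (g n) (w c)) (f n)))"
  using ptime_transduce[OF assms, of 1 "\<lambda>_ _. 0" 0 "\<lambda>_ c. w c" "\<lambda>_ _. False"]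
  by (simp add: transduce_stateless)

text \<open>A fresh end marker \<open>A\<close>, outside the alphabet of \<open>f\<close>, is
  attached by filling a hole with \<open>f n\<close>; a second substitution replaces the marker by
  \<open>g n\<close>.\<close>

lemma ptime_append:
  assumes "ptime f" "ptime g"
  shows "ptime (\<lambda>n. f n @ g n)"
proof -
  obtain A where A: "\<And>n. set (f n) \<subseteq> {..<A}" using assms unfolding ptime_def by blast
  have 1: "ptime (\<lambda>n. f n @ [A])"
    using ptime_subst[OF ptime_const[of "[0]"] assms(1), of "\<lambda>_. [None, Some A]"] by simp
  have "concat (map (\<lambda>c. fill (g n) (if c = A then [None] else [Some c])) xs) = xs"
    if "set xs \<subseteq> {..<A}" for xs n
    using that by (induction xs) auto
  with ptime_subst[OF 1 assms(2), of "\<lambda>c. if c = A then [None] else [Some c]"] A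
  show ?thesis by simp
qed

lemma ptime_unary_add:
  "ptime (\<lambda>n. replicate (a n) 0) \<Longrightarrow> ptime (\<lambda>n. replicate (b n) 0) \<Longrightarrow> ptime (\<lambda>n. replicate (a n + b n) 0)"
  by (simp add: replicate_add ptime_append)

text \<open>Here the carried string is a counter: the input matters only by its length, and step
  \<open>i\<close> fills the holes with \<open>i\<close> in unary. This provides loops over wire
  numbers.\<close>

lemma ptime_upt:
  assumes "ptime f"
  shows "ptime (\<lambda>n. concat (map (\<lambda>i. fill (replicate i 0) w) [0..<length (f n)]))"
proof -
  have "transduce (\<lambda>_ _. 0) (\<lambda>_ _. w) (\<lambda>_ _. True) 0 (replicate i 0) xs
     = concat (map (\<lambda>i. fill (replicate i 0) w) [i..<i + length xs])" for i xs
  proof (induction xs arbitrary: i)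
    case (Cons x xs)
    have "[i..<i + length (x # xs)] = i # [Suc i..<Suc i + length xs]"
      by (subst upt_rec) (simp del: upt_Suc)
    then show ?case using Cons[of "Suc i"] by simp
  qed simp
  from this[of 0] ptime_transduce[OF assms ptime_Nil, of 1 "\<lambda>_ _. 0" 0 "\<lambda>_ _. w" "\<lambda>_ _. True"]
  show ?thesis by simp
qed

section \<open>Transformations of encoded gate lists\<close>

definition encode_gates :: "(nat \<times> nat list) list \<Rightarrow> nat list" where
  "encode_gates gs = concat (map (\<lambda>(g, ws). (g + 2) # concat (map encode_nat ws)) gs)"

lemma encode_circuit_eq: "encode_circuit (m, gs) = replicate m 0 @ 1 # encode_gates gs"
  by (simp add: encode_circuit_def encode_gates_def encode_nat_def)

lemma encode_gates_simps [simp]: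
  "encode_gates [] = []"
  "encode_gates ((g, ws) # gs) = (g + 2) # concat (map encode_nat ws) @ encode_gates gs"
  "encode_gates (gs @ hs) = encode_gates gs @ encode_gates hs"
  by (simp_all add: encode_gates_def)

abbreviation punary :: "(nat \<Rightarrow> nat) \<Rightarrow> bool" where
  "punary m \<equiv> ptime (\<lambda>n. replicate (m n) 0)"

abbreviation pgates :: "(nat \<Rightarrow> (nat \<times> nat list) list) \<Rightarrow> bool" where
  "pgates gs \<equiv> ptime (\<lambda>n. encode_gates (gs n))"

lemma ptime_encode_circuit:
  assumes "punary m" "pgates gs"
  shows "ptime (\<lambda>n. encode_circuit (m n, gs n))"
  unfolding encode_circuit_eq using ptime_append[OF assms(1) ptime_Cons[OF assms(2)]] .

lemma ptime_encode_nat: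
  assumes "punary m"
  shows "ptime (\<lambda>n. encode_nat (m n))"
  unfolding encode_nat_def by (rule ptime_append[OF assms ptime_const])

lemma pgates_append: "pgates gs \<Longrightarrow> pgates hs \<Longrightarrow> pgates (\<lambda>n. gs n @ hs n)"
  by (simp add: ptime_append)

lemma pgates_single1: "punary a \<Longrightarrow> pgates (\<lambda>n. [(g, [a n])])"
  by (simp add: ptime_append ptime_Cons ptime_encode_nat)

lemma pgates_single2: "punary a \<Longrightarrow> punary b \<Longrightarrow> pgates (\<lambda>n. [(g, [a n, b n])])"
  by (simp add: ptime_append ptime_Cons ptime_encode_nat)

text \<open>The unary width is ended by the first 1, so two states suffice to separate it from the
  gates that follow.\<close>

lemma punary_header:
  assumes "ptime (\<lambda>n. encode_circuit (m n, gs n))"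
  shows "punary m"
proof -
  let ?\<delta> = "\<lambda>q c. if q = 0 \<and> c = 0 then 0 else (1::nat)"
  let ?out = "\<lambda>q c. if q = 0 \<and> c = (0::nat) then [Some 0] else []"
  have 1: "transduce ?\<delta> ?out (\<lambda>_ _. False) 1 [] xs = []" for xs
    by (induction xs) auto
  have "transduce ?\<delta> ?out (\<lambda>_ _. False) 0 [] (replicate k 0 @ 1 # xs) = replicate k 0" for k xs
    using 1 by (induction k) auto
  with ptime_transduce[OF assms ptime_Nil, of 2 ?\<delta> 0 ?out "\<lambda>_ _. False"]
  show ?thesis by (simp add: encode_circuit_eq)
qed

lemma pgates_body:
  assumes "ptime (\<lambda>n. encode_circuit (m n, gs n))"
  shows "pgates gs"
proof -
  let ?\<delta> = "\<lambda>q c. if q = 0 \<and> c = 0 then 0 else (1::nat)"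
  let ?out = "\<lambda>q c. if q = 0 then [] else [Some (c::nat)]"
  have 1: "transduce ?\<delta> ?out (\<lambda>_ _. False) 1 [] xs = xs" for xs
    by (induction xs) auto
  have "transduce ?\<delta> ?out (\<lambda>_ _. False) 0 [] (replicate k 0 @ 1 # xs) = xs" for k xs
    using 1 by (induction k) auto
  with ptime_transduce[OF assms ptime_Nil, of 2 ?\<delta> 0 ?out "\<lambda>_ _. False"]
  show ?thesis by (simp add: encode_circuit_eq)
qed

text \<open>Gate names are exactly the symbols from 2 on, so a symbolwise substitution does
  it.\<close>

lemma pgates_rename:
  assumes "pgates gs"
  shows "pgates (\<lambda>n. map (\<lambda>(g, ws). (g + k, ws)) (gs n))"
proof -
  let ?w = "\<lambda>c. if c < 2 then [Some c] else [Some (c + k)]"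
  have 1: "concat (map (\<lambda>c. fill [] (?w c)) (concat (map encode_nat ws))) = concat (map encode_nat ws)" for ws
  proof (induction ws)
    case (Cons w ws)
    have "concat (map (\<lambda>c. fill [] (?w c)) (replicate w 0)) = replicate w 0" by (induction w) auto
    then show ?case using Cons by (simp add: encode_nat_def)
  qed simp
  have "concat (map (\<lambda>c. fill [] (?w c)) (encode_gates gs)) = encode_gates (map (\<lambda>(g, ws). (g + k, ws)) gs)" for gs
    by (induction gs) (auto simp: 1)
  with ptime_subst[OF assms ptime_Nil, of ?w] show ?thesis by simp
qed

text \<open>In unary, adding \<open>s n\<close> to a wire means writing \<open>s n\<close> more
  digits in front of its terminator 1, and the symbol 1 occurs nowhere else.\<close>

lemma pgates_shift:
  assumes "pgates gs" "punary s"
  shows "pgates (\<lambda>n. map (\<lambda>(g, ws). (g, map (\<lambda>w. w + s n) ws)) (gs n))"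
proof -
  let ?w = "\<lambda>c. if c = 1 then [None, Some 1] else [Some c]"
  have 1: "concat (map (\<lambda>c. fill (replicate s 0) (?w c)) (concat (map encode_nat ws)))
      = concat (map encode_nat (map (\<lambda>w. w + s) ws))" for s ws
  proof (induction ws)
    case (Cons w ws)
    have "concat (map (\<lambda>c. fill (replicate s 0) (?w c)) (replicate w 0)) = replicate w 0" by (induction w) auto
    then show ?case using Cons by (simp add: encode_nat_def replicate_add)
  qed simp
  have "concat (map (\<lambda>c. fill (replicate s 0) (?w c)) (encode_gates gs))
      = encode_gates (map (\<lambda>(g, ws). (g, map (\<lambda>w. w + s) ws)) gs)" for s gs
  proof (induction gs)
    case (Cons x gs)
    then show ?case by (cases x) (simp add: 1[unfolded map_map o_def] o_def del: One_nat_def)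
  qed simp
  with ptime_subst[OF assms, of ?w] show ?thesis by simp
qed

text \<open>A transducer carries only one string, which is spent on the counter \<open>i\<close>.
  The other parameters enter through placeholder symbols, chosen beyond the gate name
  \<open>g + 2\<close>, which two further passes replace by \<open>U n\<close> and
  \<open>V n\<close> in unary.\<close>

lemma pgates_ladder:
  assumes "punary M" "punary U" "punary V"
  shows "pgates (\<lambda>n. map (\<lambda>i. (g, map (\<lambda>(a, b, c). i + a * U n + b * V n + c) ts)) [0..<M n])"
proof -
  let ?X = "g + 3" and ?Y = "g + 4"
  let ?t = "\<lambda>(a, b, c). [None] @ replicate a (Some ?X) @ replicate b (Some ?Y) @ replicate c (Some 0) @ [Some 1]"
  let ?wX = "\<lambda>c. if c = ?X then [None] else [Some c]"
  let ?wY = "\<lambda>c. if c = ?Y then [None] else [Some c]"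
  let ?sub = "\<lambda>w h xs. concat (map (\<lambda>c. fill h (w c)) xs)"
  have fill_append: "fill h (xs @ ys) = fill h xs @ fill h ys" for h xs ys
    by (simp add: fill_def)
  have fill_rep: "fill h (replicate k (Some s)) = replicate k s" for h k s
    by (induction k) auto
  have rep: "?sub w h (replicate k s) = concat (replicate k (fill h (w s)))" for w k s and h :: "nat list"
    by (induction k) auto
  have rep0: "concat (replicate k [s]) = replicate k s" for k and s :: nat
    by (induction k) auto
  have rep1: "concat (replicate k (replicate l 0)) = replicate (k * l) (0::nat)" for k l
    by (induction k) (auto simp: replicate_add)
  have wire: "?sub ?wY (replicate v 0) (?sub ?wX (replicate u 0) (fill (replicate i 0) (?t x)))
     = encode_nat ((\<lambda>(a, b, c). i + a * u + b * v + c) x)" for i u v x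
    by (cases x) (simp add: fill_append fill_rep rep rep0 rep1 encode_nat_def replicate_add)
  have wires: "?sub ?wY (replicate v 0) (?sub ?wX (replicate u 0) (fill (replicate i 0) (concat (map ?t ts))))
     = concat (map encode_nat (map (\<lambda>(a, b, c). i + a * u + b * v + c) ts))" for i u v ts
    using wire by (induction ts) (simp_all add: fill_append)
  have gates: "?sub ?wY (replicate v 0) (?sub ?wX (replicate u 0)
       (concat (map (\<lambda>i. fill (replicate i 0) (Some (g + 2) # concat (map ?t ts))) is)))
     = encode_gates (map (\<lambda>i. (g, map (\<lambda>(a, b, c). i + a * u + b * v + c) ts)) is)" for "is" u v
    using wires by (induction "is") simp_all
  have "ptime (\<lambda>n. ?sub ?wY (replicate (V n) 0) (?sub ?wX (replicate (U n) 0)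
     (concat (map (\<lambda>i. fill (replicate i 0) (Some (g + 2) # concat (map ?t ts))) [0..<length (replicate (M n) (0::nat))]))))"
    by (intro ptime_subst ptime_upt assms)
  then show ?thesis unfolding gates by simp
qed

text \<open>Reversing the string alone would put each gate name behind its wires and each terminator
  in front of its digits. The transducer produces exactly this inverted layout beforehand, so that
  the reversal restores well-formed numbers and gates. The wires of each gate come out in reverse
  order.\<close>

lemma pgates_reverse:
  assumes "pgates gs"
  shows "pgates (\<lambda>n. rev (map (\<lambda>(g, ws). (g, rev ws)) (gs n)))"
proof -
  text \<open>State \<open>2 * c + b\<close> remembers the name \<open>c\<close> of the current gate and whether a number is about to
    start; the trailing 2 only serves to flush the last name.\<close>
  have "ptime (\<lambda>n. encode_gates (gs n) @ [2])" by (rule ptime_append[OF assms ptime_const])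
  then obtain A where A: "\<And>n. set (encode_gates (gs n) @ [2]) \<subseteq> {..<A}" unfolding ptime_def by blast
  let ?\<delta> = "\<lambda>q c. if A \<le> c then 0 else if 2 \<le> c then 2 * c + 1
      else if c = 0 then 2 * (q div 2) else 2 * (q div 2) + (1::nat)"
  \<comment> \<open>Gate names are at least 2, so \<open>4 \<le> q\<close> says that a name is
    pending; in odd states the next symbol begins a number, whose terminator is emitted at
    once.\<close>
  let ?out = "\<lambda>q c. if 2 \<le> c then (if 4 \<le> q then [Some (q div 2)] else [])
      else if c = 0 then (if odd q then [Some 1, Some 0] else [Some 0])
      else (if odd q then [Some 1] else [])"
  let ?tr = "\<lambda>q. transduce ?\<delta> ?out (\<lambda>_ _. False) q []"
  have A2: "2 < A" using A[of 0] by simp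
  have zeros: "?tr (2 * p) (replicate w 0 @ 1 # ys) = replicate w 0 @ ?tr (2 * p + 1) ys" for p w ys
    using A2 by (induction w) auto
  have num: "?tr (2 * p + 1) (encode_nat w @ ys) = 1 # replicate w 0 @ ?tr (2 * p + 1) ys" for p w ys
    using A2 zeros[of p] by (cases w) (simp_all add: encode_nat_def)
  have nums: "?tr (2 * p + 1) (concat (map encode_nat ws) @ ys)
     = concat (map (\<lambda>w. 1 # replicate w 0) ws) @ ?tr (2 * p + 1) ys" for p ws ys
    using num by (induction ws) simp_all
  have main: "?tr q (encode_gates gs @ [2]) = (if 4 \<le> q then [q div 2] else []) @
       concat (map (\<lambda>(g, ws). concat (map (\<lambda>w. 1 # replicate w 0) ws) @ [g + 2]) gs)"
    if "set (encode_gates gs @ [2]) \<subseteq> {..<A}" for q gs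
    using that
  proof (induction gs arbitrary: q)
    case (Cons x gs)
    obtain g ws where x: "x = (g, ws)" by (cases x)
    have "g + 2 < A" using Cons.prems x by simp
    then show ?case using Cons nums[of "g + 2" ws "encode_gates gs @ [2]"] x by simp
  qed (use A2 in auto)
  have revnums: "rev (concat (map (\<lambda>w. 1 # replicate w 0) ws)) = concat (map encode_nat (rev ws))" for ws
    by (induction ws) (simp_all add: encode_nat_def)
  have "rev (concat (map (\<lambda>(g, ws). concat (map (\<lambda>w. 1 # replicate w 0) ws) @ [g + 2]) gs))
     = encode_gates (rev (map (\<lambda>(g, ws). (g, rev ws)) gs))" for gs
    by (induction gs) (auto simp: revnums simp del: One_nat_def)
  then have *: "rev (?tr 0 (encode_gates (gs n) @ [2])) = encode_gates (rev (map (\<lambda>(g, ws). (g, rev ws)) (gs n)))" for n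
    using main[OF A[of n], of 0] by simp
  \<comment> \<open>Symbols outside the alphabet are sent to state 0, which bounds the states for
    arbitrary \<open>c\<close>.\<close>
  have "?\<delta> q c < 2 * A + 2" if "q < 2 * A + 2" for q c
  proof -
    have "2 * (q div 2) + 1 < 2 * A + 2" using that by presburger
    then show ?thesis by simp
  qed
  then have "ptime (\<lambda>n. rev (?tr 0 (encode_gates (gs n) @ [2])))"
    by (intro ptime_transduce_rev[of _ _ "2 * A + 2"] ptime_append[OF assms ptime_const] ptime_Nil) auto
  then show ?thesis unfolding * .
qed


section \<open>Gates, circuits and tensor products\<close>

lemma bit_less_imp: "i < 2 ^ m \<Longrightarrow> bit i w \<Longrightarrow> w < m" for i :: nat
  by (metis bit_take_bit_iff take_bit_nat_eq_self)

lemma nat_bit_eqI: "i < 2 ^ m \<Longrightarrow> j < 2 ^ m \<Longrightarrow> (\<And>w. w < m \<Longrightarrow> bit i w = bit j w) \<Longrightarrow> i = j" for i j :: nat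
  by (rule bit_eqI) (metis bit_less_imp)

definition nat_of :: "nat \<Rightarrow> (nat \<Rightarrow> bool) \<Rightarrow> nat" where
  "nat_of m P = horner_sum of_bool 2 (map P [0..<m])"

lemma bit_nat_of [simp]: "bit (nat_of m P) w \<longleftrightarrow> w < m \<and> P w"
  by (auto simp: nat_of_def bit_horner_sum_bit_iff)

lemma nat_of_less [simp]: "nat_of m P < 2 ^ m"
  using horner_sum_of_bool_2_less[of "map P [0..<m]"] by (simp add: nat_of_def)

definition get :: "nat list \<Rightarrow> nat \<Rightarrow> nat" where
  "get ws i = horner_sum of_bool 2 (map (bit i) ws)"

lemma bit_get: "bit (get ws i) t \<longleftrightarrow> t < length ws \<and> bit i (ws ! t)"
  by (auto simp: get_def bit_horner_sum_bit_iff)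

lemma get_less [simp]: "get ws i < 2 ^ length ws"
  using horner_sum_of_bool_2_less[of "map (bit i) ws"] by (simp add: get_def)

fun idx :: "nat list \<Rightarrow> nat \<Rightarrow> nat" where
  "idx [] w = 0"
| "idx (x # xs) w = (if x = w then 0 else Suc (idx xs w))"

lemma idx_mem: "w \<in> set ws \<Longrightarrow> idx ws w < length ws \<and> ws ! idx ws w = w"
  by (induction ws) auto

lemma idx_nth: "distinct ws \<Longrightarrow> t < length ws \<Longrightarrow> idx ws (ws ! t) = t"
  by (meson distinct_conv_nth idx_mem nth_mem)

lemma idx_map: "inj f \<Longrightarrow> idx (map f ws) (f w) = idx ws w"
  by (induction ws) (auto simp: inj_eq)

definition put :: "nat \<Rightarrow> nat list \<Rightarrow> nat \<Rightarrow> nat \<Rightarrow> nat" where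
  "put m ws i l = nat_of m (\<lambda>w. if w \<in> set ws then bit l (idx ws w) else bit i w)"

lemma put_less [simp]: "put m ws i l < 2 ^ m"
  by (simp add: put_def)

lemma bit_put: "bit (put m ws i l) w \<longleftrightarrow> w < m \<and> (if w \<in> set ws then bit l (idx ws w) else bit i w)"
  by (simp add: put_def)

lemma get_put:
  assumes "distinct ws" "set ws \<subseteq> {..<m}" "l < 2 ^ length ws"
  shows "get ws (put m ws i l) = l"
proof (rule nat_bit_eqI[OF _ assms(3)])
  fix t assume "t < length ws"
  then show "bit (get ws (put m ws i l)) t = bit l t"
    using assms subsetD[OF assms(2) nth_mem[of t ws]] by (auto simp: bit_get bit_put idx_nth)
qed simp

definition agree :: "nat \<Rightarrow> nat list \<Rightarrow> nat \<Rightarrow> nat \<Rightarrow> bool" where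
  "agree m ws i j \<longleftrightarrow> (\<forall>w<m. w \<notin> set ws \<longrightarrow> bit i w = bit j w)"

lemma agree_refl [simp]: "agree m ws i i"
  by (simp add: agree_def)

lemma agree_sym: "agree m ws i j \<longleftrightarrow> agree m ws j i"
  by (auto simp: agree_def)

lemma agree_rev [simp]: "agree m (rev ws) i j \<longleftrightarrow> agree m ws i j"
  by (simp add: agree_def)

lemma agree_upt [simp]: "agree k [0..<k] i j"
  by (simp add: agree_def)

lemma agree_put [simp]: "agree m ws i (put m ws i l)" "agree m ws (put m ws i l) k \<longleftrightarrow> agree m ws i k"
  by (auto simp: agree_def bit_put)

lemma put_get:
  assumes "j < 2 ^ m" "agree m ws i j"
  shows "put m ws i (get ws j) = j"
proof (rule nat_bit_eqI[OF _ assms(1)])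
  fix w assume "w < m"
  then show "bit (put m ws i (get ws j)) w = bit j w"
    using assms idx_mem[of w ws] by (auto simp: bit_get bit_put agree_def)
qed simp

text \<open>The basis indices that agree with \<open>i\<close> off the wires \<open>ws\<close> are
  parametrised by their values on \<open>ws\<close>; this shrinks the sums in matrix products from
  the whole register to the gate.\<close>

lemma sum_agree:
  assumes "distinct ws" "set ws \<subseteq> {..<m}"
  shows "(\<Sum>j<2 ^ m. if agree m ws i j then f j else 0)
    = (\<Sum>l<2 ^ length ws. f (put m ws i l))"
proof -
  have "(\<Sum>j<2 ^ m. if agree m ws i j then f j else 0)
      = (\<Sum>j \<in> {j \<in> {..<2 ^ m}. agree m ws i j}. f j)"
    by (rule sum.inter_filter[symmetric]) simp
  also have "\<dots> = (\<Sum>l<2 ^ length ws. f (put m ws i l))"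
    by (rule sum.reindex_bij_witness[of _ "put m ws i" "get ws"])
      (use assms in \<open>auto simp: get_put put_get\<close>)
  finally show ?thesis .
qed

lemma dim_gate_mat [simp]: "dim_row (gate_mat m g) = 2 ^ m" "dim_col (gate_mat m g) = 2 ^ m"
  by (cases g; simp add: gate_mat_def)+

lemma gate_mat_carrier [simp]: "gate_mat m g \<in> carrier_mat (2 ^ m) (2 ^ m)"
  by (rule carrier_matI) simp_all

lemma gate_mat_index:
  "i < 2 ^ m \<Longrightarrow> j < 2 ^ m \<Longrightarrow> gate_mat m (U, ws) $$ (i, j) =
     (if agree m ws i j then U $$ (get ws i, get ws j) else 0)"
  unfolding gate_mat_def get_def agree_def by simp

lemma gate_apply:
  assumes "distinct ws" "set ws \<subseteq> {..<m}" "dim_vec v = 2 ^ m" "i < 2 ^ m"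
  shows "(gate_mat m (U, ws) *\<^sub>v v) $ i = (\<Sum>l<2 ^ length ws. U $$ (get ws i, l) * v $ (put m ws i l))"
proof -
  have "(gate_mat m (U, ws) *\<^sub>v v) $ i = (\<Sum>j<2 ^ m. gate_mat m (U, ws) $$ (i, j) * v $ j)"
    using assms by (simp add: scalar_prod_def lessThan_atLeast0)
  also have "\<dots> = (\<Sum>j<2 ^ m. if agree m ws i j
      then U $$ (get ws i, get ws j) * v $ j else 0)"
    by (rule sum.cong) (use assms in \<open>auto simp: gate_mat_index\<close>)
  also have "\<dots> = (\<Sum>l<2 ^ length ws. U $$ (get ws i, get ws (put m ws i l)) * v $ (put m ws i l))"
    by (rule sum_agree) fact+
  also have "\<dots> = (\<Sum>l<2 ^ length ws. U $$ (get ws i, l) * v $ (put m ws i l))"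
    by (rule sum.cong) (use assms in \<open>auto simp: get_put\<close>)
  finally show ?thesis .
qed

lemma mat_adjoint_carrier [simp]: "A \<in> carrier_mat r c \<Longrightarrow> mat_adjoint A \<in> carrier_mat c r"
  by (auto simp: mat_adjoint_def mat_of_rows_def)

lemma mat_adjoint_index:
  "A \<in> carrier_mat r c \<Longrightarrow> i < c \<Longrightarrow> j < r \<Longrightarrow> mat_adjoint A $$ (i, j) = cnj (A $$ (j, i))"
  by (auto simp: mat_adjoint_def mat_of_rows_def)

lemma gate_mat_adjoint:
  assumes "U \<in> carrier_mat (2 ^ length ws) (2 ^ length ws)"
  shows "mat_adjoint (gate_mat m (U, ws)) = gate_mat m (mat_adjoint U, ws)"
proof (rule eq_matI)
  fix i j assume "i < dim_row (gate_mat m (mat_adjoint U, ws))" "j < dim_col (gate_mat m (mat_adjoint U, ws))"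
  then have ij: "i < 2 ^ m" "j < 2 ^ m" by simp_all
  show "mat_adjoint (gate_mat m (U, ws)) $$ (i, j) = gate_mat m (mat_adjoint U, ws) $$ (i, j)"
    using ij mat_adjoint_index[OF assms, of "get ws i" "get ws j"]
    by (auto simp: mat_adjoint_index[OF gate_mat_carrier ij] gate_mat_index agree_sym[of m ws j i])
qed (use carrier_matD[OF mat_adjoint_carrier[OF gate_mat_carrier[of m "(U, ws)"]]] in auto)

lemma gate_mat_mult:
  assumes "distinct ws" "set ws \<subseteq> {..<m}"
    and A: "A \<in> carrier_mat (2 ^ length ws) (2 ^ length ws)" and B: "B \<in> carrier_mat (2 ^ length ws) (2 ^ length ws)"
  shows "gate_mat m (A, ws) * gate_mat m (B, ws) = gate_mat m (A * B, ws)"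
proof (rule eq_matI)
  fix i k assume "i < dim_row (gate_mat m (A * B, ws))" "k < dim_col (gate_mat m (A * B, ws))"
  then have ik: "i < 2 ^ m" "k < 2 ^ m" by simp_all
  have "(gate_mat m (A, ws) * gate_mat m (B, ws)) $$ (i, k)
      = (gate_mat m (A, ws) *\<^sub>v col (gate_mat m (B, ws)) k) $ i"
    using ik by simp
  also have "\<dots> = (\<Sum>l<2 ^ length ws. A $$ (get ws i, l) * col (gate_mat m (B, ws)) k $ put m ws i l)"
    by (rule gate_apply) (use assms ik in auto)
  also have "\<dots> = (\<Sum>l<2 ^ length ws. if agree m ws i k
      then A $$ (get ws i, l) * B $$ (l, get ws k) else 0)"
    by (rule sum.cong) (use assms ik in \<open>auto simp: gate_mat_index get_put\<close>)
  also have "\<dots> = gate_mat m (A * B, ws) $$ (i, k)"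
    using ik A B by (auto simp: gate_mat_index scalar_prod_def lessThan_atLeast0 intro!: sum.cong)
  finally show "(gate_mat m (A, ws) * gate_mat m (B, ws)) $$ (i, k) = gate_mat m (A * B, ws) $$ (i, k)" .
qed auto

lemma gate_mat_one: "gate_mat m (1\<^sub>m (2 ^ length ws), ws) = 1\<^sub>m (2 ^ m)"
proof (rule eq_matI)
  fix i j assume "i < dim_row (1\<^sub>m (2 ^ m))" "j < dim_col (1\<^sub>m (2 ^ m))"
  then have ij: "i < 2 ^ m" "j < 2 ^ m" by simp_all
  have "i = j" if "agree m ws i j" "get ws i = get ws j"
    using put_get[OF ij(2) that(1)] put_get[OF ij(1), of ws i] that(2) by simp
  then show "gate_mat m (1\<^sub>m (2 ^ length ws), ws) $$ (i, j) = 1\<^sub>m (2 ^ m) $$ (i, j)"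
    using ij by (auto simp: gate_mat_index)
qed auto

text \<open>\<open>gate_mat\<close> respects products, adjoints and the identity, so it carries the
  two unitarity equations from the small space to the large one.\<close>

lemma gate_wf_unitary:
  assumes "gate_wf m g"
  shows "unitary_mat (2 ^ m) (gate_mat m g)"
proof -
  obtain U ws where g: "g = (U, ws)" by (cases g)
  have *: "distinct ws" "set ws \<subseteq> {..<m}" "U \<in> carrier_mat (2 ^ length ws) (2 ^ length ws)"
    "mat_adjoint U * U = 1\<^sub>m (2 ^ length ws)" "U * mat_adjoint U = 1\<^sub>m (2 ^ length ws)"
    using assms unfolding g gate_wf_def unitary_mat_def by auto
  show ?thesis
    unfolding unitary_mat_def g gate_mat_adjoint[OF *(3)]
    using * by (simp add: gate_mat_mult gate_mat_one)
qed


section \<open>Inner products and adjoints\<close>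

definition cinner :: "complex vec \<Rightarrow> complex vec \<Rightarrow> complex" where
  "cinner u v = (\<Sum>i<dim_vec v. cnj (u $ i) * v $ i)"

lemma cinner_self: "cinner v v = of_real (norm_sq v)"
  unfolding cinner_def norm_sq_def of_real_sum
  by (rule sum.cong) (simp_all add: complex_norm_square[symmetric] mult.commute del: of_real_power)

lemma cinner_adjoint:
  assumes A: "A \<in> carrier_mat d d" and u: "dim_vec u = d" and v: "dim_vec v = d"
  shows "cinner (A *\<^sub>v u) v = cinner u (mat_adjoint A *\<^sub>v v)"
proof -
  have "cinner (A *\<^sub>v u) v = (\<Sum>i<d. \<Sum>j<d. cnj (A $$ (i, j)) * cnj (u $ j) * v $ i)"
    unfolding cinner_def using A u v
    by (auto simp: scalar_prod_def lessThan_atLeast0 sum_distrib_right intro!: sum.cong)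
  also have "\<dots> = (\<Sum>j<d. \<Sum>i<d. cnj (A $$ (i, j)) * cnj (u $ j) * v $ i)"
    by (rule sum.swap)
  also have "\<dots> = (\<Sum>j<d. cnj (u $ j) * (\<Sum>i<d. mat_adjoint A $$ (j, i) * v $ i))"
    using A by (auto simp: mat_adjoint_index[OF A] sum_distrib_left intro!: sum.cong)
  also have "\<dots> = cinner u (mat_adjoint A *\<^sub>v v)"
    unfolding cinner_def using mat_adjoint_carrier[OF A] u v
    by (auto simp: scalar_prod_def lessThan_atLeast0 intro!: sum.cong)
  finally show ?thesis .
qed

lemma norm_sq_unitary:
  assumes "unitary_mat d U" "dim_vec v = d"
  shows "norm_sq (U *\<^sub>v v) = norm_sq v"
proof -
  have U: "U \<in> carrier_mat d d" "mat_adjoint U * U = 1\<^sub>m d" using assms unfolding unitary_mat_def by auto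
  have v: "v \<in> carrier_vec d" using assms(2) by (rule carrier_vecI)
  have "cinner (U *\<^sub>v v) (U *\<^sub>v v) = cinner v ((mat_adjoint U * U) *\<^sub>v v)"
    using cinner_adjoint[OF U(1) assms(2), of "U *\<^sub>v v"] carrier_matD[OF U(1)] v
      assoc_mult_mat_vec[OF mat_adjoint_carrier[OF U(1)] U(1) v]
    by simp
  then have "cinner (U *\<^sub>v v) (U *\<^sub>v v) = cinner v v" using U(2) v by simp
  then show ?thesis by (simp add: cinner_self)
qed

lemma unitary_adjoint: "unitary_mat d U \<Longrightarrow> unitary_mat d (mat_adjoint U)"
proof -
  assume U: "unitary_mat d U"
  then have c: "U \<in> carrier_mat d d" unfolding unitary_mat_def by simp
  have "mat_adjoint (mat_adjoint U) = U"
    by (rule eq_matI)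
      (use c carrier_matD[OF mat_adjoint_carrier[OF mat_adjoint_carrier[OF c]]] in
        \<open>auto simp: mat_adjoint_index[OF mat_adjoint_carrier[OF c]] mat_adjoint_index[OF c]\<close>)
  then show ?thesis using U c unfolding unitary_mat_def by auto
qed


section \<open>Running a circuit and its inverse\<close>

lemma run_circuit_Nil [simp]: "run_circuit (m, []) v = v"
  by (simp add: run_circuit_def)

lemma run_circuit_Cons [simp]: "run_circuit (m, g # gs) v = run_circuit (m, gs) (gate_mat m g *\<^sub>v v)"
  by (simp add: run_circuit_def)

lemma run_circuit_append: "run_circuit (m, gs @ hs) v = run_circuit (m, hs) (run_circuit (m, gs) v)"
  by (simp add: run_circuit_def)

lemma dim_run_circuit [simp]: "dim_vec v = 2 ^ m \<Longrightarrow> dim_vec (run_circuit (m, gs) v) = 2 ^ m"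
  by (induction gs arbitrary: v) auto

lemma norm_sq_run_circuit:
  assumes "circuit_wf (m, gs)" "dim_vec v = 2 ^ m"
  shows "norm_sq (run_circuit (m, gs) v) = norm_sq v"
  using assms
proof (induction gs arbitrary: v)
  case (Cons g gs)
  have "norm_sq (gate_mat m g *\<^sub>v v) = norm_sq v"
    using Cons.prems by (intro norm_sq_unitary[OF gate_wf_unitary]) (auto simp: circuit_wf_def)
  then show ?case using Cons by (simp add: circuit_wf_def)
qed simp

text \<open>Adjoints are moved across the inner product one gate at a time, which reverses their
  order. The map \<open>h\<close> is left abstract, because the inverse gates will act on reordered
  wires.\<close>

lemma cinner_run_circuit:
  assumes "\<And>g. g \<in> set gs \<Longrightarrow> gate_mat m (h g) = mat_adjoint (gate_mat m g)"
    and "dim_vec u = 2 ^ m" "dim_vec v = 2 ^ m"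
  shows "cinner (run_circuit (m, gs) u) v = cinner u (run_circuit (m, rev (map h gs)) v)"
  using assms
proof (induction gs arbitrary: u)
  case (Cons g gs)
  then have "cinner (run_circuit (m, g # gs) u) v
      = cinner (gate_mat m g *\<^sub>v u) (run_circuit (m, rev (map h gs)) v)" by simp
  also have "\<dots> = cinner u (mat_adjoint (gate_mat m g) *\<^sub>v run_circuit (m, rev (map h gs)) v)"
    using Cons.prems by (intro cinner_adjoint) auto
  finally show ?case using Cons.prems by (simp add: run_circuit_append)
qed simp

text \<open>The inverse gate acts on the reversed list of wires, since reading a circuit description
  backwards reverses the wires of every gate as well.\<close>

definition reverse_gate :: "complex mat \<Rightarrow> complex mat" where
  "reverse_gate U = (let k = (SOME k. dim_row U = 2 ^ k) in gate_mat k (mat_adjoint U, rev [0..<k]))"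

text \<open>A gate matrix does not record its arity, but 2 ^ k determines k.\<close>

lemma reverse_gate_eq:
  assumes "dim_row U = 2 ^ k"
  shows "reverse_gate U = gate_mat k (mat_adjoint U, rev [0..<k])"
proof -
  have "(SOME k. dim_row U = 2 ^ k) = k" using assms by (intro some_equality) auto
  then show ?thesis by (simp add: reverse_gate_def)
qed

text \<open>Two reversals cancel: the list of wires is reversed, and \<open>reverse_gate\<close>
  reverses the qubits of the adjoint in turn.\<close>

lemma gate_mat_reverse_gate:
  assumes "U \<in> carrier_mat (2 ^ length ws) (2 ^ length ws)"
  shows "gate_mat m (reverse_gate U, rev ws) = mat_adjoint (gate_mat m (U, ws))"
proof -
  let ?k = "length ws"
  have rev: "get (rev [0..<?k]) (get (rev ws) i) = get ws i" for i
    by (rule nat_bit_eqI[of _ ?k]) (use get_less[of "rev [0..<?k]" "get (rev ws) i"] in \<open>auto simp: bit_get rev_nth\<close>)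
  have "gate_mat m (reverse_gate U, rev ws) = gate_mat m (mat_adjoint U, ws)"
  proof (rule eq_matI)
    fix i j assume "i < dim_row (gate_mat m (mat_adjoint U, ws))" "j < dim_col (gate_mat m (mat_adjoint U, ws))"
    then have ij: "i < 2 ^ m" "j < 2 ^ m" by simp_all
    have less: "get (rev ws) i < 2 ^ ?k" for i using get_less[of "rev ws" i] by simp
    show "gate_mat m (reverse_gate U, rev ws) $$ (i, j) = gate_mat m (mat_adjoint U, ws) $$ (i, j)"
      using ij assms by (simp add: gate_mat_index reverse_gate_eq[of U ?k] less rev)
  qed simp_all
  then show ?thesis using gate_mat_adjoint[OF assms] by simp
qed

lemma gate_wf_reverse_gate:
  assumes "gate_wf m (U, ws)"
  shows "gate_wf m (reverse_gate U, rev ws)"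
proof -
  have U: "U \<in> carrier_mat (2 ^ length ws) (2 ^ length ws)" "unitary_mat (2 ^ length ws) U"
    using assms by (auto simp: gate_wf_def unitary_mat_def)
  have "unitary_mat (2 ^ length ws) (reverse_gate U)"
    unfolding reverse_gate_eq[OF carrier_matD(1)[OF U(1)]]
    by (rule gate_wf_unitary) (use unitary_adjoint[OF U(2)] in \<open>auto simp: gate_wf_def\<close>)
  then show ?thesis using assms by (auto simp: gate_wf_def)
qed


section \<open>Tensor products\<close>

lemma dim_tensor_state [simp]: "dim_vec (tensor_state m u b v) = 2 ^ (m + b)"
  by (simp add: tensor_state_def)

lemma tensor_state_index: "i < 2 ^ (m + b) \<Longrightarrow> tensor_state m u b v $ i = u $ take_bit m i * v $ drop_bit m i"
  by (simp add: tensor_state_def)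

lemma drop_bit_less: "i < 2 ^ (m + r) \<Longrightarrow> drop_bit m i < 2 ^ r" for i :: nat
  by (simp add: drop_bit_eq_div less_mult_imp_div_less power_add mult.commute)

text \<open>Summing over the local index of the gate changes only \<open>take_bit m\<close> of a
  basis index, so the factor from the upper wires can be pulled out.\<close>

lemma gate_tensor_low:
  assumes "gate_wf m g" "dim_vec u = 2 ^ m"
  shows "gate_mat (m + r) g *\<^sub>v tensor_state m u r v = tensor_state m (gate_mat m g *\<^sub>v u) r v"
proof -
  obtain U ws where g: "g = (U, ws)" by (cases g)
  have ws: "distinct ws" "set ws \<subseteq> {..<m}" using assms(1) by (auto simp: g gate_wf_def)
  have ws': "set ws \<subseteq> {..<m + r}" using ws by auto
  show ?thesis
  proof (rule eq_vecI)
    fix i assume "i < dim_vec (tensor_state m (gate_mat m g *\<^sub>v u) r v)"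
    then have i: "i < 2 ^ (m + r)" by simp
    have 1: "get ws i = get ws (take_bit m i)"
      using ws by (auto simp: get_def bit_take_bit_iff intro!: arg_cong[of _ _ "horner_sum of_bool 2"])
    have 2: "take_bit m (put (m + r) ws i l) = put m ws (take_bit m i) l" for l
      by (rule nat_bit_eqI[of _ m]) (auto simp: bit_put bit_take_bit_iff)
    have 3: "drop_bit m (put (m + r) ws i l) = drop_bit m i" for l
      by (rule nat_bit_eqI[of _ r]) (use ws i in \<open>auto simp: bit_put bit_drop_bit_eq drop_bit_less\<close>)
    show "(gate_mat (m + r) g *\<^sub>v tensor_state m u r v) $ i = tensor_state m (gate_mat m g *\<^sub>v u) r v $ i"
      unfolding g tensor_state_index[OF i] using assms(2) i
      by (subst gate_apply[OF ws(1) ws' _ i], simp, subst gate_apply[OF ws], simp_all)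
        (simp add: 1 2 3 tensor_state_index sum_distrib_left mult_ac)
  qed simp
qed

lemma run_tensor_low:
  assumes "circuit_wf (m, gs)" "dim_vec u = 2 ^ m"
  shows "run_circuit (m + r, gs) (tensor_state m u r v) = tensor_state m (run_circuit (m, gs) u) r v"
  using assms by (induction gs arbitrary: u) (auto simp: circuit_wf_def gate_tensor_low)

lemma gate_tensor_high:
  assumes "gate_wf r (U, ws)" "dim_vec v = 2 ^ r"
  shows "gate_mat (n + r) (U, map (\<lambda>w. w + n) ws) *\<^sub>v tensor_state n u r v
    = tensor_state n u r (gate_mat r (U, ws) *\<^sub>v v)"
proof -
  let ?ws = "map (\<lambda>w. w + n) ws"
  have ws: "distinct ws" "set ws \<subseteq> {..<r}" using assms(1) by (auto simp: gate_wf_def)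
  have ws': "distinct ?ws" "set ?ws \<subseteq> {..<n + r}" using ws by (auto simp: distinct_map inj_on_def)
  show ?thesis
  proof (rule eq_vecI)
    fix i assume "i < dim_vec (tensor_state n u r (gate_mat r (U, ws) *\<^sub>v v))"
    then have i: "i < 2 ^ (n + r)" by simp
    have 1: "get ?ws i = get ws (drop_bit n i)"
      using ws by (auto simp: get_def bit_drop_bit_eq add.commute intro!: arg_cong[of _ _ "horner_sum of_bool 2"])
    have idx: "idx ?ws (n + w) = idx ws w" for w
      using idx_map[of "\<lambda>w. w + n" ws w] by (simp add: inj_def add.commute)
    have 2: "drop_bit n (put (n + r) ?ws i l) = put r ws (drop_bit n i) l" for l
      by (rule nat_bit_eqI[of _ r]) (auto simp: bit_put bit_drop_bit_eq drop_bit_less idx)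
    have 3: "take_bit n (put (n + r) ?ws i l) = take_bit n i" for l
      by (rule nat_bit_eqI[of _ n]) (auto simp: bit_put bit_take_bit_iff)
    show "(gate_mat (n + r) (U, ?ws) *\<^sub>v tensor_state n u r v) $ i
        = tensor_state n u r (gate_mat r (U, ws) *\<^sub>v v) $ i"
      unfolding tensor_state_index[OF i] using assms(2) i
      by (subst gate_apply[OF ws' _ i], simp, subst gate_apply[OF ws], simp_all add: drop_bit_less)
        (simp add: 1 2 3 tensor_state_index sum_distrib_left mult_ac)
  qed simp
qed

definition shift_gates :: "nat \<Rightarrow> ('a \<times> nat list) list \<Rightarrow> ('a \<times> nat list) list" where
  "shift_gates n gs = map (\<lambda>(U, ws). (U, map (\<lambda>w. w + n) ws)) gs"

lemma run_tensor_high: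
  assumes "circuit_wf (r, gs)" "dim_vec v = 2 ^ r"
  shows "run_circuit (n + r, shift_gates n gs) (tensor_state n u r v) = tensor_state n u r (run_circuit (r, gs) v)"
  using assms by (induction gs arbitrary: v) (auto simp: circuit_wf_def gate_tensor_high shift_gates_def)

lemma circuit_wf_shift: "circuit_wf (r, gs) \<Longrightarrow> circuit_wf (n + r, shift_gates n gs)"
  by (fastforce simp: circuit_wf_def shift_gates_def gate_wf_def distinct_map inj_on_def)

lemma circuit_wf_mono: "circuit_wf (m, gs) \<Longrightarrow> m \<le> m' \<Longrightarrow> circuit_wf (m', gs)"
  by (fastforce simp: circuit_wf_def gate_wf_def)

lemma circuit_wf_append [simp]: "circuit_wf (m, gs @ hs) \<longleftrightarrow> circuit_wf (m, gs) \<and> circuit_wf (m, hs)"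
  by (auto simp: circuit_wf_def)

lemma tensor_assoc:
  "tensor_state (m + r) (tensor_state m u r v) s w = tensor_state m u (r + s) (tensor_state r v s w)"
proof (rule eq_vecI)
  fix i assume "i < dim_vec (tensor_state m u (r + s) (tensor_state r v s w))"
  then have i: "i < 2 ^ (m + r + s)" by (simp add: add.assoc)
  have 1: "take_bit (m + r) i < 2 ^ (m + r)" by simp
  have 2: "drop_bit m i < 2 ^ (r + s)" using i by (intro drop_bit_less) (simp add: add.assoc)
  have 3: "drop_bit m (take_bit (m + r) i) = take_bit r (drop_bit m i)"
    by (rule bit_eqI) (auto simp: bit_take_bit_iff bit_drop_bit_eq)
  have 4: "drop_bit (r + m) i = drop_bit (m + r) i" by (simp only: add.commute)
  have "i < 2 ^ (m + (r + s))" using i by (simp add: add.assoc)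
  then show "tensor_state (m + r) (tensor_state m u r v) s w $ i = tensor_state m u (r + s) (tensor_state r v s w) $ i"
    using tensor_state_index[OF i] tensor_state_index[OF 1] tensor_state_index[OF 2] 3 4
    by (simp add: tensor_state_index)
qed (simp add: add.assoc)

lemma ket0_eq: "ket0 m = unit_vec (2 ^ m) 0"
proof -
  have "horner_sum of_bool 2 (replicate m False) = (0::nat)"
    by (induction m) auto
  then show ?thesis by (simp add: ket0_def ket_def)
qed

lemma dim_ket0 [simp]: "dim_vec (ket0 m) = 2 ^ m"
  by (simp add: ket0_eq)

lemma dim_ket [simp]: "dim_vec (ket x) = 2 ^ length x"
  by (simp add: ket_def)

text \<open>The first factor holds the low-order bits, so zero ancillas leave the basis index of
  \<open>x\<close> as it is.\<close>

lemma tensor_ket_ket0: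
  "tensor_state (length x) (ket x) a (ket0 a) = unit_vec (2 ^ (length x + a)) (horner_sum of_bool 2 x)"
proof (rule eq_vecI)
  let ?x = "horner_sum of_bool 2 x :: nat" and ?n = "length x"
  have x: "?x < 2 ^ ?n" by (rule horner_sum_of_bool_2_less)
  fix i assume "i < dim_vec (unit_vec (2 ^ (?n + a)) ?x :: complex vec)"
  then have i: "i < 2 ^ (?n + a)" by simp
  have "i = ?x \<longleftrightarrow> take_bit ?n i = ?x \<and> drop_bit ?n i = 0"
    by (metis add_0 bits_ident mult_zero_left push_bit_eq_mult take_bit_nat_eq_self x drop_bit_eq_div div_less)
  moreover have "?x < 2 ^ (?n + a)" using x by (rule less_le_trans) simp
  ultimately show "tensor_state ?n (ket x) a (ket0 a) $ i = unit_vec (2 ^ (?n + a)) ?x $ i"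
    using i x drop_bit_less[OF i] by (auto simp: tensor_state_index ket_def ket0_eq)
qed simp

lemma horner_sum_replicate_False [simp]: "horner_sum of_bool 2 (replicate m False) = (0::nat)"
  by (induction m) auto

lemma tensor_ket0_ket0: "tensor_state r (ket0 r) s (ket0 s) = ket0 (r + s)"
  using tensor_ket_ket0[of "replicate r False" s] by (simp add: ket0_eq ket_def)


section \<open>Measurement probabilities and particular gates\<close>

definition mass :: "(nat \<Rightarrow> bool) \<Rightarrow> complex vec \<Rightarrow> real" where
  "mass E v = (\<Sum>i | i < dim_vec v \<and> E i. (cmod (v $ i))\<^sup>2)"

lemma outcome_prob_qubit0:
  assumes "dim_vec v = 2 ^ m"
  shows "outcome_prob (qubit0_proj m) v = mass (\<lambda>i. bit i 0) v"
proof -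
  have *: "(qubit0_proj m *\<^sub>v v) $ i = (if bit i 0 then v $ i else 0)" if "i < 2 ^ m" for i
  proof -
    have "(qubit0_proj m *\<^sub>v v) $ i = (\<Sum>j<2 ^ m. of_bool (i = j \<and> bit i 0) * v $ j)"
      using that assms by (simp add: qubit0_proj_def scalar_prod_def lessThan_atLeast0)
    also have "\<dots> = (\<Sum>j<2 ^ m. if i = j then (if bit i 0 then v $ i else 0) else 0)"
      by (rule sum.cong) auto
    also have "\<dots> = (if bit i 0 then v $ i else 0)"
      using that by simp
    finally show ?thesis .
  qed
  have "outcome_prob (qubit0_proj m) v = (\<Sum>i<2 ^ m. if bit i 0 then (cmod (v $ i))\<^sup>2 else 0)"
    unfolding outcome_prob_def norm_sq_def
    by (rule sum.cong) (auto simp: * qubit0_proj_def[THEN arg_cong, of dim_row] simp del: index_mult_mat_vec)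
  also have "\<dots> = mass (\<lambda>i. bit i 0) v"
    unfolding mass_def using assms by (subst sum.inter_filter[symmetric]) auto
  finally show ?thesis .
qed

lemma mass_Not: "mass (\<lambda>i. \<not> E i) v = norm_sq v - mass E v"
proof -
  have "norm_sq v = mass E v + mass (\<lambda>i. \<not> E i) v"
    unfolding mass_def norm_sq_def
    by (subst sum.union_disjoint[symmetric]) (auto intro!: sum.cong)
  then show ?thesis by simp
qed

lemma mass_cong: "(\<And>i. i < dim_vec v \<Longrightarrow> v $ i \<noteq> 0 \<Longrightarrow> E i = F i) \<Longrightarrow> mass E v = mass F v"
  unfolding mass_def by (rule sum.mono_neutral_cong) auto

lemma mass_tensor_ket0:
  assumes "dim_vec u = 2 ^ m"
  shows "mass E (tensor_state m u r (ket0 r)) = mass E u"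
proof -
  let ?v = "tensor_state m u r (ket0 r)"
  have nz: "?v $ i = (if i < 2 ^ m then u $ i else 0)" if "i < 2 ^ (m + r)" for i
  proof -
    have "drop_bit m i = 0 \<longleftrightarrow> i < 2 ^ m"
      by (simp add: drop_bit_eq_div div_eq_0_iff)
    then show ?thesis using that drop_bit_less[OF that]
      by (auto simp: tensor_state_index ket0_eq take_bit_nat_eq_self)
  qed
  have le: "(2::nat) ^ m \<le> 2 ^ (m + r)" by simp
  have *: "i < 2 ^ (m + r)" if "i < 2 ^ m" for i :: nat using that le by (rule less_le_trans)
  show ?thesis
    unfolding mass_def
  proof (rule sum.mono_neutral_cong_right)
    show "{i. i < dim_vec u \<and> E i} \<subseteq> {i. i < dim_vec ?v \<and> E i}" using assms * by auto
  qed (use assms * nz in auto)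
qed

text \<open>The outcomes of the two factors are independent; the event for the second may depend on
  the outcome of the first.\<close>

lemma mass_tensor_left:
  assumes u: "dim_vec u = 2 ^ n" and v: "dim_vec v = 2 ^ r"
  shows "mass (\<lambda>i. E (take_bit n i) (drop_bit n i)) (tensor_state n u r v)
    = (\<Sum>a<2 ^ n. (cmod (u $ a))\<^sup>2 * mass (E a) v)"
proof -
  have "(\<Sum>a<2 ^ n. (cmod (u $ a))\<^sup>2 * mass (E a) v)
      = (\<Sum>a<2 ^ n. \<Sum>b | b < 2 ^ r \<and> E a b. (cmod (u $ a * v $ b))\<^sup>2)"
    by (simp add: mass_def v sum_distrib_left norm_mult power_mult_distrib)
  also have "\<dots> = (\<Sum>(a, b) \<in> (SIGMA a:{..<2 ^ n}. {b. b < 2 ^ r \<and> E a b}). (cmod (u $ a * v $ b))\<^sup>2)"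
    by (subst sum.Sigma) auto
  also have "\<dots> = mass (\<lambda>i. E (take_bit n i) (drop_bit n i)) (tensor_state n u r v)"
    unfolding mass_def
  proof (rule sum.reindex_bij_witness[of _ "\<lambda>i. (take_bit n i, drop_bit n i)" "\<lambda>(a, b). a + 2 ^ n * b"])
    fix ab :: "nat \<times> nat" assume "ab \<in> (SIGMA a:{..<2 ^ n}. {b. b < 2 ^ r \<and> E a b})"
    then obtain a b where ab: "ab = (a, b)" "a < 2 ^ n" "b < 2 ^ r" "E a b" by auto
    have td: "take_bit n (a + 2 ^ n * b) = a" "drop_bit n (a + 2 ^ n * b) = b"
      using ab by (simp_all add: take_bit_eq_mod drop_bit_eq_div)
    have "a + 2 ^ n * b < 2 ^ n + 2 ^ n * b" using ab by simp
    also have "\<dots> = 2 ^ n * Suc b" by simp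
    also have "\<dots> \<le> 2 ^ n * 2 ^ r" using ab by (intro mult_le_mono2) simp
    finally have less: "a + 2 ^ n * b < 2 ^ (n + r)" by (simp add: power_add)
    show "(\<lambda>i. (take_bit n i, drop_bit n i)) (case ab of (a, b) \<Rightarrow> a + 2 ^ n * b) = ab"
      using ab td by simp
    show "(case ab of (a, b) \<Rightarrow> a + 2 ^ n * b) \<in> {i. i < dim_vec (tensor_state n u r v) \<and> E (take_bit n i) (drop_bit n i)}"
      using ab td less by simp
    show "(cmod (tensor_state n u r v $ (case ab of (a, b) \<Rightarrow> a + 2 ^ n * b)))\<^sup>2 = (case ab of (a, b) \<Rightarrow> (cmod (u $ a * v $ b))\<^sup>2)"
      using ab td tensor_state_index[OF less] by simp
  next
    fix i assume "i \<in> {i. i < dim_vec (tensor_state n u r v) \<and> E (take_bit n i) (drop_bit n i)}"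
    then have i: "i < 2 ^ (n + r)" "E (take_bit n i) (drop_bit n i)" by auto
    show "(case (take_bit n i, drop_bit n i) of (a, b) \<Rightarrow> a + 2 ^ n * b) = i"
      using bits_ident[of n i] by (simp add: push_bit_eq_mult mult.commute add.commute)
    show "(take_bit n i, drop_bit n i) \<in> (SIGMA a:{..<2 ^ n}. {b. b < 2 ^ r \<and> E a b})"
      using i drop_bit_less[OF i(1)] by simp
  qed
  finally show ?thesis by simp
qed


section \<open>Reversible classical gates\<close>

lemma mat_adjoint_eqI:
  assumes "A \<in> carrier_mat d d" "\<And>i j. i < d \<Longrightarrow> j < d \<Longrightarrow> cnj (A $$ (j, i)) = A $$ (i, j)"
  shows "mat_adjoint A = A"
  by (rule eq_matI)
    (use assms carrier_matD[OF mat_adjoint_carrier[OF assms(1)]] in \<open>auto simp: mat_adjoint_index[OF assms(1)]\<close>)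

definition classical_gate :: "nat \<Rightarrow> (nat \<Rightarrow> nat) \<Rightarrow> complex mat" where
  "classical_gate k f = mat (2 ^ k) (2 ^ k) (\<lambda>(i, j). of_bool (i = f j))"

text \<open>For an involution the permutation matrix is self-adjoint and its own inverse, so one
  map, \<open>act\<close>, describes both where a basis state goes and from where an amplitude
  comes.\<close>

definition involution :: "nat \<Rightarrow> (nat \<Rightarrow> nat) \<Rightarrow> bool" where
  "involution k f \<longleftrightarrow> (\<forall>l<2 ^ k. f l < 2 ^ k \<and> f (f l) = l)"

lemma unitary_classical_gate:
  assumes f: "involution k f"
  shows "unitary_mat (2 ^ k) (classical_gate k f)"
proof -
  let ?U = "classical_gate k f"
  have c: "?U \<in> carrier_mat (2 ^ k) (2 ^ k)" by (simp add: classical_gate_def)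
  have adj: "mat_adjoint ?U = ?U"
  proof (rule mat_adjoint_eqI[OF c])
    fix i j :: nat assume ij: "i < 2 ^ k" "j < 2 ^ k"
    then have "j = f i \<longleftrightarrow> i = f j" using f unfolding involution_def by metis
    then show "cnj (?U $$ (j, i)) = ?U $$ (i, j)" using ij by (simp add: classical_gate_def)
  qed
  have "?U * ?U = 1\<^sub>m (2 ^ k)"
  proof (rule eq_matI)
    fix i j assume "i < dim_row (1\<^sub>m (2 ^ k))" "j < dim_col (1\<^sub>m (2 ^ k))"
    then have ij: "i < 2 ^ k" "j < 2 ^ k" by simp_all
    then have fj: "f j < 2 ^ k" "f (f j) = j" using f by (auto simp: involution_def)
    have "(?U * ?U) $$ (i, j) = (\<Sum>l<2 ^ k. if l = f j then of_bool (i = f l) else 0)"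
      using ij by (auto simp: classical_gate_def scalar_prod_def lessThan_atLeast0 intro!: sum.cong)
    also have "\<dots> = 1\<^sub>m (2 ^ k) $$ (i, j)" using ij fj by simp
    finally show "(?U * ?U) $$ (i, j) = 1\<^sub>m (2 ^ k) $$ (i, j)" .
  qed (use c in auto)
  then show ?thesis using c adj by (simp add: unitary_mat_def)
qed

definition act :: "nat \<Rightarrow> (nat \<Rightarrow> nat) \<times> nat list \<Rightarrow> nat \<Rightarrow> nat" where
  "act m = (\<lambda>(f, ws) i. put m ws i (f (get ws i)))"

definition classical_wf :: "nat \<Rightarrow> (nat \<Rightarrow> nat) \<times> nat list \<Rightarrow> bool" where
  "classical_wf m = (\<lambda>(f, ws). distinct ws \<and> set ws \<subseteq> {..<m} \<and> involution (length ws) f)"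

definition of_classical :: "(nat \<Rightarrow> nat) \<times> nat list \<Rightarrow> complex mat \<times> nat list" where
  "of_classical = (\<lambda>(f, ws). (classical_gate (length ws) f, ws))"

lemma gate_wf_of_classical: "classical_wf m c \<Longrightarrow> gate_wf m (of_classical c)"
  by (auto simp: classical_wf_def gate_wf_def of_classical_def unitary_classical_gate split: prod.splits)

lemma act_less [simp]: "act m c i < 2 ^ m"
  by (simp add: act_def split: prod.splits)

lemma act_act:
  assumes "classical_wf m c" "i < 2 ^ m"
  shows "act m c (act m c i) = i"
proof -
  obtain f ws where c: "c = (f, ws)" by (cases c)
  have ws: "distinct ws" "set ws \<subseteq> {..<m}" and f: "involution (length ws) f"
    using assms by (auto simp: c classical_wf_def)
  have "f (get ws i) < 2 ^ length ws" "f (f (get ws i)) = get ws i"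
    using f get_less by (auto simp: involution_def)
  then show ?thesis
    unfolding act_def c prod.case by (simp add: get_put ws put_get assms)
qed

lemma classical_gate_apply:
  assumes "classical_wf m c" "dim_vec v = 2 ^ m" "i < 2 ^ m"
  shows "(gate_mat m (of_classical c) *\<^sub>v v) $ i = v $ act m c i"
proof -
  obtain f ws where c: "c = (f, ws)" by (cases c)
  have ws: "distinct ws" "set ws \<subseteq> {..<m}" and f: "involution (length ws) f"
    using assms by (auto simp: c classical_wf_def)
  have *: "get ws i = f l \<longleftrightarrow> l = f (get ws i)" if "l < 2 ^ length ws" for l
    using f that get_less unfolding involution_def by metis
  have "(gate_mat m (of_classical c) *\<^sub>v v) $ i
      = (\<Sum>l<2 ^ length ws. if l = f (get ws i) then v $ put m ws i l else 0)"
    unfolding of_classical_def c prod.case gate_apply[OF ws assms(2,3)]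
    by (rule sum.cong) (auto simp: classical_gate_def *)
  also have "\<dots> = v $ act m c i"
    using f get_less[of ws i] by (simp add: act_def c involution_def)
  finally show ?thesis .
qed

lemma mass_classical_gate:
  assumes "classical_wf m c" "dim_vec v = 2 ^ m"
  shows "mass E (gate_mat m (of_classical c) *\<^sub>v v) = mass (\<lambda>i. E (act m c i)) v"
  unfolding mass_def
  by (rule sum.reindex_bij_witness[of _ "act m c" "act m c"])
    (use assms in \<open>auto simp: act_act classical_gate_apply simp del: index_mult_mat_vec\<close>)

text \<open>Measuring after a classical circuit is evaluating the circuit on the measured basis
  index, so claims about states reduce to claims about bits.\<close>

lemma mass_classical_circuit:
  assumes "\<forall>c \<in> set cs. classical_wf m c" "dim_vec v = 2 ^ m"
  shows "mass E (run_circuit (m, map of_classical cs) v) = mass (\<lambda>i. E (fold (act m) cs i)) v"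
  using assms by (induction cs arbitrary: v) (auto simp: mass_classical_gate)

lemma classical_gate_unit_vec:
  assumes "classical_wf m c" "i < 2 ^ m"
  shows "gate_mat m (of_classical c) *\<^sub>v unit_vec (2 ^ m) i = unit_vec (2 ^ m) (act m c i)"
proof (rule eq_vecI)
  fix j assume "j < dim_vec (unit_vec (2 ^ m) (act m c i) :: complex vec)"
  then have j: "j < 2 ^ m" by simp
  have "act m c j = i \<longleftrightarrow> j = act m c i" using act_act[OF assms(1)] assms(2) j by metis
  then show "(gate_mat m (of_classical c) *\<^sub>v unit_vec (2 ^ m) i) $ j = unit_vec (2 ^ m) (act m c i) $ j"
    using j assms by (auto simp: classical_gate_apply simp del: index_mult_mat_vec)
qed simp

lemma classical_circuit_unit_vec:
  assumes "\<forall>c \<in> set cs. classical_wf m c" "i < 2 ^ m"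
  shows "run_circuit (m, map of_classical cs) (unit_vec (2 ^ m) i) = unit_vec (2 ^ m) (fold (act m) cs i)"
  using assms by (induction cs arbitrary: i) (auto simp: classical_gate_unit_vec)

definition bit_fun :: "nat \<Rightarrow> ((nat \<Rightarrow> bool) \<Rightarrow> nat \<Rightarrow> bool) \<Rightarrow> nat \<Rightarrow> nat" where
  "bit_fun k F l = nat_of k (F (bit l))"

lemma involution_bit_fun:
  assumes "\<And>\<beta> t. t < k \<Longrightarrow> F (\<lambda>t. t < k \<and> F \<beta> t) t = \<beta> t"
  shows "involution k (bit_fun k F)"
  unfolding involution_def bit_fun_def
proof (intro allI impI conjI)
  fix l :: nat assume l: "l < 2 ^ k"
  show "nat_of k (F (bit (nat_of k (F (bit l))))) = l"
    by (rule nat_bit_eqI[OF _ l]) (simp_all add: bit_nat_of[abs_def] assms)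
qed simp

lemma bit_act_bit_fun:
  "bit (act m (bit_fun k F, ws) i) w \<longleftrightarrow> w < m \<and>
     (if w \<in> set ws then idx ws w < k \<and> F (\<lambda>t. t < length ws \<and> bit i (ws ! t)) (idx ws w) else bit i w)"
  by (simp add: act_def bit_put bit_fun_def bit_get[abs_def])

definition cnot :: "nat \<Rightarrow> nat" where
  "cnot = bit_fun 2 (\<lambda>\<beta> t. if t = 1 then \<beta> 1 \<noteq> \<beta> 0 else \<beta> t)"

definition swap_bits :: "nat \<Rightarrow> nat" where
  "swap_bits = bit_fun 2 (\<lambda>\<beta> t. \<beta> (1 - t))"

text \<open>The disjunction is added modulo 2 to the third bit, which makes the map reversible; on a
  zero target it is the plain disjunction.\<close>

definition or_into :: "nat \<Rightarrow> nat" where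
  "or_into = bit_fun 3 (\<lambda>\<beta> t. if t = 2 then \<beta> 2 \<noteq> (\<beta> 0 \<or> \<beta> 1) else \<beta> t)"

lemma involution_gates [simp]: "involution 2 cnot" "involution 2 swap_bits" "involution 3 or_into"
  unfolding cnot_def swap_bits_def or_into_def
  by (rule involution_bit_fun; force simp: less_Suc_eq numeral_2_eq_2 numeral_3_eq_3)+

lemma bit_act_cnot:
  "a \<noteq> b \<Longrightarrow> bit (act m (cnot, [a, b]) i) w \<longleftrightarrow> w < m \<and> (if w = b then bit i b \<noteq> bit i a else bit i w)"
  by (auto simp: cnot_def bit_act_bit_fun)

lemma bit_act_swap:
  "a \<noteq> b \<Longrightarrow> bit (act m (swap_bits, [a, b]) i) w \<longleftrightarrow>
     w < m \<and> (if w = a then bit i b else if w = b then bit i a else bit i w)"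
  by (auto simp: swap_bits_def bit_act_bit_fun)

lemma bit_act_or:
  "distinct [a, b, c] \<Longrightarrow> bit (act m (or_into, [a, b, c]) i) w \<longleftrightarrow>
     w < m \<and> (if w = c then bit i c \<noteq> (bit i a \<or> bit i b) else bit i w)"
  by (auto simp: or_into_def bit_act_bit_fun)


text \<open>The Pauli matrix Z. On qubit 0 it is I - 2P for the projection P onto acceptance, that
  is, the reflection.\<close>

definition z_gate :: "complex mat" where
  "z_gate = mat 2 2 (\<lambda>(i, j). if i = j then (if i = 0 then 1 else - 1) else 0)"

lemma unitary_z_gate: "unitary_mat 2 z_gate"
proof -
  have c: "z_gate \<in> carrier_mat 2 2" by (simp add: z_gate_def)
  have adj: "mat_adjoint z_gate = z_gate"
    by (rule mat_adjoint_eqI[OF c]) (auto simp: z_gate_def)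
  have "z_gate * z_gate = 1\<^sub>m 2"
    by (rule eq_matI) (auto simp: z_gate_def scalar_prod_def numeral_2_eq_2 less_Suc_eq)
  then show ?thesis using c adj by (simp add: unitary_mat_def)
qed

lemma z_gate_apply:
  assumes "0 < m" "dim_vec v = 2 ^ m" "i < 2 ^ m"
  shows "(gate_mat m (z_gate, [0]) *\<^sub>v v) $ i = (if bit i 0 then - (v $ i) else v $ i)"
proof -
  have *: "get [0] i = (if bit i 0 then 1 else 0)"
    by (simp add: get_def)
  have "put m [0] i (get [0] i) = i" by (rule put_get) (use assms in auto)
  then have p: "put m [0] i (if bit i 0 then 1 else 0) = i" unfolding * .
  show ?thesis
    using gate_apply[of "[0]" m v i z_gate] assms p unfolding *
    by (auto simp: z_gate_def lessThan_Suc numeral_2_eq_2 split: if_splits)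
qed


text \<open>Rotates a fresh second qubit by an angle that depends on the first one and then swaps the two.\<close>

definition affine_gate :: "real \<Rightarrow> real \<Rightarrow> complex mat" where
  "affine_gate q0 q1 = mat 4 4 (\<lambda>(i, j). complex_of_real
     ([[sqrt (1 - q0), 0, sqrt q0, 0], [sqrt q0, 0, - sqrt (1 - q0), 0],
       [0, sqrt (1 - q1), 0, sqrt q1], [0, sqrt q1, 0, - sqrt (1 - q1)]] ! i ! j))"

lemma less_4_cases: "(i::nat) < 4 \<longleftrightarrow> i = 0 \<or> i = 1 \<or> i = 2 \<or> i = 3"
  by auto

lemma unitary_affine_gate:
  assumes "0 \<le> q0" "q0 \<le> 1" "0 \<le> q1" "q1 \<le> 1"
  shows "unitary_mat 4 (affine_gate q0 q1)"
proof -
  let ?U = "affine_gate q0 q1"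
  define r where "r = [[sqrt (1 - q0), 0, sqrt q0, 0], [sqrt q0, 0, - sqrt (1 - q0), 0],
       [0, sqrt (1 - q1), 0, sqrt q1], [0, sqrt q1, 0, - sqrt (1 - q1)]]"
  have c: "?U \<in> carrier_mat 4 4" by (simp add: affine_gate_def)
  have U: "?U $$ (i, j) = complex_of_real (r ! i ! j)" if "i < 4" "j < 4" for i j
    using that by (simp add: affine_gate_def r_def)
  have d: "dim_row (mat_adjoint ?U) = 4" "dim_col (mat_adjoint ?U) = 4"
    using carrier_matD[OF mat_adjoint_carrier[OF c]] by auto
  have sum4: "(\<Sum>l = 0..<4. f l) = f 0 + f 1 + f 2 + f 3" for f :: "nat \<Rightarrow> real"
    by (simp add: numeral_eq_Suc)
  \<comment> \<open>All entries are real, so unitarity amounts to orthonormal rows and columns, and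
    the norms reduce to (1 - q) + q = 1.\<close>
  have cols: "\<forall>i \<in> {0, 1, 2, 3}. \<forall>j \<in> {0, 1, 2, 3}. (\<Sum>l = 0..<4. r ! l ! i * r ! l ! j) = of_bool (i = j)"
    and rows: "\<forall>i \<in> {0, 1, 2, 3}. \<forall>j \<in> {0, 1, 2, 3}. (\<Sum>l = 0..<4. r ! i ! l * r ! j ! l) = of_bool (i = j)"
    unfolding sum4 using assms by (simp_all add: r_def)
  have eq: "(\<Sum>l = 0..<4. complex_of_real (f l) * complex_of_real (g l)) = complex_of_real (\<Sum>l = 0..<4. f l * g l)" for f g
    by simp
  have "mat_adjoint ?U * ?U = 1\<^sub>m 4"
  proof (rule eq_matI)
    fix i j assume "i < dim_row (1\<^sub>m 4)" "j < dim_col (1\<^sub>m 4)"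
    then have ij: "i < 4" "j < 4" by simp_all
    have "(mat_adjoint ?U * ?U) $$ (i, j) = (\<Sum>l = 0..<4. complex_of_real (r ! l ! i) * complex_of_real (r ! l ! j))"
      using ij c d by (auto simp: scalar_prod_def mat_adjoint_index[OF c] U intro!: sum.cong)
    then show "(mat_adjoint ?U * ?U) $$ (i, j) = 1\<^sub>m 4 $$ (i, j)"
      unfolding eq using bspec[OF bspec[OF cols], of i j] ij by (simp add: less_4_cases del: of_real_sum)
  qed (use c d in auto)
  moreover have "?U * mat_adjoint ?U = 1\<^sub>m 4"
  proof (rule eq_matI)
    fix i j assume "i < dim_row (1\<^sub>m 4)" "j < dim_col (1\<^sub>m 4)"
    then have ij: "i < 4" "j < 4" by simp_all
    have "(?U * mat_adjoint ?U) $$ (i, j) = (\<Sum>l = 0..<4. complex_of_real (r ! i ! l) * complex_of_real (r ! j ! l))"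
      using ij c d by (auto simp: scalar_prod_def mat_adjoint_index[OF c] U intro!: sum.cong)
    then show "(?U * mat_adjoint ?U) $$ (i, j) = 1\<^sub>m 4 $$ (i, j)"
      unfolding eq using bspec[OF bspec[OF rows], of i j] ij by (simp add: less_4_cases del: of_real_sum)
  qed (use c d in auto)
  ultimately show ?thesis using c by (simp add: unitary_mat_def)
qed


section \<open>Circuits accepting with prescribed probabilities\<close>

definition interp :: "complex mat list \<Rightarrow> (nat \<times> nat list) list \<Rightarrow> (complex mat \<times> nat list) list" where
  "interp G gs = map (\<lambda>(g, ws). (G ! g, ws)) gs"

definition gates_below :: "nat \<Rightarrow> (nat \<times> nat list) list \<Rightarrow> bool" where
  "gates_below k gs \<longleftrightarrow> (\<forall>(g, ws) \<in> set gs. g < k)"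

definition rename_gates :: "nat \<Rightarrow> (nat \<times> nat list) list \<Rightarrow> (nat \<times> nat list) list" where
  "rename_gates k gs = map (\<lambda>(g, ws). (g + k, ws)) gs"

lemma interp_append: "interp G (gs @ hs) = interp G gs @ interp G hs"
  by (simp add: interp_def)

lemma interp_shift: "interp G (shift_gates n gs) = shift_gates n (interp G gs)"
  by (auto simp: interp_def shift_gates_def)

lemma interp_append_left: "gates_below (length G) gs \<Longrightarrow> interp (G @ H) gs = interp G gs"
  by (auto simp: interp_def gates_below_def nth_append)

lemma interp_rename: "k = length G \<Longrightarrow> interp (G @ H) (rename_gates k gs) = interp H gs"
  by (auto simp: interp_def rename_gates_def nth_append)

lemma gates_below_append [simp]: "gates_below k (gs @ hs) \<longleftrightarrow> gates_below k gs \<and> gates_below k hs"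
  by (auto simp: gates_below_def)

lemma gates_below_shift [simp]: "gates_below k (shift_gates n gs) \<longleftrightarrow> gates_below k gs"
  by (auto simp: gates_below_def shift_gates_def)

lemma gates_below_rename: "gates_below j gs \<Longrightarrow> j + l \<le> k \<Longrightarrow> gates_below k (rename_gates l gs)"
  by (fastforce simp: gates_below_def rename_gates_def)

lemma gates_below_mono: "gates_below j gs \<Longrightarrow> j \<le> k \<Longrightarrow> gates_below k gs"
  by (fastforce simp: gates_below_def)

text \<open>Width and gates are kept as separate polynomial-time objects, so that the two can be
  transformed independently and reassembled.\<close>

definition describes :: "(nat \<Rightarrow> circuit) \<Rightarrow> complex mat list \<Rightarrow> (nat \<Rightarrow> nat) \<Rightarrow>
    (nat \<Rightarrow> (nat \<times> nat list) list) \<Rightarrow> bool" where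
  "describes C G m gs \<longleftrightarrow> punary m \<and> pgates gs \<and> (\<forall>n. gates_below (length G) (gs n) \<and>
     C n = (m n, interp G (gs n)) \<and> circuit_wf (m n, interp G (gs n)))"

lemma describesD:
  assumes "describes C G m gs"
  shows "punary m" "pgates gs" "gates_below (length G) (gs n)" "C n = (m n, interp G (gs n))"
    "circuit_wf (m n, interp G (gs n))"
  using assms unfolding describes_def by blast+

lemma describes_imp_uniform:
  assumes "describes C G m gs"
  shows "uniform_circuits C"
  unfolding uniform_circuits_def
proof (intro exI conjI allI)
  show "polytime (\<lambda>n. encode_circuit ((\<lambda>n. (m n, gs n)) n))"
    using ptimeD[OF ptime_encode_circuit[OF describesD(1,2)[OF assms]]] by simp
qed (use describesD(3-5)[OF assms] in \<open>auto simp: gates_below_def interpret_circuit_def interp_def\<close>)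

text \<open>The fixed gate list bounds the alphabet of the encodings by \<open>length G + 2\<close>,
  which upgrades \<open>polytime\<close> to \<open>ptime\<close>.\<close>

lemma uniform_imp_describes:
  assumes "uniform_circuits C"
  shows "\<exists>G m gs. describes C G m gs"
proof -
  obtain G D where D: "polytime (\<lambda>n. encode_circuit (D n))"
    "\<And>n. \<forall>(g, ws) \<in> set (snd (D n)). g < length G" "\<And>n. C n = interpret_circuit G (D n)" "\<And>n. circuit_wf (C n)"
    using assms unfolding uniform_circuits_def by blast
  define m where "m n = fst (D n)" for n
  define gs where "gs n = snd (D n)" for n
  have Dn: "D n = (m n, gs n)" for n by (simp add: m_def gs_def)
  have wires: "set (concat (map encode_nat ws)) \<subseteq> {..<2}" for ws
    by (auto simp: encode_nat_def)
  have "set (encode_gates hs) \<subseteq> {..<length G + 2}" if "gates_below (length G) hs" for hs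
    using that
  proof (induction hs)
    case (Cons h hs)
    obtain g ws where "h = (g, ws)" by (cases h)
    then show ?case using Cons wires[of ws] by (auto simp: gates_below_def)
  qed simp
  moreover have below: "gates_below (length G) (gs n)" for n
    using D(2)[of n] by (simp add: gates_below_def gs_def)
  ultimately have "set (encode_circuit (D n)) \<subseteq> {..<length G + 2}" for n
    by (auto simp: Dn encode_circuit_eq)
  then have p: "ptime (\<lambda>n. encode_circuit (m n, gs n))"
    using D(1) unfolding ptime_def Dn by blast
  have C: "C n = (m n, interp G (gs n))" for n
    using D(3)[of n] by (simp add: Dn interpret_circuit_def interp_def)
  then have "describes C G m gs"
    unfolding describes_def using punary_header[OF p] pgates_body[OF p] below D(4) by metis
  then show ?thesis by blast
qed

lemma pgates_rename_gates: "pgates gs \<Longrightarrow> pgates (\<lambda>n. rename_gates k (gs n))"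
  unfolding rename_gates_def by (rule pgates_rename)

lemma pgates_shift_gates: "pgates gs \<Longrightarrow> punary s \<Longrightarrow> pgates (\<lambda>n. shift_gates (s n) (gs n))"
  unfolding shift_gates_def by (rule pgates_shift)


text \<open>The classes on which the maps of the acceptance probability act. No order between
  \<open>\<delta>\<close> and \<open>\<epsilon>\<close> is imposed, so complements stay inside the
  scheme.\<close>

definition EQP_with :: "real \<Rightarrow> real \<Rightarrow> language set" where
  "EQP_with \<delta> \<epsilon> = {L. \<exists>a C.
     uniform_circuits C \<and> (\<forall>n. fst (C n) = n + a n \<and> 0 < n + a n) \<and>
     (\<forall>n x. length x = n \<longrightarrow>
        outcome_prob (qubit0_proj (n + a n))
          (run_circuit (C n) (tensor_state n (ket x) (a n) (ket0 (a n)))) =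
          (if x \<in> L then \<epsilon> else \<delta>))}"

lemma EQP_eq: "EQP = EQP_with 0 1"
  by (simp add: EQP_def EQP_with_def)

lemma EQP_with_iff:
  "L \<in> EQP_with \<delta> \<epsilon> \<longleftrightarrow> (\<exists>a G gs. describes (\<lambda>n. (n + a n, interp G (gs n))) G (\<lambda>n. n + a n) gs \<and>
     (\<forall>n. 0 < n + a n) \<and>
     (\<forall>n x. length x = n \<longrightarrow>
        mass (\<lambda>i. bit i 0) (run_circuit (n + a n, interp G (gs n)) (tensor_state n (ket x) (a n) (ket0 (a n))))
        = (if x \<in> L then \<epsilon> else \<delta>)))" (is "_ \<longleftrightarrow> ?R")
proof
  assume "L \<in> EQP_with \<delta> \<epsilon>"
  then obtain a C where "uniform_circuits C \<and> (\<forall>n. fst (C n) = n + a n \<and> 0 < n + a n) \<and>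
     (\<forall>n x. length x = n \<longrightarrow>
        outcome_prob (qubit0_proj (n + a n))
          (run_circuit (C n) (tensor_state n (ket x) (a n) (ket0 (a n)))) = (if x \<in> L then \<epsilon> else \<delta>))"
    unfolding EQP_with_def mem_Collect_eq by (elim exE) (rule that)
  then have C: "uniform_circuits C" "\<And>n. fst (C n) = n + a n" "\<And>n. 0 < n + a n"
    "\<And>n x. length x = n \<Longrightarrow>
        outcome_prob (qubit0_proj (n + a n))
          (run_circuit (C n) (tensor_state n (ket x) (a n) (ket0 (a n)))) = (if x \<in> L then \<epsilon> else \<delta>)"
    by auto
  obtain G m gs where G: "describes C G m gs"
    using uniform_imp_describes[OF C(1)] by blast
  have m: "m = (\<lambda>n. n + a n)" using C(2) describesD(4)[OF G] by (metis fst_conv)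
  have Cn: "C = (\<lambda>n. (n + a n, interp G (gs n)))" using describesD(4)[OF G] m by auto
  show ?R
    by (rule exI[of _ a], rule exI[of _ G], rule exI[of _ gs])
      (use G C(3,4) in \<open>simp add: Cn m outcome_prob_qubit0\<close>)
next
  assume ?R
  then obtain a G gs where G0: "describes (\<lambda>n. (n + a n, interp G (gs n))) G (\<lambda>n. n + a n) gs \<and>
     (\<forall>n. 0 < n + a n) \<and>
     (\<forall>n x. length x = n \<longrightarrow>
        mass (\<lambda>i. bit i 0) (run_circuit (n + a n, interp G (gs n)) (tensor_state n (ket x) (a n) (ket0 (a n))))
        = (if x \<in> L then \<epsilon> else \<delta>))" by (elim exE) (rule that)
  show "L \<in> EQP_with \<delta> \<epsilon>"
    unfolding EQP_with_def
    by (rule CollectI, rule exI[of _ a], rule exI[of _ "\<lambda>n. (n + a n, interp G (gs n))"])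
      (use G0 describes_imp_uniform[OF conjunct1[OF G0]] in \<open>simp add: outcome_prob_qubit0\<close>)
qed

section \<open>Passing between the formats of EQP and EBQP\<close>

lemma norm_sq_unit_vec: "i < d \<Longrightarrow> norm_sq (unit_vec d i) = 1"
proof -
  assume i: "i < d"
  have "norm_sq (unit_vec d i) = (\<Sum>j<d. if j = i then 1 else 0)"
    unfolding norm_sq_def by (rule sum.cong) (auto simp: i)
  then show ?thesis using i by simp
qed

lemma projection_qubit0: "projection_mat (2 ^ m) (qubit0_proj m)"
proof -
  have c: "qubit0_proj m \<in> carrier_mat (2 ^ m) (2 ^ m)" by (simp add: qubit0_proj_def)
  have adj: "mat_adjoint (qubit0_proj m) = qubit0_proj m"
    by (rule mat_adjoint_eqI[OF c]) (auto simp: qubit0_proj_def)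
  have "qubit0_proj m * qubit0_proj m = qubit0_proj m"
  proof (rule eq_matI)
    fix i j assume "i < dim_row (qubit0_proj m)" "j < dim_col (qubit0_proj m)"
    then have ij: "i < 2 ^ m" "j < 2 ^ m" by (simp_all add: qubit0_proj_def)
    have "(qubit0_proj m * qubit0_proj m) $$ (i, j)
        = (\<Sum>l<2 ^ m. if l = i then of_bool (i = j \<and> bit i 0) else 0)"
      using ij by (auto simp: qubit0_proj_def scalar_prod_def lessThan_atLeast0 intro!: sum.cong)
    then show "(qubit0_proj m * qubit0_proj m) $$ (i, j) = qubit0_proj m $$ (i, j)"
      using ij by (simp add: qubit0_proj_def)
  qed (simp_all add: qubit0_proj_def)
  then show ?thesis using c adj by (simp add: projection_mat_def)
qed

text \<open>Replacing every gate by the identity gives trivial circuits without changing the descriptions.\<close>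

lemma uniform_trivial_circuits:
  assumes "uniform_circuits C"
  shows "\<exists>C'. uniform_circuits C' \<and> (\<forall>n. fst (C' n) = fst (C n) \<and>
    (\<forall>v. dim_vec v = 2 ^ fst (C n) \<longrightarrow> run_circuit (C' n) v = v))"
proof -
  obtain G m gs where "describes C G m gs"
    using uniform_imp_describes[OF assms] by blast
  note G = describesD[OF this]
  define I where "I = map (\<lambda>U. 1\<^sub>m (dim_row U) :: complex mat) G"
  have one: "unitary_mat d (1\<^sub>m d)" for d
  proof -
    have "mat_adjoint (1\<^sub>m d) = (1\<^sub>m d :: complex mat)"
      by (rule mat_adjoint_eqI[of _ d]) auto
    then show ?thesis by (simp add: unitary_mat_def)
  qed
  have I: "U = 1\<^sub>m (2 ^ length ws) \<and> gate_wf (m n) (U, ws)" if mem: "(U, ws) \<in> set (interp I (gs n))" for U ws n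
  proof -
    obtain g where g: "(g, ws) \<in> set (gs n)" "U = I ! g" using mem by (auto simp: interp_def)
    then have "g < length G" using G(3)[of n] by (auto simp: gates_below_def)
    moreover have "gate_wf (m n) (G ! g, ws)"
      using G(5)[of n] g by (force simp: circuit_wf_def interp_def)
    ultimately show ?thesis using g one by (auto simp: I_def gate_wf_def unitary_mat_def)
  qed
  have triv: "run_circuit (m n, hs) v = v"
    if "\<forall>h \<in> set hs. fst h = 1\<^sub>m (2 ^ length (snd h))" "dim_vec v = 2 ^ m n" for n hs v
    using that
  proof (induction hs)
    case (Cons h hs)
    have "h = (1\<^sub>m (2 ^ length (snd h)), snd h)" using Cons.prems by (simp add: prod_eq_iff)
    then have "gate_mat (m n) h *\<^sub>v v = v"
      using Cons.prems(2) gate_mat_one[of "m n" "snd h"] by (metis carrier_vecI one_mult_mat_vec)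
    then show ?case using Cons by simp
  qed simp
  show ?thesis
  proof (intro exI conjI allI impI)
    have "describes (\<lambda>n. (m n, interp I (gs n))) I m gs"
      unfolding describes_def using G(1-3) I by (auto simp: I_def circuit_wf_def)
    then show "uniform_circuits (\<lambda>n. (m n, interp I (gs n)))" by (rule describes_imp_uniform)
    show "run_circuit (m n, interp I (gs n)) v = v" if "dim_vec v = 2 ^ fst (C n)" for n v
    proof (rule triv)
      show "\<forall>h \<in> set (interp I (gs n)). fst h = 1\<^sub>m (2 ^ length (snd h))"
        using I by (metis prod.collapse)
    qed (use that in \<open>simp add: G(4)\<close>)
    show "fst (m n, interp I (gs n)) = fst (C n)" for n by (simp add: G(4))
  qed
qed

text \<open>The all-zero state and the standard measurement call for no work, but uniform circuits
  realising them have to be exhibited; the given family with its gates trivialised already has a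
  suitable number of wires.\<close>

lemma EQP_subset_EBQP_with: "EQP \<subseteq> EBQP_with 0 1"
proof
  fix L assume "L \<in> EQP"
  then obtain a C where "uniform_circuits C \<and> (\<forall>n. fst (C n) = n + a n \<and> 0 < n + a n) \<and>
     (\<forall>n x. length x = n \<longrightarrow>
        outcome_prob (qubit0_proj (n + a n))
          (run_circuit (C n) (tensor_state n (ket x) (a n) (ket0 (a n)))) = (if x \<in> L then 1 else 0))"
    unfolding EQP_def mem_Collect_eq by (elim exE) (rule that)
  then have C: "uniform_circuits C" "\<And>n. fst (C n) = n + a n" "\<And>n. 0 < n + a n"
    "\<And>n x. length x = n \<Longrightarrow>
        outcome_prob (qubit0_proj (n + a n))
          (run_circuit (C n) (tensor_state n (ket x) (a n) (ket0 (a n)))) = (if x \<in> L then 1 else 0)"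
    by auto
  obtain I where I: "uniform_circuits I" "\<forall>n. fst (I n) = fst (C n) \<and>
      (\<forall>v. dim_vec v = 2 ^ fst (C n) \<longrightarrow> run_circuit (I n) v = v)"
    using uniform_trivial_circuits[OF C(1)] by blast
  have "uniform_states a (\<lambda>n. ket0 (a n))"
    unfolding uniform_states_def
  proof (intro conjI allI)
    show "\<exists>C b. uniform_circuits C \<and> (\<forall>n. fst (C n) = a n + b n \<and>
             run_circuit (C n) (ket0 (a n + b n)) = tensor_state (a n) (ket0 (a n)) (b n) (ket0 (b n)))"
      \<comment> \<open>The circuits have n + a n wires, so the surplus n wires are declared to be
        work qubits.\<close>
      by (rule exI[of _ I], rule exI[of _ "\<lambda>n. n"])
        (use I C(2) in \<open>auto simp: tensor_ket0_ket0 add.commute\<close>)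
  qed (auto simp: ket0_eq norm_sq_unit_vec)
  moreover have "uniform_measurements (\<lambda>n. n + a n) (\<lambda>n. qubit0_proj (n + a n))"
    unfolding uniform_measurements_def
  proof (intro conjI allI)
    have "tensor_state m v 0 (ket0 0) = v" if "dim_vec v = 2 ^ m" for m v
      by (rule eq_vecI) (use that in \<open>auto simp: tensor_state_index ket0_eq take_bit_nat_eq_self drop_bit_eq_div\<close>)
    then show "\<exists>C b. uniform_circuits C \<and> (\<forall>n. fst (C n) = n + a n + b n \<and> 0 < n + a n + b n \<and>
             (\<forall>v \<in> carrier_vec (2 ^ (n + a n)).
                outcome_prob (qubit0_proj (n + a n + b n))
                  (run_circuit (C n) (tensor_state (n + a n) v (b n) (ket0 (b n)))) =
                outcome_prob (qubit0_proj (n + a n)) v))"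
      by (intro exI[of _ I] exI[of _ "\<lambda>n. 0"]) (use I C(2,3) in auto)
  qed (rule projection_qubit0)
  ultimately show "L \<in> EBQP_with 0 1"
    unfolding EBQP_with_def using C(1,2,4)
    by (intro CollectI exI[of _ a] exI[of _ C] exI[of _ "\<lambda>n. ket0 (a n)"] exI[of _ "\<lambda>n. qubit0_proj (n + a n)"]) auto
qed

text \<open>State preparation, computation and the reduction of the measurement to qubit 0 are
  chained into one circuit that starts from zero ancillas.\<close>

lemma EBQP_with_subset: "EBQP_with \<delta> \<epsilon> \<subseteq> EQP_with \<delta> \<epsilon>"
proof
  fix L assume "L \<in> EBQP_with \<delta> \<epsilon>"
  then obtain a C A P where EB: "uniform_circuits C \<and> (\<forall>n. fst (C n) = n + a n) \<and>
     uniform_states a A \<and> uniform_measurements (\<lambda>n. n + a n) P \<and>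
     (\<forall>n x. length x = n \<longrightarrow>
        outcome_prob (P n) (run_circuit (C n) (tensor_state n (ket x) (a n) (A n))) = (if x \<in> L then \<epsilon> else \<delta>))"
    unfolding EBQP_with_def mem_Collect_eq by (elim exE) (rule that)
  then have C: "uniform_circuits C" "\<And>n. fst (C n) = n + a n"
    and prob: "\<And>n x. length x = n \<Longrightarrow>
        outcome_prob (P n) (run_circuit (C n) (tensor_state n (ket x) (a n) (A n))) = (if x \<in> L then \<epsilon> else \<delta>)"
    by auto
  have "\<exists>S b. uniform_circuits S \<and> (\<forall>n. fst (S n) = a n + b n \<and>
      run_circuit (S n) (ket0 (a n + b n)) = tensor_state (a n) (A n) (b n) (ket0 (b n)))"
    using EB unfolding uniform_states_def by (elim conjE)
  then obtain S b where S: "uniform_circuits S" "\<And>n. fst (S n) = a n + b n"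
    and prep: "\<And>n. run_circuit (S n) (ket0 (a n + b n)) = tensor_state (a n) (A n) (b n) (ket0 (b n))"
    by blast
  have "\<exists>M c. uniform_circuits M \<and> (\<forall>n. fst (M n) = n + a n + c n \<and> 0 < n + a n + c n \<and>
      (\<forall>v \<in> carrier_vec (2 ^ (n + a n)).
        outcome_prob (qubit0_proj (n + a n + c n)) (run_circuit (M n) (tensor_state (n + a n) v (c n) (ket0 (c n)))) =
        outcome_prob (P n) v))"
    using EB unfolding uniform_measurements_def by (elim conjE)
  then obtain M c where M0: "uniform_circuits M \<and> (\<forall>n. fst (M n) = n + a n + c n \<and> 0 < n + a n + c n \<and>
      (\<forall>v \<in> carrier_vec (2 ^ (n + a n)).
        outcome_prob (qubit0_proj (n + a n + c n)) (run_circuit (M n) (tensor_state (n + a n) v (c n) (ket0 (c n)))) =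
        outcome_prob (P n) v))"
    by (elim exE) (rule that)
  then have M: "uniform_circuits M" "\<And>n. fst (M n) = n + a n + c n" "\<And>n. 0 < n + a n + c n"
    and meas: "\<And>n v. v \<in> carrier_vec (2 ^ (n + a n)) \<Longrightarrow>
        outcome_prob (qubit0_proj (n + a n + c n)) (run_circuit (M n) (tensor_state (n + a n) v (c n) (ket0 (c n)))) =
        outcome_prob (P n) v"
    by simp_all
  obtain GC mC gC where "describes C GC mC gC"
    using uniform_imp_describes[OF C(1)] by blast
  note GC = describesD[OF this]
  obtain GS mS gS where "describes S GS mS gS"
    using uniform_imp_describes[OF S(1)] by blast
  note GS = describesD[OF this]
  obtain GM mM gM where "describes M GM mM gM"
    using uniform_imp_describes[OF M(1)] by blast
  note GM = describesD[OF this]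
  have m: "mC n = n + a n" "mS n = a n + b n" "mM n = n + a n + c n" for n
    using C(2)[of n] S(2)[of n] M(2)[of n] GC(4)[of n] GS(4)[of n] GM(4)[of n] by simp_all
  text \<open>The measurement can reuse the work qubits of the state preparation, which are zero again; taking
    the total number of wires larger than needed avoids computing any difference or maximum.\<close>
  define a' where "a' n = (a n + b n) + (n + a n + c n)" for n
  \<comment> \<open>The preparation is moved past the n input wires; gate names are offset because
    the three gate lists are concatenated.\<close>
  define gs where "gs n = shift_gates n (gS n) @ rename_gates (length GS) (gC n)
     @ rename_gates (length GS + length GC) (gM n)" for n
  define G where "G = GS @ GC @ GM"
  have interp: "interp G (gs n) = shift_gates n (interp GS (gS n)) @ interp GC (gC n) @ interp GM (gM n)" for n
  proof -
    have "interp G (gS n) = interp GS (gS n)"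
      unfolding G_def by (rule interp_append_left) (rule GS)
    moreover have "interp G (rename_gates (length GS) (gC n)) = interp GC (gC n)"
      unfolding G_def using GC(3) by (simp add: interp_rename interp_append_left)
    moreover have "interp G (rename_gates (length GS + length GC) (gM n)) = interp GM (gM n)"
      unfolding G_def append_assoc[symmetric] by (rule interp_rename) simp
    ultimately show ?thesis by (simp add: gs_def interp_append interp_shift)
  qed
  show "L \<in> EQP_with \<delta> \<epsilon>"
    unfolding EQP_with_iff
  proof (intro exI conjI allI impI)
    show "describes (\<lambda>n. (n + a' n, interp G (gs n))) G (\<lambda>n. n + a' n) gs"
      unfolding describes_def
    proof (intro conjI allI)
      have "punary (\<lambda>n. n + (mS n + mM n))"
        by (intro ptime_unary_add ptime_unary GS GM)
      then show "punary (\<lambda>n. n + a' n)" by (simp add: m a'_def)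
      show "pgates gs"
        unfolding gs_def by (intro pgates_append pgates_shift_gates pgates_rename_gates ptime_unary GS GM GC)
      show "gates_below (length G) (gs n)" for n
        using GS(3)[of n] GC(3)[of n] GM(3)[of n] unfolding gs_def G_def
        by (auto elim: gates_below_rename gates_below_mono)
      have wfS: "circuit_wf (n + mS n, shift_gates n (interp GS (gS n)))" for n
        by (rule circuit_wf_shift) (rule GS)
      show "circuit_wf (n + a' n, interp G (gs n))" for n
        unfolding interp circuit_wf_append
        using circuit_wf_mono[OF wfS[of n], of "n + a' n"] circuit_wf_mono[OF GC(5)[of n], of "n + a' n"]
          circuit_wf_mono[OF GM(5)[of n], of "n + a' n"] by (simp add: m a'_def)
    qed simp
    show "0 < n + a' n" for n using M(3)[of n] by (simp add: a'_def)
  next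
    fix n and x :: "bool list" assume x: "length x = n"
    let ?a = "a n" and ?b = "b n" and ?c = "c n"
    let ?R = "n + ?a + ?c" and ?Q = "?b + n + ?a"
    let ?X = "tensor_state n (ket x)"
    define v where "v = run_circuit (C n) (?X ?a (A n))"
    define w where "w = run_circuit (M n) (tensor_state (n + ?a) v ?c (ket0 ?c))"
    \<comment> \<open>Three splittings of one register: the wires up to those used by the
      preparation, the computation and the measurement, each followed by idle ones.\<close>
    have wires: "n + a' n = (n + (?a + ?b)) + ?R" "n + a' n = (n + ?a) + (?b + ?R)"
      "n + a' n = (n + ?a + ?c) + ?Q" by (simp_all add: a'_def)
    have dv: "dim_vec v = 2 ^ (n + ?a)" by (simp add: v_def GC(4) m)
    have "?X (a' n) (ket0 (a' n)) = tensor_state (n + (?a + ?b)) (?X (?a + ?b) (ket0 (?a + ?b))) ?R (ket0 ?R)"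
      unfolding tensor_assoc tensor_ket0_ket0 by (simp add: a'_def)
    then have 1: "run_circuit (n + a' n, shift_gates n (interp GS (gS n))) (?X (a' n) (ket0 (a' n)))
        = tensor_state (n + (?a + ?b)) (run_circuit (n + (?a + ?b), shift_gates n (interp GS (gS n)))
            (?X (?a + ?b) (ket0 (?a + ?b)))) ?R (ket0 ?R)"
      using GS(5)[of n] unfolding wires(1) m
      by (simp add: run_tensor_low circuit_wf_shift)
    also have "\<dots> = tensor_state (n + (?a + ?b)) (?X (?a + ?b) (tensor_state ?a (A n) ?b (ket0 ?b))) ?R (ket0 ?R)"
      using GS(5)[of n] prep[of n] unfolding m GS(4) by (simp add: run_tensor_high)
    also have "\<dots> = tensor_state (n + ?a) (?X ?a (A n)) (?b + ?R) (ket0 (?b + ?R))"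
      by (simp only: tensor_assoc tensor_ket0_ket0 add.assoc)
    finally have 1: "run_circuit (n + a' n, shift_gates n (interp GS (gS n))) (?X (a' n) (ket0 (a' n))) = \<dots>" .
    have 2: "run_circuit (n + a' n, interp GC (gC n)) (tensor_state (n + ?a) (?X ?a (A n)) (?b + ?R) (ket0 (?b + ?R)))
        = tensor_state (n + ?a) v (?b + ?R) (ket0 (?b + ?R))"
      using GC(5)[of n] unfolding wires(2) m v_def GC(4) by (simp add: run_tensor_low)
    have "?b + ?R = ?c + ?Q" by simp
    then have "tensor_state (n + ?a) v (?b + ?R) (ket0 (?b + ?R)) = tensor_state (n + ?a + ?c) (tensor_state (n + ?a) v ?c (ket0 ?c)) ?Q (ket0 ?Q)"
      unfolding tensor_assoc tensor_ket0_ket0 by (simp only:)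
    then have 3: "run_circuit (n + a' n, interp GM (gM n)) (tensor_state (n + ?a) v (?b + ?R) (ket0 (?b + ?R)))
        = tensor_state (n + ?a + ?c) w ?Q (ket0 ?Q)"
      using GM(5)[of n] unfolding wires(3) m w_def GM(4) by (simp add: run_tensor_low)
    have "run_circuit (n + a' n, interp G (gs n)) (?X (a' n) (ket0 (a' n))) = tensor_state (n + ?a + ?c) w ?Q (ket0 ?Q)"
      unfolding interp run_circuit_append 1 2 3 ..
    moreover have dw: "dim_vec w = 2 ^ (n + ?a + ?c)"
      unfolding w_def GM(4) m by simp
    moreover have "mass (\<lambda>i. bit i 0) w = (if x \<in> L then \<epsilon> else \<delta>)"
      using meas[of v n] prob[OF x] outcome_prob_qubit0[OF dw] carrier_vecI[OF dv] unfolding w_def v_def by simp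
    ultimately show "mass (\<lambda>i. bit i 0) (run_circuit (n + a' n, interp G (gs n)) (?X (a' n) (ket0 (a' n))))
        = (if x \<in> L then \<epsilon> else \<delta>)"
      using mass_tensor_ket0[OF dw] by simp
  qed
qed


section \<open>Affine maps of the acceptance probability\<close>

text \<open>The old qubit 0 ends up on wire \<open>N\<close> and selects whether the new qubit 0
  accepts with probability \<open>q0\<close> or \<open>q1\<close>. As it stays recorded there, the
  two cases do not interfere and the probabilities simply add.\<close>

lemma mass_affine_gate:
  assumes N: "0 < N" and u: "dim_vec u = 2 ^ N" and q: "0 \<le> q0" "q0 \<le> 1" "0 \<le> q1" "q1 \<le> 1"
  shows "mass (\<lambda>i. bit i 0) (gate_mat (N + 1) (affine_gate q0 q1, [0, N]) *\<^sub>v tensor_state N u 1 (ket0 1))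
    = q0 * (norm_sq u - mass (\<lambda>i. bit i 0) u) + q1 * mass (\<lambda>i. bit i 0) u"
proof -
  let ?v = "tensor_state N u 1 (ket0 1)" and ?ws = "[0, N]"
  let ?w = "gate_mat (N + 1) (affine_gate q0 q1, ?ws) *\<^sub>v ?v"
  \<comment> \<open>The bijection between accepting indices after the gate and all indices before
    it: the old bit 0 has moved to position \<open>N\<close>.\<close>
  let ?k = "\<lambda>i. nat_of N (\<lambda>w. if w = 0 then bit i N else bit i w)"
  let ?i = "\<lambda>k. nat_of (N + 1) (\<lambda>w. if w = 0 then True else if w = N then bit k 0 else bit k w)"
  have ws: "distinct ?ws" "set ?ws \<subseteq> {..<N + 1}" using N by auto
  have val: "?w $ i = complex_of_real (sqrt (if bit i N then q1 else q0)) * u $ ?k i"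
    if i: "i < 2 ^ (N + 1)" "bit i 0" for i
  proof -
    let ?p = "put (N + 1) ?ws i"
    \<comment> \<open>These are the accepting rows of the matrix: the low bit is 1, the high bit is
      the old qubit 0.\<close>
    have get: "get ?ws i = (if bit i N then 3 else 1)" using i by (simp add: get_def)
    have N1: "bit (?p l) N = bit l 1" "bit (?p l) 0 = bit l 0" for l
      using N by (simp_all add: bit_put)
    have dl: "drop_bit N (?p l) < 2 ^ 1" for l by (rule drop_bit_less[OF put_less])
    have high: "?v $ ?p l = 0" if "bit l 1" for l
    proof -
      have "bit (drop_bit N (?p l)) 0" using N1 that by (simp add: bit_drop_bit_eq)
      moreover have "bit j 0 \<Longrightarrow> j \<noteq> 0" for j :: nat by (metis bit_0_eq bot_apply bot_bool_def)
      ultimately have "drop_bit N (?p l) \<noteq> 0" by blast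
      then show ?thesis using dl[of l] unfolding tensor_state_index[OF put_less] by (simp add: ket0_eq)
    qed
    have low: "?v $ ?p l = u $ take_bit N (?p l)" if "\<not> bit l 1" for l
    proof -
      have "drop_bit N (?p l) = 0"
        by (rule nat_bit_eqI[OF dl]) (use N1 that in \<open>auto simp: bit_drop_bit_eq\<close>)
      then show ?thesis unfolding tensor_state_index[OF put_less] by (simp add: ket0_eq)
    qed
    have k: "take_bit N (?p l) = ?k i" if "bit l 0 = bit i N" for l
      by (rule nat_bit_eqI[of _ N]) (use N that in \<open>auto simp: bit_take_bit_iff bit_put\<close>)
    have b: "bit (2::nat) 1" "bit (3::nat) 1" "\<not> bit (0::nat) 1" "\<not> bit (1::nat) 1" "\<not> bit (0::nat) 0" "bit (1::nat) 0"
      by (simp_all add: bit_iff_odd)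
    have "?w $ i = (\<Sum>l<4. affine_gate q0 q1 $$ (get ?ws i, l) * ?v $ ?p l)"
      using gate_apply[OF ws, of ?v i] i by simp
    also have "\<dots> = affine_gate q0 q1 $$ (get ?ws i, 0) * u $ take_bit N (?p 0)
        + affine_gate q0 q1 $$ (get ?ws i, 1) * u $ take_bit N (?p 1)"
      using high[OF b(1)] high[OF b(2)] low[OF b(3)] low[OF b(4)] by (simp add: numeral_eq_Suc lessThan_Suc)
    also have "\<dots> = complex_of_real (sqrt (if bit i N then q1 else q0)) * u $ ?k i"
      using k[of 0] k[of 1] b unfolding get by (cases "bit i N") (simp_all add: affine_gate_def)
    finally show ?thesis .
  qed
  have "mass (\<lambda>i. bit i 0) ?w = (\<Sum>k<2 ^ N. (if bit k 0 then q1 else q0) * (cmod (u $ k))\<^sup>2)"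
    unfolding mass_def
  proof (rule sum.reindex_bij_witness[of _ ?i ?k])
    fix i assume "i \<in> {i. i < dim_vec ?w \<and> bit i 0}"
    then have i: "i < 2 ^ (N + 1)" "bit i 0" by auto
    show "?i (?k i) = i"
      by (rule nat_bit_eqI[OF nat_of_less i(1)]) (use N i in \<open>auto simp: less_Suc_eq\<close>)
    show "?k i \<in> {..<2 ^ N}" by simp
    show "(if bit (?k i) 0 then q1 else q0) * (cmod (u $ ?k i))\<^sup>2 = (cmod (?w $ i))\<^sup>2"
      unfolding val[OF i] using N q by (simp add: norm_mult power_mult_distrib)
  next
    fix k :: nat assume "k \<in> {..<2 ^ N}"
    then have k: "k < 2 ^ N" by simp
    show "?k (?i k) = k"
      by (rule nat_bit_eqI[OF nat_of_less k]) (use N in auto)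
    show "?i k \<in> {i. i < dim_vec ?w \<and> bit i 0}" using nat_of_less[of "N + 1"] by simp
  qed
  also have "\<dots> = (\<Sum>k<2 ^ N. (if bit k 0 then q1 * (cmod (u $ k))\<^sup>2 else 0) + (if \<not> bit k 0 then q0 * (cmod (u $ k))\<^sup>2 else 0))"
    by (rule sum.cong) auto
  also have "\<dots> = q1 * mass (\<lambda>i. bit i 0) u + q0 * mass (\<lambda>i. \<not> bit i 0) u"
  proof -
    have "(\<Sum>k<2 ^ N. if E k then c * (cmod (u $ k))\<^sup>2 else 0) = c * mass E u" for c E
      unfolding mass_def u sum_distrib_left by (subst sum.inter_filter[symmetric]) auto
    then show ?thesis unfolding sum.distrib by simp
  qed
  finally show ?thesis by (simp add: mass_Not)
qed

lemma horner_sum_less: "horner_sum of_bool 2 x < (2::nat) ^ (length x + a)"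
  by (rule less_le_trans[OF horner_sum_of_bool_2_less power_increasing]) auto

lemma norm_sq_input: "length x = n \<Longrightarrow> norm_sq (tensor_state n (ket x) a (ket0 a)) = 1"
  by (auto simp: tensor_ket_ket0 horner_sum_less intro!: norm_sq_unit_vec)

lemma EQP_with_affine:
  assumes L: "L \<in> EQP_with \<delta> \<epsilon>" and q: "0 \<le> q0" "q0 \<le> 1" "0 \<le> q1" "q1 \<le> 1"
  shows "L \<in> EQP_with (q0 * (1 - \<delta>) + q1 * \<delta>) (q0 * (1 - \<epsilon>) + q1 * \<epsilon>)"
proof -
  obtain a G gs where L': "describes (\<lambda>n. (n + a n, interp G (gs n))) G (\<lambda>n. n + a n) gs \<and>
     (\<forall>n. 0 < n + a n) \<and>
     (\<forall>n x. length x = n \<longrightarrow>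
        mass (\<lambda>i. bit i 0) (run_circuit (n + a n, interp G (gs n)) (tensor_state n (ket x) (a n) (ket0 (a n))))
        = (if x \<in> L then \<epsilon> else \<delta>))"
    using L unfolding EQP_with_iff by (elim exE) (rule that)
  note D = describesD[OF conjunct1[OF L']]
  define a' where "a' n = a n + 1" for n
  define gs' where "gs' n = gs n @ [(length G, [0, n + a n])]" for n
  define G' where "G' = G @ [affine_gate q0 q1]"
  have interp: "interp G' (gs' n) = interp G (gs n) @ [(affine_gate q0 q1, [0, n + a n])]" for n
    using D(3)[of n] by (simp add: G'_def gs'_def interp_append interp_append_left) (simp add: interp_def)
  have pos: "0 < n + a n" for n using L' by simp
  show ?thesis
    unfolding EQP_with_iff
  proof (intro exI conjI allI impI)
    show "describes (\<lambda>n. (n + a' n, interp G' (gs' n))) G' (\<lambda>n. n + a' n) gs'"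
      unfolding describes_def
    proof (intro conjI allI)
      have "punary (\<lambda>n. (n + a n) + 1)" by (rule ptime_unary_add[OF D(1) ptime_const])
      then show "punary (\<lambda>n. n + a' n)" by (simp add: a'_def)
      have "punary (\<lambda>n. 0)" by (rule ptime_const)
      then show "pgates gs'" unfolding gs'_def by (intro pgates_append pgates_single2 D(1,2))
      show "gates_below (length G') (gs' n)" for n
        using D(3)[of n] unfolding gs'_def G'_def by (auto simp: gates_below_def)
      have "gate_wf (n + a' n) (affine_gate q0 q1, [0, n + a n])" for n
        using pos[of n] unitary_affine_gate[OF q] by (auto simp: gate_wf_def a'_def)
      then show "circuit_wf (n + a' n, interp G' (gs' n))" for n
        unfolding interp circuit_wf_append
        using circuit_wf_mono[OF D(5)[of n], of "n + a' n"] by (auto simp: circuit_wf_def a'_def)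
    qed simp
    show "0 < n + a' n" for n by (simp add: a'_def)
  next
    fix n and x :: "bool list" assume x: "length x = n"
    define N where "N = n + a n"
    let ?s = "tensor_state n (ket x) (a n) (ket0 (a n))"
    define u where "u = run_circuit (N, interp G (gs n)) ?s"
    have N: "n + a' n = N + 1" "0 < N" using pos[of n] by (simp_all add: N_def a'_def)
    have wf: "circuit_wf (N, interp G (gs n))" using D(5)[of n] by (simp add: N_def)
    have du: "dim_vec u = 2 ^ N" by (simp add: u_def N_def)
    \<comment> \<open>Unit norm turns the rejecting mass into 1 - p.\<close>
    have nu: "norm_sq u = 1"
      unfolding u_def using norm_sq_run_circuit[OF wf, of ?s] norm_sq_input[OF x] by (simp add: N_def)
    have mu: "mass (\<lambda>i. bit i 0) u = (if x \<in> L then \<epsilon> else \<delta>)"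
      using L' x by (auto simp: u_def N_def)
    have "tensor_state n (ket x) (a' n) (ket0 (a' n)) = tensor_state N ?s 1 (ket0 1)"
      unfolding N_def a'_def tensor_assoc tensor_ket0_ket0 ..
    then have "run_circuit (n + a' n, interp G' (gs' n)) (tensor_state n (ket x) (a' n) (ket0 (a' n)))
      = gate_mat (N + 1) (affine_gate q0 q1, [0, N]) *\<^sub>v tensor_state N u 1 (ket0 1)"
      using run_tensor_low[OF wf, of ?s 1 "ket0 1"]
      unfolding interp run_circuit_append N u_def by (simp add: N_def)
    then show "mass (\<lambda>i. bit i 0) (run_circuit (n + a' n, interp G' (gs' n)) (tensor_state n (ket x) (a' n) (ket0 (a' n))))
        = (if x \<in> L then q0 * (1 - \<epsilon>) + q1 * \<epsilon> else q0 * (1 - \<delta>) + q1 * \<delta>)"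
      using mass_affine_gate[OF N(2) du q] nu mu by simp
  qed
qed


section \<open>Amplification\<close>

lemma tensor_unit_vec:
  assumes "j < 2 ^ (n + r)"
  shows "tensor_state n (unit_vec (2 ^ n) (take_bit n j)) r (unit_vec (2 ^ r) (drop_bit n j)) = unit_vec (2 ^ (n + r)) j"
proof (rule eq_vecI)
  fix i assume "i < dim_vec (unit_vec (2 ^ (n + r)) j :: complex vec)"
  then have i: "i < 2 ^ (n + r)" by simp
  have "i = j \<longleftrightarrow> take_bit n i = take_bit n j \<and> drop_bit n i = drop_bit n j"
    by (metis bits_ident)
  then show "tensor_state n (unit_vec (2 ^ n) (take_bit n j)) r (unit_vec (2 ^ r) (drop_bit n j)) $ i
      = unit_vec (2 ^ (n + r)) j $ i"
    using i assms by (simp add: tensor_state_index drop_bit_less)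
qed simp

lemma fold_act_less: "i < 2 ^ m \<Longrightarrow> fold (act m) cs i < 2 ^ m"
  by (induction cs arbitrary: i) auto

section \<open>Classical copying and comparison\<close>

definition copy_circuit :: "nat \<Rightarrow> ((nat \<Rightarrow> nat) \<times> nat list) list" where
  "copy_circuit n = map (\<lambda>i. (cnot, [i, n + i])) [0..<n]"

text \<open>Running disjunctions: wire \<open>n + N\<close> stays 0 and starts the ladder, and wire
  \<open>n + N + i + 1\<close> collects the disjunction of the first \<open>i + 1\<close> wires of
  the second register. This takes \<open>N + 1\<close> work wires, the last being
  \<open>n + 2 * N\<close>.\<close>

definition or_circuit :: "nat \<Rightarrow> nat \<Rightarrow> ((nat \<Rightarrow> nat) \<times> nat list) list" where
  "or_circuit n N = map (\<lambda>i. (or_into, [n + i, n + N + i, n + N + i + 1])) [0..<N]"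

lemma bit_fold_copy:
  assumes "2 * n \<le> M" "i < 2 ^ M"
  shows "bit (fold (act M) (copy_circuit n) i) w \<longleftrightarrow>
     (if n \<le> w \<and> w < 2 * n then bit i w \<noteq> bit i (w - n) else bit i w)"
proof -
  have "bit (fold (act M) (map (\<lambda>i. (cnot, [i, n + i])) [0..<k]) i) w \<longleftrightarrow>
     (if n \<le> w \<and> w < n + k then bit i w \<noteq> bit i (w - n) else bit i w)" if "k \<le> n" for k w
    using that
  proof (induction k arbitrary: w)
    case 0
    then show ?case by auto
  next
    case (Suc k)
    have "n + k < M" using Suc.prems assms by simp
    then show ?case using Suc bit_less_imp[OF assms(2), of w]
      by (auto simp: bit_act_cnot less_Suc_eq)
  qed
  from this[of n] show ?thesis by (simp add: copy_circuit_def mult_2)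
qed

text \<open>The bound on \<open>i\<close> says that the work wires start at 0. The induction has to
  describe every wire: after \<open>k\<close> rungs the work wires up to number \<open>k\<close>
  hold their disjunctions and the later ones are still 0.\<close>

lemma bit_fold_or:
  assumes "n + 2 * N < M" "i < 2 ^ (n + N)"
  shows "bit (fold (act M) (or_circuit n N) i) (n + 2 * N) \<longleftrightarrow> (\<exists>j<N. bit i (n + j))"
proof -
  let ?c = "n + N"
  have "bit (fold (act M) (map (\<lambda>i. (or_into, [n + i, n + N + i, n + N + i + 1])) [0..<k]) i) w \<longleftrightarrow>
     (if w < ?c then bit i w else if w \<le> ?c + k then (\<exists>j<w - ?c. bit i (n + j)) else False)" if "k \<le> N" for k w
    using that
  proof (induction k arbitrary: w)
    case 0
    then show ?case using bit_less_imp[OF assms(2), of w] by auto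
  next
    case (Suc k)
    let ?f = "fold (act M) (map (\<lambda>i. (or_into, [n + i, n + N + i, n + N + i + 1])) [0..<k]) i"
    have IH: "bit ?f w \<longleftrightarrow> (if w < ?c then bit i w else if w \<le> ?c + k then (\<exists>j<w - ?c. bit i (n + j)) else False)" for w
      using Suc by simp
    have "distinct [n + k, ?c + k, ?c + k + 1]" using Suc.prems by simp
    note step = bit_act_or[OF this, of M ?f w]
    have eq: "fold (act M) (map (\<lambda>i. (or_into, [n + i, n + N + i, n + N + i + 1])) [0..<Suc k]) i
       = act M (or_into, [n + k, ?c + k, ?c + k + 1]) ?f" by simp
    have kM: "?c + k + 1 < M" and kN: "k < N" using Suc.prems assms(1) by simp_all
    show ?case
    proof (cases "w = ?c + k + 1")
      case True
      have "(\<exists>j<k + 1. bit i (n + j)) \<longleftrightarrow> bit i (n + k) \<or> (\<exists>j<k. bit i (n + j))"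
        by (auto simp: less_Suc_eq)
      then show ?thesis unfolding eq step IH using True kM kN by simp
    next
      case False
      have "(if w < ?c then bit i w else if w \<le> ?c + k then (\<exists>j<w - ?c. bit i (n + j)) else False) \<Longrightarrow> w < M"
        using kM bit_less_imp[OF assms(2), of w] by (auto split: if_splits)
      then show ?thesis unfolding eq step IH using False kM by auto
    qed
  qed
  from this[of N "n + 2 * N"] show ?thesis unfolding or_circuit_def by simp
qed

text \<open>All qubits of the second register agree with \<open>x\<close> and its remaining qubits vanish exactly if
  the computation has returned to its initial state.\<close>

lemma bit_fold_test:
  assumes N: "n \<le> N" "0 < N" and M: "M = n + (N + (N + 1))"
    and i: "i < 2 ^ (n + N)" "take_bit n i = X" and X: "X < 2 ^ n"
  shows "bit (fold (act M) (copy_circuit n @ or_circuit n N @ [(swap_bits, [0, n + 2 * N])]) i) 0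
    \<longleftrightarrow> take_bit N (drop_bit n i) \<noteq> X"
proof -
  let ?j = "fold (act M) (copy_circuit n) i"
  have iM: "i < 2 ^ M" by (rule less_le_trans[OF i(1) power_increasing]) (simp_all add: M)
  note copy = bit_fold_copy[OF _ iM, of n]
  \<comment> \<open>The copy writes below \<open>2 * n \<le> n + N\<close>, so the work wires remain
    0.\<close>
  have j: "?j < 2 ^ (n + N)"
  proof -
    have "?j = nat_of (n + N) (bit ?j)"
    proof (rule bit_eqI)
      fix w
      have "bit ?j w \<Longrightarrow> w < n + N"
        using copy[of w] N M bit_less_imp[OF i(1), of w] by (auto split: if_splits)
      then show "bit ?j w = bit (nat_of (n + N) (bit ?j)) w" by auto
    qed
    then show ?thesis by (metis nat_of_less)
  qed
  have Xb: "bit X t \<longleftrightarrow> t < n \<and> bit i t" for t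
    using i(2) by (auto simp: bit_take_bit_iff)
  have "bit (fold (act M) (copy_circuit n @ or_circuit n N @ [(swap_bits, [0, n + 2 * N])]) i) 0
      \<longleftrightarrow> bit (fold (act M) (or_circuit n N) ?j) (n + 2 * N)"
    using N M by (simp add: bit_act_swap)
  also have "\<dots> \<longleftrightarrow> (\<exists>t<N. bit ?j (n + t))"
    by (rule bit_fold_or[OF _ j]) (simp add: M)
  \<comment> \<open>The copy adds the input modulo 2 to the second register, so a nonzero qubit
    there betrays a difference from \<open>X\<close>.\<close>
  also have "\<dots> \<longleftrightarrow> (\<exists>t<N. bit (take_bit N (drop_bit n i)) t \<noteq> bit X t)"
    using copy N M by (auto simp: bit_take_bit_iff bit_drop_bit_eq Xb)
  also have "\<dots> \<longleftrightarrow> take_bit N (drop_bit n i) \<noteq> X"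
  proof -
    have "X < 2 ^ N" using X by (rule less_le_trans) (use N in simp)
    then show ?thesis using nat_bit_eqI[of "take_bit N (drop_bit n i)" N X] by auto
  qed
  finally show ?thesis .
qed

lemma classical_wf_copy: "2 * n \<le> M \<Longrightarrow> \<forall>c \<in> set (copy_circuit n). classical_wf M c"
  by (auto simp: copy_circuit_def classical_wf_def numeral_2_eq_2[symmetric])

lemma classical_wf_or: "n + 2 * N < M \<Longrightarrow> \<forall>c \<in> set (or_circuit n N). classical_wf M c"
  by (auto simp: or_circuit_def classical_wf_def numeral_3_eq_3[symmetric])

text \<open>On a zero register, adding \<open>x\<close> modulo 2 is copying. The second register
  then holds the initial state on which the given circuit is meant to run: \<open>x\<close> followed
  by zero ancillas, as an \<open>N\<close>-bit index.\<close>

lemma run_copy: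
  assumes x: "length x = n" and nN: "n \<le> N"
  shows "run_circuit (n + (N + R), map of_classical (copy_circuit n)) (tensor_state n (ket x) (N + R) (ket0 (N + R)))
    = tensor_state n (ket x) (N + R) (tensor_state N (unit_vec (2 ^ N) (horner_sum of_bool 2 x)) R (ket0 R))"
proof -
  let ?X = "horner_sum of_bool 2 x :: nat" and ?M = "n + (N + R)"
  let ?j = "fold (act ?M) (copy_circuit n) ?X"
  have X: "?X < 2 ^ n" using horner_sum_of_bool_2_less[of x] x by simp
  have XM: "?X < 2 ^ ?M" using horner_sum_less[of x "N + R"] x by simp
  have XN: "?X < 2 ^ N" using X by (rule less_le_trans) (use nN in simp)
  have Xb: "\<not> bit ?X t" if "n \<le> t" for t using bit_less_imp[OF X, of t] that by auto
  note copy = bit_fold_copy[OF _ XM, of n]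
  have j1: "take_bit n ?j = ?X"
  proof (rule bit_eqI)
    show "bit (take_bit n ?j) t = bit ?X t" for t
      using copy[of t] nN Xb[of t] by (cases "t < n") (simp_all add: bit_take_bit_iff)
  qed
  have j2: "drop_bit n ?j = ?X"
  proof (rule bit_eqI)
    show "bit (drop_bit n ?j) t = bit ?X t" for t
      using copy[of "n + t"] nN Xb[of "n + t"] Xb[of t] by (cases "t < n") (simp_all add: bit_drop_bit_eq)
  qed
  have jM: "?j < 2 ^ ?M" using XM by (rule fold_act_less)
  have "run_circuit (?M, map of_classical (copy_circuit n)) (tensor_state n (ket x) (N + R) (ket0 (N + R)))
      = unit_vec (2 ^ ?M) ?j"
    using classical_circuit_unit_vec[OF classical_wf_copy XM, of n] x nN tensor_ket_ket0[of x "N + R"] by simp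
  also have "\<dots> = tensor_state n (ket x) (N + R) (unit_vec (2 ^ (N + R)) ?X)"
    using tensor_unit_vec[OF jM] x by (simp add: j1 j2 ket_def)
  also have "unit_vec (2 ^ (N + R)) ?X = tensor_state N (unit_vec (2 ^ N) ?X) R (ket0 R)"
  proof -
    have "?X < 2 ^ (N + R)" using XN by (rule less_le_trans) simp
    moreover have "drop_bit N ?X = 0" using XN by (simp add: drop_bit_eq_div)
    ultimately show ?thesis using tensor_unit_vec[of ?X N R] XN by (simp add: take_bit_nat_eq_self ket0_eq)
  qed
  finally show ?thesis .
qed

text \<open>Reflecting about the accepting subspace between a computation and its inverse leaves the
  amplitude \<open>1 - 2 * p\<close> on the initial state.\<close>

lemma reflect_and_undo:
  fixes N :: nat and W
  defines "W' \<equiv> W @ [(z_gate, [0])] @ rev (map (\<lambda>(U, ws). (reverse_gate U, rev ws)) W)"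
  assumes W: "circuit_wf (N, W)" and N: "0 < N" and X: "X < 2 ^ N"
  shows "circuit_wf (N, W')"
    and "mass (\<lambda>i. i \<noteq> X) (run_circuit (N, W') (unit_vec (2 ^ N) X))
      = (let p = mass (\<lambda>i. bit i 0) (run_circuit (N, W) (unit_vec (2 ^ N) X)) in 4 * p * (1 - p))"
proof -
  let ?h = "\<lambda>(U, ws). (reverse_gate U, rev ws)"
  let ?e = "unit_vec (2 ^ N) X :: complex vec"
  have z: "gate_wf N (z_gate, [0])" using N unitary_z_gate by (simp add: gate_wf_def)
  have rev: "circuit_wf (N, rev (map ?h W))"
    using W by (auto simp: circuit_wf_def intro!: gate_wf_reverse_gate)
  show wf: "circuit_wf (N, W')"
    unfolding W'_def circuit_wf_append using W z rev by (simp add: circuit_wf_def)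
  define \<psi> where "\<psi> = run_circuit (N, W) ?e"
  define \<psi>' where "\<psi>' = gate_mat N (z_gate, [0]) *\<^sub>v \<psi>"
  define \<phi> where "\<phi> = run_circuit (N, W') ?e"
  define p where "p = mass (\<lambda>i. bit i 0) \<psi>"
  have \<phi>: "\<phi> = run_circuit (N, rev (map ?h W)) \<psi>'"
    by (simp add: \<phi>_def W'_def \<psi>'_def \<psi>_def run_circuit_append)
  have dim: "dim_vec \<psi> = 2 ^ N" "dim_vec \<psi>' = 2 ^ N" "dim_vec \<phi> = 2 ^ N"
    by (simp_all add: \<psi>_def \<psi>'_def \<phi>_def)
  have norm: "norm_sq \<psi> = 1" "norm_sq \<phi> = 1"
    unfolding \<psi>_def \<phi>_def using norm_sq_run_circuit[OF W, of ?e] norm_sq_run_circuit[OF wf, of ?e] X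
    by (simp_all add: norm_sq_unit_vec)
  have adj: "gate_mat N (?h g) = mat_adjoint (gate_mat N g)" if "g \<in> set W" for g
  proof -
    obtain U ws where g: "g = (U, ws)" by (cases g)
    have "gate_wf N g" using W that by (auto simp: circuit_wf_def)
    then have "U \<in> carrier_mat (2 ^ length ws) (2 ^ length ws)"
      by (auto simp: g gate_wf_def unitary_mat_def)
    then show ?thesis by (simp add: g gate_mat_reverse_gate)
  qed
  \<comment> \<open>Moving the inverse circuit to the left side turns the amplitude into the
    expectation of Z in \<open>\<psi>\<close>, in which accepting mass counts -1 and rejecting mass
    +1.\<close>
  have "\<phi> $ X = (\<Sum>i<2 ^ N. if i = X then \<phi> $ i else 0)" using X by simp
  also have "\<dots> = cinner ?e \<phi>"
    unfolding cinner_def dim using X by (intro sum.cong) auto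
  also have "\<dots> = cinner \<psi> \<psi>'"
    unfolding \<phi> \<psi>_def[symmetric] using cinner_run_circuit[of W N ?h ?e \<psi>'] adj dim
    by (simp add: \<psi>_def)
  also have "\<dots> = (\<Sum>i<2 ^ N. complex_of_real ((cmod (\<psi> $ i))\<^sup>2 - 2 * (if bit i 0 then (cmod (\<psi> $ i))\<^sup>2 else 0)))"
    unfolding cinner_def dim
  proof (rule sum.cong)
    fix i assume "i \<in> {..<(2::nat) ^ N}"
    then have "\<psi>' $ i = (if bit i 0 then - (\<psi> $ i) else \<psi> $ i)"
      unfolding \<psi>'_def by (intro z_gate_apply[OF N dim(1)]) simp
    moreover have "cnj (\<psi> $ i) * \<psi> $ i = complex_of_real ((cmod (\<psi> $ i))\<^sup>2)"
      by (simp add: complex_norm_square mult.commute del: of_real_power)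
    ultimately show "cnj (\<psi> $ i) * \<psi>' $ i
        = complex_of_real ((cmod (\<psi> $ i))\<^sup>2 - 2 * (if bit i 0 then (cmod (\<psi> $ i))\<^sup>2 else 0))"
      by (simp del: of_real_power)
  qed simp
  also have "\<dots> = complex_of_real (norm_sq \<psi> - 2 * p)"
  proof -
    have "p = (\<Sum>i<2 ^ N. if bit i 0 then (cmod (\<psi> $ i))\<^sup>2 else 0)"
      unfolding p_def mass_def dim by (subst sum.inter_filter[symmetric]) auto
    moreover have "norm_sq \<psi> = (\<Sum>i<2 ^ N. (cmod (\<psi> $ i))\<^sup>2)"
      by (simp add: norm_sq_def dim)
    ultimately show ?thesis by (simp only: sum_subtractf sum_distrib_left of_real_sum[symmetric])
  qed
  finally have "\<phi> $ X = complex_of_real (1 - 2 * p)" unfolding norm .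
  then have amp: "(cmod (\<phi> $ X))\<^sup>2 = (1 - 2 * p)\<^sup>2"
    by (simp only: norm_of_real power2_abs)
  have "mass (\<lambda>i. i = X) \<phi> = (\<Sum>i \<in> {X}. (cmod (\<phi> $ i))\<^sup>2)"
    unfolding mass_def dim by (rule sum.cong) (use X in auto)
  \<comment> \<open>Failing to return has probability 1 - (1 - 2 * p) ^ 2.\<close>
  then have "mass (\<lambda>i. i \<noteq> X) \<phi> = 4 * p * (1 - p)"
    using mass_Not[of "\<lambda>i. i = X" \<phi>] norm amp by (simp add: power2_eq_square algebra_simps)
  then show "mass (\<lambda>i. i \<noteq> X) (run_circuit (N, W') ?e)
      = (let p = mass (\<lambda>i. bit i 0) (run_circuit (N, W) ?e) in 4 * p * (1 - p))"
    by (simp add: Let_def p_def \<psi>_def \<phi>_def)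
qed

text \<open>Acceptance means that the test finds the second register changed. The first register is
  the reference for this test and only ever a control, until the final swap brings the verdict to
  wire 0; the work wires may keep their contents, as only probabilities count.\<close>

lemma EQP_with_amplify:
  assumes L: "L \<in> EQP_with \<delta> \<epsilon>"
  shows "L \<in> EQP_with (4 * \<delta> * (1 - \<delta>)) (4 * \<epsilon> * (1 - \<epsilon>))"
proof -
  obtain a G gs where L': "describes (\<lambda>n. (n + a n, interp G (gs n))) G (\<lambda>n. n + a n) gs \<and>
     (\<forall>n. 0 < n + a n) \<and>
     (\<forall>n x. length x = n \<longrightarrow>
        mass (\<lambda>i. bit i 0) (run_circuit (n + a n, interp G (gs n)) (tensor_state n (ket x) (a n) (ket0 (a n))))
        = (if x \<in> L then \<epsilon> else \<delta>))"
    using L unfolding EQP_with_iff by (elim exE) (rule that)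
  note D = describesD[OF conjunct1[OF L']]
  have pos: "0 < n + a n" for n using L' by simp
  let ?k = "length G"
  define N where "N n = n + a n" for n
  \<comment> \<open>The original input is followed by a full register for the circuit and by the
    \<open>N n + 1\<close> wires of the ladder.\<close>
  define a' where "a' n = N n + (N n + 1)" for n
  define R where "R = map reverse_gate G"
  define H where "H = [classical_gate 2 cnot, classical_gate 3 or_into, classical_gate 2 swap_bits, z_gate]"
  define G' where "G' = G @ R @ H"
  define copy where "copy n = map (\<lambda>i. (0::nat, [i, n + i])) [0..<n]" for n :: nat
  define test where "test n = map (\<lambda>i. (1::nat, [n + i, n + N n + i, n + N n + i + 1])) [0..<N n]" for n :: nat
  define rgs where "rgs n = rev (map (\<lambda>(g, ws). (g, rev ws)) (gs n))" for n
  \<comment> \<open>Offsets into \<open>G'\<close>: 0 for the given gates, \<open>?k\<close> for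
    their inverses, \<open>2 * ?k\<close> for the four fixed gates, numbered 0 to 3 as in
    \<open>H\<close>. The second occurrence of \<open>copy\<close> undoes the first if the
    computation has returned.\<close>
  define gs' where "gs' n = rename_gates (2 * ?k) (copy n) @
     shift_gates n (gs n @ rename_gates (2 * ?k) [(3, [0])] @ rename_gates ?k (rgs n)) @
     rename_gates (2 * ?k) (copy n) @ rename_gates (2 * ?k) (test n) @ rename_gates (2 * ?k) [(2, [0, n + 2 * N n])]" for n
  define W where "W n = interp G (gs n)" for n
  define W' where "W' n = W n @ [(z_gate, [0])] @ rev (map (\<lambda>(U, ws). (reverse_gate U, rev ws)) (W n))" for n
  define cl where "cl n = copy_circuit n @ or_circuit n (N n) @ [(swap_bits, [0, n + 2 * N n])]" for n
  have below_rgs: "gates_below ?k (rgs n)" for n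
    using D(3)[of n] by (fastforce simp: gates_below_def rgs_def)
  have interp_H: "interp G' (rename_gates (2 * ?k) hs) = interp H hs" for hs
    unfolding G'_def append_assoc[symmetric] by (rule interp_rename) (simp add: R_def)
  have interp_rgs: "interp G' (rename_gates ?k (rgs n)) = rev (map (\<lambda>(U, ws). (reverse_gate U, rev ws)) (W n))" for n
  proof -
    have "interp G' (rename_gates ?k (rgs n)) = interp (R @ H) (rgs n)"
      unfolding G'_def by (rule interp_rename) simp
    also have "\<dots> = interp R (rgs n)"
      using below_rgs by (intro interp_append_left) (simp add: R_def)
    also have "\<dots> = rev (map (\<lambda>(U, ws). (reverse_gate U, rev ws)) (W n))"
      using D(3)[of n] by (auto simp: interp_def rgs_def W_def R_def rev_map gates_below_def)
    finally show ?thesis .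
  qed
  have interp_gs: "interp G' (gs n) = W n" for n
    unfolding G'_def W_def by (rule interp_append_left) (rule D)
  have interp: "interp G' (gs' n) = map of_classical (copy_circuit n) @ shift_gates n (W' n) @ map of_classical (cl n)" for n
  proof -
    have "interp H (copy n) = map of_classical (copy_circuit n)"
      by (simp add: interp_def copy_def copy_circuit_def of_classical_def H_def numeral_2_eq_2)
    moreover have "interp H (test n) = map of_classical (or_circuit n (N n))"
      by (simp add: interp_def test_def or_circuit_def of_classical_def H_def numeral_3_eq_3)
    moreover have "interp H [(2, [0, n + 2 * N n])] = map of_classical [(swap_bits, [0, n + 2 * N n])]"
      by (simp add: interp_def of_classical_def H_def numeral_2_eq_2)
    moreover have "interp H [(3, [0])] = [(z_gate, [0])]"
      by (simp add: interp_def H_def)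
    ultimately show ?thesis
      unfolding gs'_def interp_append interp_shift interp_H interp_rgs interp_gs W'_def cl_def by simp
  qed
  have wfW: "circuit_wf (N n, W n)" for n using D(5)[of n] by (simp add: N_def W_def)
  \<comment> \<open>Well-formedness does not involve the initial state, so 0 is an arbitrary choice
    for it.\<close>
  have wfW': "circuit_wf (N n, W' n)" for n
    unfolding W'_def by (rule reflect_and_undo(1)[OF wfW, where X = 0]) (use pos[of n] in \<open>simp_all add: N_def\<close>)
  have M: "n + a' n = n + (N n + (N n + 1))" for n by (simp add: a'_def)
  have nN: "n \<le> N n" "0 < N n" for n using pos[of n] by (simp_all add: N_def)
  have wf_copy: "\<forall>c \<in> set (copy_circuit n). classical_wf (n + a' n) c" for n
    using nN[of n] by (intro classical_wf_copy) (simp add: a'_def)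
  have wf_cl: "\<forall>c \<in> set (cl n). classical_wf (n + a' n) c" for n
  proof -
    have "\<forall>c \<in> set (or_circuit n (N n)). classical_wf (n + a' n) c"
      by (intro classical_wf_or) (simp add: a'_def)
    moreover have "classical_wf (n + a' n) (swap_bits, [0, n + 2 * N n])"
      using nN[of n] by (simp add: classical_wf_def a'_def numeral_2_eq_2[symmetric])
    ultimately show ?thesis using wf_copy by (auto simp: cl_def)
  qed
  have wf_of: "circuit_wf (m, map of_classical cs)" if "\<forall>c \<in> set cs. classical_wf m c" for m cs
    using that by (auto simp: circuit_wf_def gate_wf_of_classical)
  show ?thesis
    unfolding EQP_with_iff
  proof (intro exI conjI allI impI)
    show "describes (\<lambda>n. (n + a' n, interp G' (gs' n))) G' (\<lambda>n. n + a' n) gs'"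
      unfolding describes_def
    proof (intro conjI allI)
      have N: "punary N" using D(1) by (simp add: N_def[abs_def])
      have one: "punary (\<lambda>n. 1)" and zero: "punary (\<lambda>n. 0)" by (rule ptime_const)+
      have NN: "punary (\<lambda>n. n + 2 * N n)"
        using ptime_unary_add[OF ptime_unary ptime_unary_add[OF N N]] by (simp add: mult_2)
      show "punary (\<lambda>n. n + a' n)"
        using ptime_unary_add[OF ptime_unary ptime_unary_add[OF N ptime_unary_add[OF N one]]] by (simp add: a'_def)
      have "pgates copy"
        using pgates_ladder[OF ptime_unary ptime_unary zero, of 0 "[(0, 0, 0), (1, 0, 0)]"]
        by (simp add: copy_def[abs_def] add.commute)
      moreover have "pgates test"
        using pgates_ladder[OF N ptime_unary N, of 1 "[(1, 0, 0), (1, 1, 0), (1, 1, 1)]"]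
        by (simp add: test_def[abs_def] ac_simps)
      moreover have "pgates rgs" unfolding rgs_def by (rule pgates_reverse[OF D(2)])
      ultimately show "pgates gs'"
        unfolding gs'_def
        by (intro pgates_append pgates_rename_gates pgates_shift_gates pgates_single1 pgates_single2 ptime_unary D(2) NN zero)
      have "gates_below 4 (copy n)" "gates_below 4 (test n)" for n
        by (auto simp: gates_below_def copy_def test_def)
      moreover have "gates_below 4 [(2, [0, n + 2 * N n])]" "gates_below 4 [(3, [0])]" for n
        by (simp_all add: gates_below_def)
      moreover have len: "length G' = 2 * ?k + 4" by (simp add: G'_def R_def H_def)
      ultimately show "gates_below (length G') (gs' n)" for n
        unfolding gs'_def gates_below_append gates_below_shift
        using gates_below_rename[of 4 _ "2 * ?k" "length G'"]
          gates_below_rename[OF below_rgs[of n], of ?k "length G'"] gates_below_mono[OF D(3)[of n], of "length G'"]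
        by (simp add: len)
      have "circuit_wf (n + N n, shift_gates n (W' n))" for n by (rule circuit_wf_shift[OF wfW'])
      then have "circuit_wf (n + a' n, shift_gates n (W' n))" for n
        by (rule circuit_wf_mono) (simp add: a'_def)
      then show "circuit_wf (n + a' n, interp G' (gs' n))" for n
        unfolding interp circuit_wf_append using wf_of[OF wf_copy] wf_of[OF wf_cl] by blast
    qed simp
    show "0 < n + a' n" for n by (simp add: a'_def)
  next
    fix n and x :: "bool list" assume x: "length x = n"
    let ?X = "horner_sum of_bool 2 x :: nat" and ?N = "N n" and ?M = "n + a' n"
    let ?e = "unit_vec (2 ^ ?N) ?X :: complex vec"
    let ?T = "tensor_state n (ket x) (?N + (?N + 1))"
    let ?\<phi> = "run_circuit (?N, W' n) ?e"
    let ?s = "?T (tensor_state ?N ?\<phi> (?N + 1) (ket0 (?N + 1)))"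
    have Xn: "?X < 2 ^ n" using horner_sum_of_bool_2_less[of x] x by simp
    have XN: "?X < 2 ^ ?N" using horner_sum_less[of x "a n"] x by (simp add: N_def)
    have e: "?e = tensor_state n (ket x) (a n) (ket0 (a n))"
      using tensor_ket_ket0[of x "a n"] x by (simp add: N_def)
    have p: "mass (\<lambda>i. bit i 0) (run_circuit (?N, W n) ?e) = (if x \<in> L then \<epsilon> else \<delta>)"
      using L' x unfolding e by (auto simp: N_def W_def)
    have test: "mass (\<lambda>i. i \<noteq> ?X) ?\<phi>
        = (if x \<in> L then 4 * \<epsilon> * (1 - \<epsilon>) else 4 * \<delta> * (1 - \<delta>))"
      using reflect_and_undo(2)[OF wfW nN(2) XN] p unfolding W'_def by (simp add: Let_def)
    have "run_circuit (?M, shift_gates n (W' n)) (?T (tensor_state ?N ?e (?N + 1) (ket0 (?N + 1)))) = ?s"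
      unfolding M
      by (subst run_tensor_high[OF circuit_wf_mono[OF wfW']], simp, simp, subst run_tensor_low[OF wfW']) simp_all
    then have "run_circuit (?M, interp G' (gs' n)) (tensor_state n (ket x) (a' n) (ket0 (a' n)))
       = run_circuit (?M, map of_classical (cl n)) ?s"
      unfolding interp run_circuit_append using run_copy[OF x nN(1), of "?N + 1"] by (simp only: M a'_def)
    then have "mass (\<lambda>i. bit i 0) (run_circuit (?M, interp G' (gs' n)) (tensor_state n (ket x) (a' n) (ket0 (a' n))))
       = mass (\<lambda>i. bit (fold (act ?M) (cl n) i) 0) ?s"
      using mass_classical_circuit[OF wf_cl] by (simp add: M)
    \<comment> \<open>Only the support of the state counts: there the first register holds
      \<open>x\<close> and the work wires are 0, which is what \<open>bit_fold_test\<close>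
      assumes.\<close>
    also have "\<dots> = mass (\<lambda>i. take_bit ?N (drop_bit n i) \<noteq> ?X) ?s"
    proof (rule mass_cong)
      fix i assume "i < dim_vec ?s" and nz: "?s $ i \<noteq> 0"
      then have i: "i < 2 ^ (n + (?N + (?N + 1)))" by simp
      have d: "drop_bit n i < 2 ^ (?N + (?N + 1))" by (rule drop_bit_less[OF i])
      have nz': "ket x $ take_bit n i \<noteq> 0" "ket0 (?N + 1) $ drop_bit ?N (drop_bit n i) \<noteq> 0"
        using nz unfolding tensor_state_index[OF i] tensor_state_index[OF d] by auto
      have "take_bit n i = ?X" using nz'(1) x by (auto simp: ket_def unit_vec_def split: if_splits)
      moreover have "drop_bit ?N (drop_bit n i) = 0"
        using nz'(2) drop_bit_less[OF d] by (auto simp: ket0_eq split: if_splits)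
      then have "i < 2 ^ (n + ?N)"
        by (simp add: drop_bit_eq_div div_eq_0_iff power_add flip: div_mult2_eq)
      ultimately show "bit (fold (act ?M) (cl n) i) 0 = (take_bit ?N (drop_bit n i) \<noteq> ?X)"
        unfolding cl_def using bit_fold_test[OF nN[of n] M[of n], of i ?X] Xn by blast
    qed
    \<comment> \<open>The event ignores the first register, whose state has norm 1.\<close>
    also have "\<dots> = (\<Sum>c<2 ^ n. (cmod (ket x $ c))\<^sup>2 *
        mass (\<lambda>j. take_bit ?N j \<noteq> ?X) (tensor_state ?N ?\<phi> (?N + 1) (ket0 (?N + 1))))"
      using mass_tensor_left[of "ket x" n "tensor_state ?N ?\<phi> (?N + 1) (ket0 (?N + 1))" "?N + (?N + 1)" "\<lambda>_ j. take_bit ?N j \<noteq> ?X"] x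
      by simp
    also have "\<dots> = norm_sq (ket x) * mass (\<lambda>j. take_bit ?N j \<noteq> ?X) (tensor_state ?N ?\<phi> (?N + 1) (ket0 (?N + 1)))"
      using x by (simp add: norm_sq_def sum_distrib_right)
    also have "norm_sq (ket x) = 1"
      using Xn x by (simp add: ket_def norm_sq_unit_vec)
    also have "mass (\<lambda>j. take_bit ?N j \<noteq> ?X) (tensor_state ?N ?\<phi> (?N + 1) (ket0 (?N + 1))) = mass (\<lambda>j. take_bit ?N j \<noteq> ?X) ?\<phi>"
      by (rule mass_tensor_ket0) simp
    also have "\<dots> = mass (\<lambda>j. j \<noteq> ?X) ?\<phi>"
      by (rule mass_cong) (simp add: take_bit_nat_eq_self)
    finally show "mass (\<lambda>i. bit i 0) (run_circuit (?M, interp G' (gs' n)) (tensor_state n (ket x) (a' n) (ket0 (a' n))))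
        = (if x \<in> L then 4 * \<epsilon> * (1 - \<epsilon>) else 4 * \<delta> * (1 - \<delta>))"
      using test by simp
  qed
qed

section \<open>Driving the two probabilities to 0 and 1\<close>

lemma EQP_with_complement: "L \<in> EQP_with \<delta> \<epsilon> \<Longrightarrow> L \<in> EQP_with (1 - \<delta>) (1 - \<epsilon>)"
  using EQP_with_affine[of L \<delta> \<epsilon> 1 0] by simp

lemma EQP_with_scale: "L \<in> EQP_with \<delta> \<epsilon> \<Longrightarrow> 0 \<le> c \<Longrightarrow> c \<le> 1 \<Longrightarrow> L \<in> EQP_with (c * \<delta>) (c * \<epsilon>)"
  using EQP_with_affine[of L \<delta> \<epsilon> 0 c] by simp

text \<open>The map \<open>p \<mapsto> 4 * p * (1 - p)\<close> fixes 0, sends 1/2 to 1, and at least doubles every \<open>p \<le> 1/2\<close>.\<close>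

lemma EQP_with_zero:
  assumes "L \<in> EQP_with 0 q" "0 < q" "q \<le> 1"
  shows "L \<in> EQP_with 0 1"
proof -
  \<comment> \<open>Scaling \<open>r\<close> to 1/2 and amplifying gives 4 * 1/2 * 1/2 = 1, while
    both maps fix 0.\<close>
  have half: "L \<in> EQP_with 0 1" if "L \<in> EQP_with 0 r" "1 / 2 \<le> r" for r
  proof -
    have "L \<in> EQP_with (1 / (2 * r) * 0) (1 / (2 * r) * r)"
      by (rule EQP_with_scale) (use that in auto)
    then have "L \<in> EQP_with 0 (1 / 2)" using that by simp
    from EQP_with_amplify[OF this] show ?thesis by simp
  qed
  \<comment> \<open>\<open>k\<close> counts doublings that suffice to reach 1/2; it depends on the
    starting probability and not on the input.\<close>
  have "L \<in> EQP_with 0 1" if "L \<in> EQP_with 0 r" "0 < r" "1 / 2 \<le> 2 ^ k * r" for k r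
    using that
  proof (induction k arbitrary: r)
    case 0
    then show ?case using half by simp
  next
    case (Suc k)
    show ?case
    proof (cases "1 / 2 \<le> r")
      case True
      then show ?thesis using half Suc.prems by simp
    next
      case False
      have "r * (2 * r) \<le> r * 1" using Suc.prems False by (intro mult_left_mono) auto
      then have r: "2 * r \<le> 4 * r * (1 - r)" by (simp add: algebra_simps)
      have "1 / 2 \<le> 2 ^ k * (2 * r)" using Suc.prems by simp
      also have "\<dots> \<le> 2 ^ k * (4 * r * (1 - r))" using r by (intro mult_left_mono) auto
      finally have "1 / 2 \<le> 2 ^ k * (4 * r * (1 - r))" .
      moreover have "0 < 4 * r * (1 - r)" using r Suc.prems by linarith
      ultimately show ?thesis using Suc.IH EQP_with_amplify[OF Suc.prems(1)] by simp
    qed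
  qed
  moreover obtain k where "1 / (2 * q) < 2 ^ k"
    using real_arch_pow[of 2] by auto
  then have "1 / 2 \<le> 2 ^ k * q" using assms by (simp add: field_simps)
  ultimately show ?thesis using assms by blast
qed

text \<open>Scaling the larger probability to 1/2 and amplifying makes exactly one of the two errors vanish.\<close>

lemma EQP_with_separate:
  assumes "L \<in> EQP_with \<delta> \<epsilon>" "0 \<le> \<delta>" "\<delta> \<le> 1" "0 \<le> \<epsilon>" "\<epsilon> \<le> 1" "\<delta> < \<epsilon>" "1 / 2 \<le> \<epsilon>"
  shows "L \<in> EQP_with ((1 - \<delta> / \<epsilon>)\<^sup>2) 0"
proof -
  \<comment> \<open>The factor is at most 1 because \<epsilon> \<ge> 1/2.\<close>
  have "L \<in> EQP_with (1 / (2 * \<epsilon>) * \<delta>) (1 / (2 * \<epsilon>) * \<epsilon>)"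
    by (rule EQP_with_scale) (use assms in auto)
  then have "L \<in> EQP_with (\<delta> / (2 * \<epsilon>)) (1 / 2)" using assms by simp
  from EQP_with_complement[OF EQP_with_amplify[OF this]]
  have "L \<in> EQP_with (1 - 4 * (\<delta> / (2 * \<epsilon>)) * (1 - \<delta> / (2 * \<epsilon>))) 0" by simp
  \<comment> \<open>With p = \<delta> / (2 * \<epsilon>) this is 1 - 4 * p * (1 - p) = (1 - 2 * p) ^
    2, which is positive as \<delta> < \<epsilon>.\<close>
  moreover have "1 - 4 * (\<delta> / (2 * \<epsilon>)) * (1 - \<delta> / (2 * \<epsilon>)) = (1 - \<delta> / \<epsilon>)\<^sup>2"
    using assms by (simp add: field_simps power2_eq_square)
  ultimately show ?thesis by simp
qed

text \<open>The circuits stay the same and only members and nonmembers change roles, in contrast to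
  \<open>EQP_with_complement\<close>, which flips the answers for a fixed language.\<close>

lemma EQP_with_Compl: "L \<in> EQP_with \<delta> \<epsilon> \<Longrightarrow> - L \<in> EQP_with \<epsilon> \<delta>"
proof -
  assume L: "L \<in> EQP_with \<delta> \<epsilon>"
  have "(if x \<in> L then \<epsilon> else \<delta>) = (if x \<in> - L then \<delta> else \<epsilon>)" for x by simp
  then show ?thesis using L unfolding EQP_with_iff by (simp only:)
qed

text \<open>If \<epsilon> < 1/2, scaling down cannot reach 1/2. But then 1 - \<epsilon> < 1 -
  \<delta> both exceed 1/2, and passing to the complement of L gives the larger of them to the
  members again, so that \<open>EQP_with_separate\<close> applies in either case.\<close>

lemma EQP_with_subset_EQP:
  assumes L: "L \<in> EQP_with \<delta> \<epsilon>" and "0 \<le> \<delta>" "\<delta> < \<epsilon>" "\<epsilon> \<le> 1"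
  shows "L \<in> EQP"
proof -
  have pos: "0 < (1 - \<delta> / \<epsilon>)\<^sup>2 \<and> (1 - \<delta> / \<epsilon>)\<^sup>2 \<le> 1" if "0 \<le> \<delta>" "\<delta> < \<epsilon>" for \<delta> \<epsilon> :: real
  proof -
    have "0 \<le> \<delta> / \<epsilon>" "\<delta> / \<epsilon> < 1" using that by auto
    then show ?thesis using that by (simp add: power_le_one)
  qed
  show ?thesis
  proof (cases "1 / 2 \<le> \<epsilon>")
    case True
    then have "L \<in> EQP_with ((1 - \<delta> / \<epsilon>)\<^sup>2) 0"
      using assms by (intro EQP_with_separate) auto
    then have "- L \<in> EQP_with 0 1"
      using EQP_with_zero[OF EQP_with_Compl] pos[of \<delta> \<epsilon>] assms by blast
    from EQP_with_complement[OF EQP_with_Compl[OF this]] show ?thesis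
      by (simp add: EQP_eq)
  next
    case False
    have "- L \<in> EQP_with (1 - \<epsilon>) (1 - \<delta>)"
      by (rule EQP_with_Compl[OF EQP_with_complement[OF L]])
    then have "- L \<in> EQP_with ((1 - (1 - \<epsilon>) / (1 - \<delta>))\<^sup>2) 0"
      using assms False by (intro EQP_with_separate) auto
    from EQP_with_Compl[OF this] have "L \<in> EQP_with 0 ((1 - (1 - \<epsilon>) / (1 - \<delta>))\<^sup>2)" by simp
    then have "L \<in> EQP_with 0 1"
      using EQP_with_zero pos[of "1 - \<epsilon>" "1 - \<delta>"] assms by auto
    then show ?thesis by (simp add: EQP_eq)
  qed
qed

theorem theorem5:
  shows "EQP = ERQP \<and> ERQP = EBQP"
proof -
  have "EQP \<subseteq> ERQP"
    unfolding ERQP_def ERQP_with_def using EQP_subset_EBQP_with by (intro order.trans[OF _ UN_upper[of 1]]) auto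
  moreover have "ERQP \<subseteq> EBQP"
    unfolding ERQP_def ERQP_with_def EBQP_def by force
  moreover have "EBQP \<subseteq> EQP"
    unfolding EBQP_def using EBQP_with_subset EQP_with_subset_EQP by fastforce
  ultimately show ?thesis by blast
qed

end
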